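(* Let $(X_n)_{n\ge0}$ be a $\phi$-irreducible Markov chain on $(\mathcal X,\mathcal F)$ with Markov kernel $P$, stationary measure $\pi$ and MH-spectral gap $\gamma^{MH}=1-\beta^{MH}$. Assume that $P(x,\cdot)$, $P^*(x,\cdot)$ ($x\in\mathcal X$) and $\pi$ are absolutely continuous with respect to a common reference measure $\mu$ on $(\mathcal X,\mathcal F)$, with densities $p(x,\cdot)$, $p^*(x,\cdot)$, $\pi(\cdot)$, and that $\{x:\pi(x)=0\}$ is a $\mu$-null set. Let $f\in L^2(\pi)$ and define $$V_f:=\mathrm{Var}_\pi(f),\qquad \sigma_{as}^2:=\lim_{n\to\infty}\frac1n\mathrm{Var}_\pi\left(\sum_{i=1}^nf(X_i)\right).$$ Then $$\mathrm{Var}_\pi\left(\sum_{i=1}^nf(X_i)\right)\le nV_f\left(|\mathcal C^c|+\frac2{\gamma^{MH}}\right),$$ $$\left|\mathrm{Var}_\pi\left(\sum_{i=1}^nf(X_i)\right)-n\sigma_{as}^2\right|\le 4V_f\left(1+|\mathcal C^c|+\frac{4(\beta^{MH})^{|\mathcal C^c|+1}}{\gamma^{MH}}\right)^2.$$ More generally, if $f_i\in L^2(\pi)$ for $i=1,\dots,n$, then $$\mathrm{Var}_\pi\left(\sum_{i=1}^nf_i(X_i)\right)\le\sum_{i=1}^n\mathrm{Var}_\pi(f_i(X_i))\left(|\mathcal C^c|+\frac2{\gamma^{MH}}\right).$$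
   Context: $\mathrm{Var}_\pi$ is variance when the chain is started from $X_0\sim\pi$. If $\gamma^{MH}=0$ or $|\mathcal C^c|=\infty$ the right-hand sides are read as $+\infty$ and nothing is asserted. $L^2(\pi)$ has inner product $\langle f,g\rangle_\pi=\int f\overline g\,d\pi$; $L^2_0(\pi)=\{f\in L^2(\pi):\int f\,d\pi=0\}$. The time-reversal $P^*$ is the adjoint of $P$ on $L^2(\pi)$: $\pi(dx)P^*(x,dy)=\pi(dy)P(y,dx)$. For a Markov kernel $R$ with stationary distribution $\pi$, with densities $r(x,\cdot)$ of $R(x,\cdot)$ and $r^*(x,\cdot)$ of $R^*(x,\cdot)$ with respect to $\mu$, the first and second Metropolis-Hastings (MH) kernels are $$M_1(R)(x,dy)=\min\{r(x,y),r^*(x,y)\}\mu(dy)+\rho_R(x)\delta_x(dy),\quad M_2(R)(x,dy)=\max\{r(x,y),r^*(x,y)\}\mu(dy)-\rho_R(x)\delta_x(dy),$$ where $\rho_R(x)=\int_{y\ne x}(r(x,y)-\min\{r(x,y),r^*(x,y)\})\mu(dy)$. They are self-adjoint on $L^2(\pi)$. For a self-adjoint operator $K$ with $\pi K=\pi$: $\lambda(K)=\inf\{\langle Kf,f\rangle_\pi:f\in L^2_0(\pi),\|f\|_\pi=1\}$ and $\Lambda(K)=\sup\{\langle Kf,f\rangle_\pi:f\in L^2_0(\pi),\|f\|_\pi=1\}$. MH-spectral gap: $\mathcal C:=\{n\in\mathbb N:|\lambda(M_2(P^n))|<1,\ \Lambda(M_1(P^n))<1\}$, $\mathcal C^c:=\mathbb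 N\setminus\mathcal C$; $\beta^{MH}:=1$ if $\mathcal C=\emptyset$, and otherwise $\beta^{MH}:=\sup_{n\in\mathcal C}\{|\lambda(M_2(P^n))|^{1/n},\Lambda(M_1(P^n))^{1/n}\}$ (supremum of both families; terms with $\Lambda(M_1(P^n))<0$ are omitted); $\gamma^{MH}:=1-\beta^{MH}$. *)

theory Defs
  imports "HOL-Probability.Probability"
begin

text \<open>
  Throughout, the measurable space is the one underlying the reference measure \<open>\<mu>\<close>.
  Markov kernels are elements of \<open>\<mu> \<rightarrow>\<^sub>M prob_algebra \<mu>\<close>, functions are complex valued, and
  \<open>L\<^sup>2\<close> consists of functions rather than of classes modulo null sets.
\<close>

section \<open>Kernels and Markov chains\<close>

primrec kernel_pow :: "'a measure \<Rightarrow> ('a \<Rightarrow> 'a measure) \<Rightarrow> nat \<Rightarrow> 'a \<Rightarrow> 'a measure" where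
  "kernel_pow \<mu> P 0 = return \<mu>"
| "kernel_pow \<mu> P (Suc n) = (\<lambda>x. P x \<bind> kernel_pow \<mu> P n)"

definition stationary :: "'a measure \<Rightarrow> ('a \<Rightarrow> 'a measure) \<Rightarrow> bool" where
  "stationary \<pi> P \<longleftrightarrow> \<pi> \<bind> P = \<pi>"

text \<open>\<open>\<pi>(dx) P\<^sup>*(x,dy) = \<pi>(dy) P(y,dx)\<close>, tested on measurable rectangles.\<close>

definition time_reversal :: "'a measure \<Rightarrow> ('a \<Rightarrow> 'a measure) \<Rightarrow> ('a \<Rightarrow> 'a measure) \<Rightarrow> bool" where
  "time_reversal \<pi> P Ps \<longleftrightarrow>
     (\<forall>A\<in>sets \<pi>. \<forall>B\<in>sets \<pi>.
        (\<integral>\<^sup>+x\<in>A. emeasure (Ps x) B \<partial>\<pi>) = (\<integral>\<^sup>+y\<in>B. emeasure (P y) A \<partial>\<pi>))"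

definition phi_irreducible :: "'a measure \<Rightarrow> 'a measure \<Rightarrow> ('a \<Rightarrow> 'a measure) \<Rightarrow> bool" where
  "phi_irreducible \<mu> \<phi> P \<longleftrightarrow>
     sets \<phi> = sets \<mu> \<and> sigma_finite_measure \<phi> \<and> emeasure \<phi> (space \<phi>) \<noteq> 0 \<and>
     (\<forall>A\<in>sets \<phi>. emeasure \<phi> A > 0 \<longrightarrow>
        (\<forall>x\<in>space \<phi>. \<exists>n\<ge>1. emeasure (kernel_pow \<mu> P n x) A > 0))"

definition history :: "'w measure \<Rightarrow> 'a measure \<Rightarrow> (nat \<Rightarrow> 'w \<Rightarrow> 'a) \<Rightarrow> nat \<Rightarrow> 'w measure" where
  "history W \<mu> X n =
     vimage_algebra (space W) (\<lambda>w. \<lambda>i\<in>{..n}. X i w) (\<Pi>\<^sub>M i\<in>{..n}. \<mu>)"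

definition markov_chain ::
    "'w measure \<Rightarrow> 'a measure \<Rightarrow> ('a \<Rightarrow> 'a measure) \<Rightarrow> (nat \<Rightarrow> 'w \<Rightarrow> 'a) \<Rightarrow> bool" where
  "markov_chain W \<mu> P X \<longleftrightarrow>
     prob_space W \<and> (\<forall>n. X n \<in> W \<rightarrow>\<^sub>M \<mu>) \<and>
     (\<forall>n. \<forall>A\<in>sets \<mu>. AE w in W.
        real_cond_exp W (history W \<mu> X n) (\<lambda>w. indicator A (X (Suc n) w)) w
          = measure (P (X n w)) A)"

definition cvariance :: "'w measure \<Rightarrow> ('w \<Rightarrow> complex) \<Rightarrow> real" where
  "cvariance W Y = (\<integral>w. (cmod (Y w - (\<integral>v. Y v \<partial>W)))\<^sup>2 \<partial>W)"

definition asymp_variance :: "'w measure \<Rightarrow> (nat \<Rightarrow> 'w \<Rightarrow> 'a) \<Rightarrow> ('a \<Rightarrow> complex) \<Rightarrow> real" where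
  "asymp_variance W X f = lim (\<lambda>n. cvariance W (\<lambda>w. \<Sum>i=1..n. f (X i w)) / real n)"

section \<open>\<open>L\<^sup>2(\<pi>)\<close> and quadratic forms\<close>

definition L2 :: "'a measure \<Rightarrow> ('a \<Rightarrow> complex) set" where
  "L2 \<pi> = {f \<in> borel_measurable \<pi>. integrable \<pi> (\<lambda>x. (cmod (f x))\<^sup>2)}"

definition L2_0 :: "'a measure \<Rightarrow> ('a \<Rightarrow> complex) set" where
  "L2_0 \<pi> = {f \<in> L2 \<pi>. (\<integral>x. f x \<partial>\<pi>) = 0}"

definition inner_L2 :: "'a measure \<Rightarrow> ('a \<Rightarrow> complex) \<Rightarrow> ('a \<Rightarrow> complex) \<Rightarrow> complex" where
  "inner_L2 \<pi> f g = (\<integral>x. f x * cnj (g x) \<partial>\<pi>)"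

definition norm_L2 :: "'a measure \<Rightarrow> ('a \<Rightarrow> complex) \<Rightarrow> real" where
  "norm_L2 \<pi> f = sqrt (Re (inner_L2 \<pi> f f))"

text \<open>
  The two functionals are only applied to self-adjoint operators, whose quadratic form is
  real; \<open>Re\<close> merely changes the type.
\<close>

definition spec_inf :: "'a measure \<Rightarrow> (('a \<Rightarrow> complex) \<Rightarrow> 'a \<Rightarrow> complex) \<Rightarrow> real" where
  "spec_inf \<pi> K = Inf {Re (inner_L2 \<pi> (K f) f) | f. f \<in> L2_0 \<pi> \<and> norm_L2 \<pi> f = 1}"

definition spec_sup :: "'a measure \<Rightarrow> (('a \<Rightarrow> complex) \<Rightarrow> 'a \<Rightarrow> complex) \<Rightarrow> real" where
  "spec_sup \<pi> K = Sup {Re (inner_L2 \<pi> (K f) f) | f. f \<in> L2_0 \<pi> \<and> norm_L2 \<pi> f = 1}"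

section \<open>Metropolis-Hastings kernels\<close>

text \<open>
  \<open>Rs\<close> is the time-reversal of \<open>R\<close>; the densities \<open>r(x,\<cdot>)\<close>, \<open>r\<^sup>*(x,\<cdot>)\<close> are taken to be
  Radon-Nikodym derivatives with respect to \<open>\<mu>\<close>, and nothing below depends on the versions. As
  \<open>M\<^sub>2\<close> may put negative mass on the diagonal, both kernels are given by their action on functions.
  If \<open>{x}\<close> is not measurable, the integral in \<open>mh_rho\<close> is the lower integral (a supremum over
  simple functions); otherwise it is the ordinary one.
\<close>

definition mh_rho ::
    "'a measure \<Rightarrow> ('a \<Rightarrow> 'a measure) \<Rightarrow> ('a \<Rightarrow> 'a measure) \<Rightarrow> 'a \<Rightarrow> real" where
  "mh_rho \<mu> R Rs x =
     enn2real (\<integral>\<^sup>+y\<in>space \<mu> - {x}.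
       (RN_deriv \<mu> (R x) y - min (RN_deriv \<mu> (R x) y) (RN_deriv \<mu> (Rs x) y)) \<partial>\<mu>)"

definition MH1 ::
    "'a measure \<Rightarrow> ('a \<Rightarrow> 'a measure) \<Rightarrow> ('a \<Rightarrow> 'a measure) \<Rightarrow> ('a \<Rightarrow> complex) \<Rightarrow> 'a \<Rightarrow> complex" where
  "MH1 \<mu> R Rs f x =
     (\<integral>y. of_real (enn2real (min (RN_deriv \<mu> (R x) y) (RN_deriv \<mu> (Rs x) y))) * f y \<partial>\<mu>)
       + of_real (mh_rho \<mu> R Rs x) * f x"

definition MH2 ::
    "'a measure \<Rightarrow> ('a \<Rightarrow> 'a measure) \<Rightarrow> ('a \<Rightarrow> 'a measure) \<Rightarrow> ('a \<Rightarrow> complex) \<Rightarrow> 'a \<Rightarrow> complex" where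
  "MH2 \<mu> R Rs f x =
     (\<integral>y. of_real (enn2real (max (RN_deriv \<mu> (R x) y) (RN_deriv \<mu> (Rs x) y))) * f y \<partial>\<mu>)
       - of_real (mh_rho \<mu> R Rs x) * f x"

section \<open>The MH-spectral gap\<close>

text \<open>
  The time-reversal of \<open>P\<^sup>n\<close> is entered as the \<open>n\<close>-th power of the time-reversal of \<open>P\<close>; see
  \<open>time_reversal_kernel_pow\<close> below. Exponents \<open>n\<close> range over the positive integers.
\<close>

definition lambda_MH2 ::
    "'a measure \<Rightarrow> 'a measure \<Rightarrow> ('a \<Rightarrow> 'a measure) \<Rightarrow> ('a \<Rightarrow> 'a measure) \<Rightarrow> nat \<Rightarrow> real" where
  "lambda_MH2 \<mu> \<pi> P Ps n = spec_inf \<pi> (MH2 \<mu> (kernel_pow \<mu> P n) (kernel_pow \<mu> Ps n))"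

definition Lambda_MH1 ::
    "'a measure \<Rightarrow> 'a measure \<Rightarrow> ('a \<Rightarrow> 'a measure) \<Rightarrow> ('a \<Rightarrow> 'a measure) \<Rightarrow> nat \<Rightarrow> real" where
  "Lambda_MH1 \<mu> \<pi> P Ps n = spec_sup \<pi> (MH1 \<mu> (kernel_pow \<mu> P n) (kernel_pow \<mu> Ps n))"

definition mh_C ::
    "'a measure \<Rightarrow> 'a measure \<Rightarrow> ('a \<Rightarrow> 'a measure) \<Rightarrow> ('a \<Rightarrow> 'a measure) \<Rightarrow> nat set" where
  "mh_C \<mu> \<pi> P Ps = {n. n \<ge> 1 \<and> \<bar>lambda_MH2 \<mu> \<pi> P Ps n\<bar> < 1 \<and> Lambda_MH1 \<mu> \<pi> P Ps n < 1}"

definition mh_Cc ::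
    "'a measure \<Rightarrow> 'a measure \<Rightarrow> ('a \<Rightarrow> 'a measure) \<Rightarrow> ('a \<Rightarrow> 'a measure) \<Rightarrow> nat set" where
  "mh_Cc \<mu> \<pi> P Ps = {1..} - mh_C \<mu> \<pi> P Ps"

definition mh_beta ::
    "'a measure \<Rightarrow> 'a measure \<Rightarrow> ('a \<Rightarrow> 'a measure) \<Rightarrow> ('a \<Rightarrow> 'a measure) \<Rightarrow> real" where
  "mh_beta \<mu> \<pi> P Ps =
     (if mh_C \<mu> \<pi> P Ps = {} then 1
      else Sup ({root n \<bar>lambda_MH2 \<mu> \<pi> P Ps n\<bar> | n. n \<in> mh_C \<mu> \<pi> P Ps} \<union>
                {root n (Lambda_MH1 \<mu> \<pi> P Ps n) | n.
                   n \<in> mh_C \<mu> \<pi> P Ps \<and> Lambda_MH1 \<mu> \<pi> P Ps n \<ge> 0}))"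

definition mh_gap ::
    "'a measure \<Rightarrow> 'a measure \<Rightarrow> ('a \<Rightarrow> 'a measure) \<Rightarrow> ('a \<Rightarrow> 'a measure) \<Rightarrow> real" where
  "mh_gap \<mu> \<pi> P Ps = 1 - mh_beta \<mu> \<pi> P Ps"

section \<open>Time-reversal commutes with powers\<close>

lemma kernel_pow_measurable:
  assumes P: "P \<in> \<mu> \<rightarrow>\<^sub>M prob_algebra \<mu>"
  shows "kernel_pow \<mu> P n \<in> \<mu> \<rightarrow>\<^sub>M prob_algebra \<mu>"
proof (induction n)
  case 0
  then show ?case by (simp add: measurable_return_prob_space)
next
  case (Suc n)
  show ?case unfolding kernel_pow.simps
    by (rule measurable_bind_prob_space[OF P Suc])
qed

lemma kernel_pow_Suc_right:
  assumes P: "P \<in> \<mu> \<rightarrow>\<^sub>M prob_algebra \<mu>" and x: "x \<in> space \<mu>"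
  shows "kernel_pow \<mu> P (Suc n) x = kernel_pow \<mu> P n x \<bind> P"
  using x
proof (induction n arbitrary: x)
  have Ps: "P \<in> \<mu> \<rightarrow>\<^sub>M subprob_algebra \<mu>"
    using P by (rule measurable_prob_algebraD)
  case 0
  have sP: "sets (P x) = sets \<mu>" by (rule sets_kernel[OF Ps 0])
  then have "return \<mu> = return (P x)" by (intro ext return_cong) simp
  then have "kernel_pow \<mu> P (Suc 0) x = P x"
    by (simp add: bind_return''[OF refl])
  also have "\<dots> = kernel_pow \<mu> P 0 x \<bind> P"
    using bind_return[OF Ps 0] by simp
  finally show ?case .
next
  case (Suc n)
  have Ps: "P \<in> \<mu> \<rightarrow>\<^sub>M subprob_algebra \<mu>"
    using P by (rule measurable_prob_algebraD)
  have Kn: "kernel_pow \<mu> P n \<in> \<mu> \<rightarrow>\<^sub>M subprob_algebra \<mu>"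
    using kernel_pow_measurable[OF P] by (rule measurable_prob_algebraD)
  have sP: "sets (P x) = sets \<mu>" by (rule sets_kernel[OF Ps Suc.prems])
  then have spP: "space (P x) = space \<mu>" by (rule sets_eq_imp_space_eq)
  have "kernel_pow \<mu> P (Suc (Suc n)) x = P x \<bind> kernel_pow \<mu> P (Suc n)" by simp
  also have "\<dots> = P x \<bind> (\<lambda>y. kernel_pow \<mu> P n y \<bind> P)"
    by (rule bind_cong[OF refl]) (use Suc.IH spP in \<open>simp del: kernel_pow.simps\<close>)
  also have "\<dots> = P x \<bind> kernel_pow \<mu> P n \<bind> P"
    by (subst bind_assoc[where N=\<mu> and R=\<mu>]) (use Kn Ps in \<open>simp_all add: measurable_cong_sets[OF sP refl]\<close>)
  finally show ?case by simp
qed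

lemma time_reversal_nn_integral:
  assumes P: "P \<in> \<mu> \<rightarrow>\<^sub>M prob_algebra \<mu>" and Ps: "Ps \<in> \<mu> \<rightarrow>\<^sub>M prob_algebra \<mu>"
    and s: "sets \<pi> = sets \<mu>" and rev: "time_reversal \<pi> P Ps"
    and f: "f \<in> borel_measurable \<mu>" and g: "g \<in> borel_measurable \<mu>"
  shows "(\<integral>\<^sup>+x. f x * (\<integral>\<^sup>+y. g y \<partial>Ps x) \<partial>\<pi>) = (\<integral>\<^sup>+y. g y * (\<integral>\<^sup>+x. f x \<partial>P y) \<partial>\<pi>)"
proof -
  have Pm[measurable]: "P \<in> \<pi> \<rightarrow>\<^sub>M subprob_algebra \<mu>" "Ps \<in> \<pi> \<rightarrow>\<^sub>M subprob_algebra \<mu>"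
    using P Ps by (simp_all add: measurable_prob_algebraD measurable_cong_sets[OF s refl])
  have sP: "sets (P y) = sets \<mu>" "sets (Ps y) = sets \<mu>" if "y \<in> space \<pi>" for y
    using sets_kernel[OF Pm(1) that] sets_kernel[OF Pm(2) that] by auto
  have sp: "space \<pi> = space \<mu>" using s by (rule sets_eq_imp_space_eq)
  have int_meas: "(\<lambda>y. \<integral>\<^sup>+x. h x \<partial>K y) \<in> borel_measurable \<pi>"
    if "K \<in> \<pi> \<rightarrow>\<^sub>M subprob_algebra \<mu>" "h \<in> borel_measurable \<mu>" for K and h :: "'a \<Rightarrow> ennreal"
    by (rule measurable_compose[OF that(1) nn_integral_measurable_subprob_algebra[OF that(2)]])
  have step: "(\<integral>\<^sup>+x. indicator A x * (\<integral>\<^sup>+y. g y \<partial>Ps x) \<partial>\<pi>)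
                = (\<integral>\<^sup>+y. g y * emeasure (P y) A \<partial>\<pi>)" if A: "A \<in> sets \<mu>" for A
    using g
  proof (induction g rule: borel_measurable_induct)
    case (cong f' g')
    have "(\<integral>\<^sup>+y. f' y \<partial>Ps x) = (\<integral>\<^sup>+y. g' y \<partial>Ps x)" if "x \<in> space \<pi>" for x
      by (rule nn_integral_cong) (use cong(3) sets_eq_imp_space_eq[OF sP(2)[OF that]] in auto)
    then have "(\<integral>\<^sup>+x. indicator A x * (\<integral>\<^sup>+y. f' y \<partial>Ps x) \<partial>\<pi>) =
        (\<integral>\<^sup>+x. indicator A x * (\<integral>\<^sup>+y. g' y \<partial>Ps x) \<partial>\<pi>)"
      by (intro nn_integral_cong) simp
    moreover have "(\<integral>\<^sup>+y. f' y * emeasure (P y) A \<partial>\<pi>) = (\<integral>\<^sup>+y. g' y * emeasure (P y) A \<partial>\<pi>)"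
      by (intro nn_integral_cong) (use cong(3) sp in simp)
    ultimately show ?case using cong by simp
  next
    case (set B)
    have "(\<integral>\<^sup>+x. indicator A x * (\<integral>\<^sup>+y. indicator B y \<partial>Ps x) \<partial>\<pi>)
       = (\<integral>\<^sup>+x\<in>A. emeasure (Ps x) B \<partial>\<pi>)"
      by (intro nn_integral_cong) (use set sP in \<open>simp add: mult.commute\<close>)
    also have "\<dots> = (\<integral>\<^sup>+y\<in>B. emeasure (P y) A \<partial>\<pi>)"
      using rev A set s unfolding time_reversal_def by auto
    finally show ?case by (simp add: mult.commute)
  next
    case (mult u c)
    have u: "u \<in> borel_measurable \<mu>" by fact
    have "(\<integral>\<^sup>+x. indicator A x * (\<integral>\<^sup>+y. c * u y \<partial>Ps x) \<partial>\<pi>) =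
          (\<integral>\<^sup>+x. c * (indicator A x * (\<integral>\<^sup>+y. u y \<partial>Ps x)) \<partial>\<pi>)"
    proof (intro nn_integral_cong)
      fix x assume "x \<in> space \<pi>"
      then have "u \<in> borel_measurable (Ps x)" using u sP by (metis measurable_cong_sets)
      then show "indicator A x * (\<integral>\<^sup>+y. c * u y \<partial>Ps x) = c * (indicator A x * (\<integral>\<^sup>+y. u y \<partial>Ps x))"
        by (simp add: nn_integral_cmult mult_ac)
    qed
    also have "\<dots> = c * (\<integral>\<^sup>+y. u y * emeasure (P y) A \<partial>\<pi>)"
      using int_meas[OF Pm(2) u] A s mult by (subst nn_integral_cmult) auto
    also have "\<dots> = (\<integral>\<^sup>+y. c * u y * emeasure (P y) A \<partial>\<pi>)"
      using u A s by (subst nn_integral_cmult[symmetric])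
        (auto simp: mult_ac measurable_cong_sets[OF s refl]
          intro!: borel_measurable_times_ennreal measurable_emeasure_kernel[OF Pm(1)])
    finally show ?case .
  next
    case (add u v)
    have uv: "u \<in> borel_measurable \<mu>" "v \<in> borel_measurable \<mu>" by fact+
    have uv': "u \<in> borel_measurable \<pi>" "v \<in> borel_measurable \<pi>"
      using uv by (auto simp: measurable_cong_sets[OF s refl])
    have A': "A \<in> sets \<pi>" using A s by simp
    have PA: "(\<lambda>y. emeasure (P y) A) \<in> borel_measurable \<pi>"
      using measurable_emeasure_kernel[OF Pm(1) A] .
    have "(\<integral>\<^sup>+x. indicator A x * (\<integral>\<^sup>+y. v y + u y \<partial>Ps x) \<partial>\<pi>) =
          (\<integral>\<^sup>+x. indicator A x * (\<integral>\<^sup>+y. v y \<partial>Ps x) + indicator A x * (\<integral>\<^sup>+y. u y \<partial>Ps x) \<partial>\<pi>)"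
    proof (intro nn_integral_cong)
      fix x assume "x \<in> space \<pi>"
      then have "u \<in> borel_measurable (Ps x)" "v \<in> borel_measurable (Ps x)"
        using uv sP by (metis measurable_cong_sets)+
      then show "indicator A x * (\<integral>\<^sup>+y. v y + u y \<partial>Ps x) =
          indicator A x * (\<integral>\<^sup>+y. v y \<partial>Ps x) + indicator A x * (\<integral>\<^sup>+y. u y \<partial>Ps x)"
        by (simp add: nn_integral_add distrib_left)
    qed
    also have "\<dots> = (\<integral>\<^sup>+x. indicator A x * (\<integral>\<^sup>+y. v y \<partial>Ps x) \<partial>\<pi>)
        + (\<integral>\<^sup>+x. indicator A x * (\<integral>\<^sup>+y. u y \<partial>Ps x) \<partial>\<pi>)"
      using int_meas[OF Pm(2) uv(1)] int_meas[OF Pm(2) uv(2)] A' by (intro nn_integral_add) auto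
    also have "\<dots> = (\<integral>\<^sup>+y. v y * emeasure (P y) A \<partial>\<pi>) + (\<integral>\<^sup>+y. u y * emeasure (P y) A \<partial>\<pi>)"
      using add by simp
    also have "\<dots> = (\<integral>\<^sup>+y. v y * emeasure (P y) A + u y * emeasure (P y) A \<partial>\<pi>)"
      using uv' PA by (intro nn_integral_add[symmetric]) auto
    finally show ?case by (simp add: distrib_right)
  next
    case (seq U)
    have U': "U i \<in> borel_measurable \<pi>" for i
      using seq(1) by (simp add: measurable_cong_sets[OF s refl])
    have A': "A \<in> sets \<pi>" using A s by simp
    have PA: "(\<lambda>y. emeasure (P y) A) \<in> borel_measurable \<pi>"
      using measurable_emeasure_kernel[OF Pm(1) A] .
    have inc: "incseq (\<lambda>i x. indicator A x * (\<integral>\<^sup>+y. U i y \<partial>Ps x))"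
      using \<open>incseq U\<close>
      by (auto simp: incseq_def le_fun_def intro!: mult_left_mono nn_integral_mono)
    have "(\<integral>\<^sup>+x. indicator A x * (\<integral>\<^sup>+y. (SUP i. U i) y \<partial>Ps x) \<partial>\<pi>) =
          (\<integral>\<^sup>+x. (SUP i. indicator A x * (\<integral>\<^sup>+y. U i y \<partial>Ps x)) \<partial>\<pi>)"
    proof (intro nn_integral_cong)
      fix x assume "x \<in> space \<pi>"
      then have "U i \<in> borel_measurable (Ps x)" for i
        using seq(1) sP by (metis measurable_cong_sets)
      then have "(\<integral>\<^sup>+y. (SUP i. U i y) \<partial>Ps x) = (SUP i. \<integral>\<^sup>+y. U i y \<partial>Ps x)"
        using \<open>incseq U\<close> by (intro nn_integral_monotone_convergence_SUP) auto
      then show "indicator A x * (\<integral>\<^sup>+y. (SUP i. U i) y \<partial>Ps x) =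
          (SUP i. indicator A x * (\<integral>\<^sup>+y. U i y \<partial>Ps x))"
        by (simp add: SUP_mult_left_ennreal image_comp)
    qed
    also have "\<dots> = (SUP i. \<integral>\<^sup>+x. indicator A x * (\<integral>\<^sup>+y. U i y \<partial>Ps x) \<partial>\<pi>)"
      using inc int_meas[OF Pm(2) seq(1)] A'
      by (intro nn_integral_monotone_convergence_SUP) auto
    also have "\<dots> = (SUP i. \<integral>\<^sup>+y. U i y * emeasure (P y) A \<partial>\<pi>)"
      using seq by simp
    also have "\<dots> = (\<integral>\<^sup>+y. (SUP i. U i y * emeasure (P y) A) \<partial>\<pi>)"
      using U' PA \<open>incseq U\<close>
      by (intro nn_integral_monotone_convergence_SUP[symmetric])
         (auto simp: incseq_def le_fun_def intro!: mult_right_mono)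
    finally show ?case by (simp add: SUP_mult_right_ennreal image_comp)
  qed
  have f': "f \<in> borel_measurable \<pi>" and g': "g \<in> borel_measurable \<pi>"
    using f g by (auto simp: measurable_cong_sets[OF s refl])
  note G = int_meas[OF Pm(2) g]
  show ?thesis
    using f
  proof (induction f rule: borel_measurable_induct)
    case (cong f' g')
    have "(\<integral>\<^sup>+y. f' y \<partial>P x) = (\<integral>\<^sup>+y. g' y \<partial>P x)" if "x \<in> space \<pi>" for x
      by (rule nn_integral_cong) (use cong(3) sets_eq_imp_space_eq[OF sP(1)[OF that]] in auto)
    then have "(\<integral>\<^sup>+x. g x * (\<integral>\<^sup>+y. f' y \<partial>P x) \<partial>\<pi>) = (\<integral>\<^sup>+x. g x * (\<integral>\<^sup>+y. g' y \<partial>P x) \<partial>\<pi>)"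
      by (intro nn_integral_cong) simp
    moreover have "(\<integral>\<^sup>+x. f' x * (\<integral>\<^sup>+y. g y \<partial>Ps x) \<partial>\<pi>) = (\<integral>\<^sup>+x. g' x * (\<integral>\<^sup>+y. g y \<partial>Ps x) \<partial>\<pi>)"
      by (intro nn_integral_cong) (use cong(3) sp in simp)
    ultimately show ?case using cong by simp
  next
    case (set A)
    have "(\<integral>\<^sup>+y. g y * (\<integral>\<^sup>+x. indicator A x \<partial>P y) \<partial>\<pi>) = (\<integral>\<^sup>+y. g y * emeasure (P y) A \<partial>\<pi>)"
      by (intro nn_integral_cong) (use set sP in simp)
    with step[OF set] show ?case by simp
  next
    case (mult u c)
    have u: "u \<in> borel_measurable \<mu>" by fact
    have u': "u \<in> borel_measurable \<pi>" using u by (simp add: measurable_cong_sets[OF s refl])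
    have "(\<integral>\<^sup>+y. g y * (\<integral>\<^sup>+x. c * u x \<partial>P y) \<partial>\<pi>) = (\<integral>\<^sup>+y. c * (g y * (\<integral>\<^sup>+x. u x \<partial>P y)) \<partial>\<pi>)"
    proof (intro nn_integral_cong)
      fix y assume "y \<in> space \<pi>"
      then have "u \<in> borel_measurable (P y)" using u sP by (metis measurable_cong_sets)
      then show "g y * (\<integral>\<^sup>+x. c * u x \<partial>P y) = c * (g y * (\<integral>\<^sup>+x. u x \<partial>P y))"
        by (simp add: nn_integral_cmult mult_ac)
    qed
    also have "\<dots> = c * (\<integral>\<^sup>+y. g y * (\<integral>\<^sup>+x. u x \<partial>P y) \<partial>\<pi>)"
      using int_meas[OF Pm(1) u] g' by (intro nn_integral_cmult) auto
    also have "\<dots> = c * (\<integral>\<^sup>+x. u x * (\<integral>\<^sup>+y. g y \<partial>Ps x) \<partial>\<pi>)" using mult by simp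
    also have "\<dots> = (\<integral>\<^sup>+x. c * (u x * (\<integral>\<^sup>+y. g y \<partial>Ps x)) \<partial>\<pi>)"
      using G u' by (intro nn_integral_cmult[symmetric]) auto
    finally show ?case by (simp add: mult_ac)
  next
    case (add u v)
    have uv: "u \<in> borel_measurable \<mu>" "v \<in> borel_measurable \<mu>" by fact+
    have uv': "u \<in> borel_measurable \<pi>" "v \<in> borel_measurable \<pi>"
      using uv by (auto simp: measurable_cong_sets[OF s refl])
    have "(\<integral>\<^sup>+y. g y * (\<integral>\<^sup>+x. v x + u x \<partial>P y) \<partial>\<pi>) =
        (\<integral>\<^sup>+y. g y * (\<integral>\<^sup>+x. v x \<partial>P y) + g y * (\<integral>\<^sup>+x. u x \<partial>P y) \<partial>\<pi>)"
    proof (intro nn_integral_cong)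
      fix x assume "x \<in> space \<pi>"
      then have "u \<in> borel_measurable (P x)" "v \<in> borel_measurable (P x)"
        using uv sP by (metis measurable_cong_sets)+
      then show "g x * (\<integral>\<^sup>+y. v y + u y \<partial>P x) = g x * (\<integral>\<^sup>+y. v y \<partial>P x) + g x * (\<integral>\<^sup>+y. u y \<partial>P x)"
        by (simp add: nn_integral_add distrib_left)
    qed
    also have "\<dots> = (\<integral>\<^sup>+y. g y * (\<integral>\<^sup>+x. v x \<partial>P y) \<partial>\<pi>) + (\<integral>\<^sup>+y. g y * (\<integral>\<^sup>+x. u x \<partial>P y) \<partial>\<pi>)"
      using int_meas[OF Pm(1) uv(1)] int_meas[OF Pm(1) uv(2)] g' by (intro nn_integral_add) auto
    also have "\<dots> = (\<integral>\<^sup>+x. v x * (\<integral>\<^sup>+y. g y \<partial>Ps x) \<partial>\<pi>) + (\<integral>\<^sup>+x. u x * (\<integral>\<^sup>+y. g y \<partial>Ps x) \<partial>\<pi>)"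
      using add by simp
    also have "\<dots> = (\<integral>\<^sup>+x. v x * (\<integral>\<^sup>+y. g y \<partial>Ps x) + u x * (\<integral>\<^sup>+y. g y \<partial>Ps x) \<partial>\<pi>)"
      using G uv' by (intro nn_integral_add[symmetric]) auto
    finally show ?case by (simp add: distrib_right)
  next
    case (seq U)
    have U': "U i \<in> borel_measurable \<pi>" for i
      using seq(1) by (simp add: measurable_cong_sets[OF s refl])
    have "(\<integral>\<^sup>+y. g y * (\<integral>\<^sup>+x. (SUP i. U i) x \<partial>P y) \<partial>\<pi>) =
          (\<integral>\<^sup>+y. (SUP i. g y * (\<integral>\<^sup>+x. U i x \<partial>P y)) \<partial>\<pi>)"
    proof (intro nn_integral_cong)
      fix x assume "x \<in> space \<pi>"
      then have "U i \<in> borel_measurable (P x)" for i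
        using seq(1) sP by (metis measurable_cong_sets)
      then have "(\<integral>\<^sup>+y. (SUP i. U i y) \<partial>P x) = (SUP i. \<integral>\<^sup>+y. U i y \<partial>P x)"
        using \<open>incseq U\<close> by (intro nn_integral_monotone_convergence_SUP) auto
      then show "g x * (\<integral>\<^sup>+y. (SUP i. U i) y \<partial>P x) = (SUP i. g x * (\<integral>\<^sup>+y. U i y \<partial>P x))"
        by (simp add: SUP_mult_left_ennreal image_comp)
    qed
    also have "\<dots> = (SUP i. \<integral>\<^sup>+y. g y * (\<integral>\<^sup>+x. U i x \<partial>P y) \<partial>\<pi>)"
      using \<open>incseq U\<close> int_meas[OF Pm(1) seq(1)] g'
      by (intro nn_integral_monotone_convergence_SUP)
         (auto simp: incseq_def le_fun_def intro!: mult_left_mono nn_integral_mono)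
    also have "\<dots> = (SUP i. \<integral>\<^sup>+x. U i x * (\<integral>\<^sup>+y. g y \<partial>Ps x) \<partial>\<pi>)"
      using seq by simp
    also have "\<dots> = (\<integral>\<^sup>+x. (SUP i. U i x * (\<integral>\<^sup>+y. g y \<partial>Ps x)) \<partial>\<pi>)"
      using U' G \<open>incseq U\<close>
      by (intro nn_integral_monotone_convergence_SUP[symmetric])
         (auto simp: incseq_def le_fun_def intro!: mult_right_mono)
    finally show ?case by (simp add: SUP_mult_right_ennreal image_comp)
  qed
qed

lemma time_reversal_kernel_pow:
  assumes P: "P \<in> \<mu> \<rightarrow>\<^sub>M prob_algebra \<mu>" and Ps: "Ps \<in> \<mu> \<rightarrow>\<^sub>M prob_algebra \<mu>"
    and s: "sets \<pi> = sets \<mu>" and rev: "time_reversal \<pi> P Ps"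
  shows "time_reversal \<pi> (kernel_pow \<mu> P n) (kernel_pow \<mu> Ps n)"
proof (induction n)
  have sp: "space \<pi> = space \<mu>" using s by (rule sets_eq_imp_space_eq)
  case 0
  show ?case unfolding time_reversal_def
  proof (intro ballI)
    fix A B assume AB: "A \<in> sets \<pi>" "B \<in> sets \<pi>"
    show "(\<integral>\<^sup>+x\<in>A. emeasure (kernel_pow \<mu> Ps 0 x) B \<partial>\<pi>) =
        (\<integral>\<^sup>+y\<in>B. emeasure (kernel_pow \<mu> P 0 y) A \<partial>\<pi>)"
      by (intro nn_integral_cong) (use AB s sp in \<open>simp add: mult.commute\<close>)
  qed
next
  case (Suc n)
  have sp: "space \<pi> = space \<mu>" using s by (rule sets_eq_imp_space_eq)
  let ?K = "kernel_pow \<mu> P n" and ?Ks = "kernel_pow \<mu> Ps n"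
  have K: "?K \<in> \<mu> \<rightarrow>\<^sub>M prob_algebra \<mu>" and Ks: "?Ks \<in> \<mu> \<rightarrow>\<^sub>M prob_algebra \<mu>"
    using kernel_pow_measurable P Ps by auto
  note sub = measurable_prob_algebraD[OF P] measurable_prob_algebraD[OF Ps]
    measurable_prob_algebraD[OF K] measurable_prob_algebraD[OF Ks]
  have em: "emeasure (L x \<bind> H) B = (\<integral>\<^sup>+y. emeasure (H y) B \<partial>L x)"
    if "L \<in> \<mu> \<rightarrow>\<^sub>M subprob_algebra \<mu>" "H \<in> \<mu> \<rightarrow>\<^sub>M subprob_algebra \<mu>" "x \<in> space \<mu>" "B \<in> sets \<mu>"
    for L H :: "'a \<Rightarrow> 'a measure" and x B
  proof (rule emeasure_bind)
    have "sets (L x) = sets \<mu>" using that by (metis sets_kernel)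
    then show "space (L x) \<noteq> {}" "H \<in> L x \<rightarrow>\<^sub>M subprob_algebra \<mu>"
      using that sets_eq_imp_space_eq[of "L x" \<mu>] measurable_cong_sets[of "L x" \<mu>] by auto
    show "B \<in> sets \<mu>" by fact
  qed
  show ?case unfolding time_reversal_def
  proof (intro ballI)
    fix A B assume AB: "A \<in> sets \<pi>" "B \<in> sets \<pi>"
    then have AB': "A \<in> sets \<mu>" "B \<in> sets \<mu>" using s by auto
    have m: "(\<lambda>y. emeasure (Ps y) B) \<in> borel_measurable \<mu>"
        "(\<lambda>y. emeasure (?K y) A) \<in> borel_measurable \<mu>"
      using measurable_emeasure_kernel[OF sub(2) AB'(2)]
        measurable_emeasure_kernel[OF sub(3) AB'(1)] .
    have nnind: "(\<integral>\<^sup>+x. indicator C x \<partial>L y) = emeasure (L y) C"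
      if "L \<in> \<mu> \<rightarrow>\<^sub>M subprob_algebra \<mu>" "y \<in> space \<mu>" "C \<in> sets \<mu>" for L C y
      using that by (metis nn_integral_indicator sets_kernel)
    have "(\<integral>\<^sup>+x\<in>A. emeasure (kernel_pow \<mu> Ps (Suc n) x) B \<partial>\<pi>) =
        (\<integral>\<^sup>+x. indicator A x * (\<integral>\<^sup>+y. emeasure (Ps y) B \<partial>?Ks x) \<partial>\<pi>)"
      by (intro nn_integral_cong)
         (use em[OF sub(4) sub(2)] AB' sp kernel_pow_Suc_right[OF Ps]
          in \<open>simp add: mult.commute del: kernel_pow.simps\<close>)
    also have "\<dots> = (\<integral>\<^sup>+y. emeasure (Ps y) B * (\<integral>\<^sup>+x. indicator A x \<partial>?K y) \<partial>\<pi>)"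
      by (rule time_reversal_nn_integral[OF K Ks s Suc]) (use m AB' in auto)
    also have "\<dots> = (\<integral>\<^sup>+y. emeasure (?K y) A * (\<integral>\<^sup>+x. indicator B x \<partial>Ps y) \<partial>\<pi>)"
      by (intro nn_integral_cong)
         (use nnind[OF sub(2)] nnind[OF sub(3)] AB' sp in \<open>simp add: mult.commute\<close>)
    also have "\<dots> = (\<integral>\<^sup>+x. indicator B x * (\<integral>\<^sup>+y. emeasure (?K y) A \<partial>P x) \<partial>\<pi>)"
      by (rule time_reversal_nn_integral[OF P Ps s rev]) (use m AB' in auto)
    also have "\<dots> = (\<integral>\<^sup>+y\<in>B. emeasure (kernel_pow \<mu> P (Suc n) y) A \<partial>\<pi>)"
      by (intro nn_integral_cong) (use em[OF sub(1) sub(3)] AB' sp in \<open>simp add: mult.commute\<close>)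
    finally show "(\<integral>\<^sup>+x\<in>A. emeasure (kernel_pow \<mu> Ps (Suc n) x) B \<partial>\<pi>) =
        (\<integral>\<^sup>+y\<in>B. emeasure (kernel_pow \<mu> P (Suc n) y) A \<partial>\<pi>)" .
  qed
qed

end

theory Submission
  imports Defs "HOL-Library.Function_Algebras"
begin

text \<open>
  Write \<open>\<parallel>\<cdot>\<parallel>\<close> for the norm of \<open>L\<^sup>2(\<pi>)\<close> and let \<open>C\<close> be the set of good times. The variances of sums along
  the stationary chain are sums of inner products \<open>\<langle>P\<^sup>k f, g\<rangle>\<close> of centred functions, and the theorem
  follows from two facts.

  First, for \<open>n \<in> C\<close> the operator \<open>P\<^sup>n\<close> has numerical radius at most \<open>\<beta>\<^sup>n\<close> on \<open>L\<^sup>2\<^sub>0(\<pi>)\<close>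
  (\<open>form_bound\<close>, \<open>num_radius\<close>). Let \<open>q(x, y)\<close> be the density of \<open>P\<^sup>n\<close> with respect to \<open>\<pi>\<close>; then
  \<open>q(y, x)\<close> is that of the reversal. Put \<open>m = min {q(x, y), q(y, x)}\<close> and \<open>r = q - m\<close>; the rejection function
  \<open>\<rho>\<close> is the common marginal of \<open>r\<close>. The definition of \<open>\<beta>\<close> gives \<open>M\<^sub>1 = m + \<rho> \<le> \<beta>\<^sup>n\<close> and
  \<open>M\<^sub>2 = m + r + r\<^sup>* - \<rho> \<ge> - \<beta>\<^sup>n\<close> as quadratic forms. This controls the real part of \<open>\<langle>P\<^sup>n f, f\<rangle>\<close>. For the
  imaginary part, which comes from \<open>r\<close> alone and is dominated by \<open>\<rho>\<close>, one needs \<open>\<rho> \<le> \<beta>\<^sup>n\<close> almost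
  everywhere. The difference of the two forms bounds the Dirichlet form of \<open>r\<close> by \<open>\<beta>\<^sup>n\<close>. Tested on
  the indicator of a set \<open>A\<close>, it bounds the part of \<open>r\<close> that leaves \<open>A\<close>; and since the part of \<open>r\<close> that
  stays inside the pieces of a finite partition can be made arbitrarily small (\<open>resolves_integrable\<close>),
  summing over the pieces bounds the whole of \<open>\<rho>\<close> (\<open>rejection_le\<close>).

  Secondly, let \<open>K\<close> be the least element of \<open>C\<close>. The times \<open>1, \<dots>, K - 1\<close> are all exceptional, so
  \<open>K \<le> \<bar>C\<^sup>c\<bar> + 1\<close>. Splitting a sum along the chain by residues modulo \<open>K\<close> costs a factor \<open>K\<close> and leaves
  sums along a chain with operator \<open>P\<^sup>K\<close>, whose numerical radius is at most \<open>b = \<beta>\<^sup>K < 1\<close>. For such a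
  chain the variance is at most \<open>(1 + b) / (1 - b)\<close> times the sum of the individual variances
  (\<open>block_bound\<close>), and \<open>K (1 + b) / (1 - b) \<le> \<bar>C\<^sup>c\<bar> + 2 / (1 - \<beta>)\<close>. This is the third claim, and the first
  is a special case.

  For the second claim, let \<open>R\<close> be the inverse of \<open>1 - P\<close>. Then \<open>n \<sigma>\<^sup>2 - Var\<close> is twice the real part of
  \<open>\<langle>P (1 - P\<^sup>n) R\<^sup>2 f, f\<rangle>\<close> (\<open>tail_sum_bound\<close>), so it suffices that the norm of \<open>R\<close> is at most
  \<open>D = 1 + \<bar>C\<^sup>c\<bar> + 4 \<beta> ^ (\<bar>C\<^sup>c\<bar> + 1) / (1 - \<beta>)\<close>. Two estimates are available: \<open>K / (1 - b)\<close>, from the positivity of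
  \<open>1 - P\<^sup>K\<close>, and the sum of the norms of all powers, where \<open>\<parallel>P\<^sup>k\<parallel> \<le> 2 \<beta>\<^sup>k\<close> for \<open>k \<in> C\<close>. At least one of
  them is below \<open>D\<close> (\<open>resolvent_constant_cases\<close>).
\<close>

section \<open>Contractive semigroups on semi-inner product spaces\<close>

lemma sum_nat_residues:
  fixes F :: "nat \<Rightarrow> 'b::comm_monoid_add"
  shows "(\<Sum>i<L * K. F i) = (\<Sum>c<K. \<Sum>t<L. F (c + K * t))"
proof -
  have "(\<Sum>i<L * K. F i) = (\<Sum>t<L. \<Sum>i = t * K..<t * K + K. F i)" by (rule sum.nat_group[symmetric])
  also have "\<dots> = (\<Sum>t<L. \<Sum>c<K. F (c + K * t))"
  proof (rule sum.cong[OF refl])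
    fix t
    show "(\<Sum>i = t * K..<t * K + K. F i) = (\<Sum>c<K. F (c + K * t))"
      by (rule sum.reindex_bij_witness[of _ "\<lambda>c. c + t * K" "\<lambda>i. i - t * K"]) (auto simp: mult.commute)
  qed
  also have "\<dots> = (\<Sum>c<K. \<Sum>t<L. F (c + K * t))" by (rule sum.swap)
  finally show ?thesis .
qed

lemma sum_lessThan_4: "(\<Sum>k<(4::nat). F k) = F 0 + F 1 + F 2 + (F 3 :: 'c::comm_monoid_add)"
  by (simp add: eval_nat_numeral)

lemma ii_cubed: "\<i> ^ 3 = - \<i>"
  by (simp add: eval_nat_numeral)

lemma sum_roots_of_unity:
  fixes d :: int and M :: nat
  assumes "M > 0" "\<not> int M dvd d"
  shows "(\<Sum>t<M. cis (2 * pi * of_int d / M) ^ t) = 0"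
proof -
  have "cis (2 * pi * of_int d / M) \<noteq> 1"
  proof
    assume "cis (2 * pi * of_int d / M) = 1"
    then have "exp (\<i> * of_real (2 * pi * of_int d / M)) = 1" by (simp add: cis_conv_exp)
    then obtain n :: int where "2 * pi * of_int d / M = of_int (2 * n) * pi"
      by (auto simp: exp_eq_1)
    then have "of_int d = (of_int n * of_nat M :: real)" using assms by (simp add: field_simps)
    then have "d = n * int M" by (metis of_int_eq_iff of_int_mult of_int_of_nat_eq)
    then show False using assms by simp
  qed
  moreover have "cis (2 * pi * of_int d / M) ^ M = 1"
  proof -
    have "cis (2 * pi * of_int d / M) ^ M = cis (2 * pi * of_int d)"
      using assms by (simp add: Complex.DeMoivre)
    then show ?thesis by (simp add: cis_multiple_2pi)
  qed
  ultimately show ?thesis by (simp add: geometric_sum)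
qed

text \<open>
  The elements of \<open>L\<^sup>2\<close> are functions, not classes modulo null sets, so the
  inner product is only positive semidefinite and is defined on a set of vectors.
\<close>

locale semi_inner_product =
  fixes H :: "'v::ab_group_add set" and sc :: "complex \<Rightarrow> 'v \<Rightarrow> 'v" and ip :: "'v \<Rightarrow> 'v \<Rightarrow> complex"
  assumes zero_closed [simp]: "0 \<in> H"
    and add_closed [simp]: "f \<in> H \<Longrightarrow> g \<in> H \<Longrightarrow> f + g \<in> H"
    and sc_closed [simp]: "f \<in> H \<Longrightarrow> sc c f \<in> H"
    and sc_minus_one: "f \<in> H \<Longrightarrow> sc (- 1) f = - f"
    and ip_add_left: "f \<in> H \<Longrightarrow> g \<in> H \<Longrightarrow> h \<in> H \<Longrightarrow> ip (f + g) h = ip f h + ip g h"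
    and ip_sc_left: "f \<in> H \<Longrightarrow> g \<in> H \<Longrightarrow> ip (sc c f) g = c * ip f g"
    and ip_cnj: "f \<in> H \<Longrightarrow> g \<in> H \<Longrightarrow> ip g f = cnj (ip f g)"
    and ip_nonneg: "f \<in> H \<Longrightarrow> 0 \<le> Re (ip f f)"
begin

definition nrm :: "'v \<Rightarrow> real" where
  "nrm f = sqrt (Re (ip f f))"

lemma nrm_nonneg [simp]: "f \<in> H \<Longrightarrow> 0 \<le> nrm f"
  by (simp add: nrm_def ip_nonneg)

lemma nrm_sq: "f \<in> H \<Longrightarrow> (nrm f)\<^sup>2 = Re (ip f f)"
  by (simp add: nrm_def ip_nonneg)

lemma ip_self: "f \<in> H \<Longrightarrow> ip f f = of_real ((nrm f)\<^sup>2)"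
  using ip_cnj[of f f] by (simp add: nrm_sq complex_eq_iff)

lemma uminus_closed [simp]: "f \<in> H \<Longrightarrow> - f \<in> H"
  using sc_closed[of f "-1"] by (simp add: sc_minus_one)

lemma diff_closed [simp]: "f \<in> H \<Longrightarrow> g \<in> H \<Longrightarrow> f - g \<in> H"
  using add_closed[of f "- g"] by simp

lemma sum_closed [simp]: "(\<And>i. i \<in> I \<Longrightarrow> f i \<in> H) \<Longrightarrow> (\<Sum>i\<in>I. f i) \<in> H"
  by (induction I rule: infinite_finite_induct) auto

lemma ip_add_right: "f \<in> H \<Longrightarrow> g \<in> H \<Longrightarrow> h \<in> H \<Longrightarrow> ip h (f + g) = ip h f + ip h g"
  using ip_cnj[of "f + g" h] ip_cnj[of f h] ip_cnj[of g h] by (simp add: ip_add_left)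

lemma ip_sc_right: "f \<in> H \<Longrightarrow> g \<in> H \<Longrightarrow> ip g (sc c f) = cnj c * ip g f"
  using ip_cnj[of "sc c f" g] ip_cnj[of f g] by (simp add: ip_sc_left)

lemma ip_minus_left: "f \<in> H \<Longrightarrow> g \<in> H \<Longrightarrow> ip (- f) g = - ip f g"
  using ip_sc_left[of f g "-1"] by (simp add: sc_minus_one)

lemma ip_diff_left: "f \<in> H \<Longrightarrow> g \<in> H \<Longrightarrow> h \<in> H \<Longrightarrow> ip (f - g) h = ip f h - ip g h"
  using ip_add_left[of f "- g" h] by (simp add: ip_minus_left)

lemma ip_zero_left [simp]: "f \<in> H \<Longrightarrow> ip 0 f = 0"
  using ip_add_left[of 0 0 f] by simp

lemma ip_zero_right [simp]: "f \<in> H \<Longrightarrow> ip f 0 = 0"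
  using ip_add_right[of 0 0 f] by simp

lemma ip_sum_left:
  "(\<And>i. i \<in> I \<Longrightarrow> f i \<in> H) \<Longrightarrow> h \<in> H \<Longrightarrow> ip (\<Sum>i\<in>I. f i) h = (\<Sum>i\<in>I. ip (f i) h)"
  by (induction I rule: infinite_finite_induct) (auto simp: ip_add_left)

lemma ip_sum_right:
  "(\<And>i. i \<in> I \<Longrightarrow> f i \<in> H) \<Longrightarrow> h \<in> H \<Longrightarrow> ip h (\<Sum>i\<in>I. f i) = (\<Sum>i\<in>I. ip h (f i))"
  by (induction I rule: infinite_finite_induct) (auto simp: ip_add_right)

lemma nrm_sc: "f \<in> H \<Longrightarrow> nrm (sc c f) = cmod c * nrm f"
proof -
  assume f: "f \<in> H"
  have "ip (sc c f) (sc c f) = (c * cnj c) * ip f f"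
    using f by (simp add: ip_sc_left ip_sc_right)
  also have "\<dots> = of_real ((cmod c * nrm f)\<^sup>2)"
    using f by (simp add: ip_self complex_norm_square[symmetric] power_mult_distrib)
  finally show ?thesis using f by (simp add: nrm_def[of "sc c f"])
qed

lemma nrm_expand:
  "f \<in> H \<Longrightarrow> g \<in> H \<Longrightarrow> (nrm (f + g))\<^sup>2 = (nrm f)\<^sup>2 + (nrm g)\<^sup>2 + 2 * Re (ip f g)"
  using ip_cnj[of f g] by (simp add: nrm_sq ip_add_left ip_add_right)

text \<open>
  The norm of \<open>f - s g\<close> is nonnegative for every real \<open>s\<close>; the
  minimising \<open>s\<close> gives the inequality. If \<open>g\<close> has norm zero there is no
  minimiser and a large \<open>s\<close> is used instead.
\<close>

lemma Re_ip_le: 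
  assumes "f \<in> H" "g \<in> H"
  shows "Re (ip f g) \<le> nrm f * nrm g"
proof -
  have ineq: "2 * s * Re (ip f g) \<le> (nrm f)\<^sup>2 + s\<^sup>2 * (nrm g)\<^sup>2" for s :: real
  proof -
    have "0 \<le> (nrm (f + sc (- of_real s) g))\<^sup>2" by simp
    also have "\<dots> = (nrm f)\<^sup>2 + s\<^sup>2 * (nrm g)\<^sup>2 - 2 * s * Re (ip f g)"
      using assms by (simp add: nrm_expand nrm_sc ip_sc_right power_mult_distrib)
    finally show ?thesis by simp
  qed
  show ?thesis
  proof (cases "nrm g = 0")
    case True
    have "\<not> 0 < Re (ip f g)"
    proof
      assume pos: "0 < Re (ip f g)"
      show False using ineq[of "((nrm f)\<^sup>2 + 1) / (2 * Re (ip f g))"] True pos by (simp add: field_simps)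
    qed
    then show ?thesis using True by simp
  next
    case False
    then have "0 < nrm g" using nrm_nonneg[OF assms(2)] by linarith
    then have "(Re (ip f g))\<^sup>2 \<le> (nrm f * nrm g)\<^sup>2"
      using ineq[of "Re (ip f g) / (nrm g)\<^sup>2"] by (simp add: power_mult_distrib field_simps power2_eq_square)
    then show ?thesis by (rule power2_le_imp_le) (use assms in simp)
  qed
qed

text \<open>
  Rotating \<open>f\<close> by the phase of the inner product makes the inner product real.
\<close>

lemma Cauchy_Schwarz:
  assumes "f \<in> H" "g \<in> H"
  shows "cmod (ip f g) \<le> nrm f * nrm g"
proof (cases "ip f g = 0")
  case False
  define c where "c = cnj (ip f g) / of_real (cmod (ip f g))"
  have c: "cmod c = 1" using False by (simp add: c_def norm_divide)
  have "cnj (ip f g) * ip f g = of_real (cmod (ip f g)) * of_real (cmod (ip f g))"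
    using complex_norm_square[of "ip f g"] by (simp add: mult.commute power2_eq_square)
  then have "ip (sc c f) g = of_real (cmod (ip f g))"
    using assms False by (simp add: c_def ip_sc_left)
  then have "cmod (ip f g) = Re (ip (sc c f) g)" by simp
  also have "\<dots> \<le> nrm (sc c f) * nrm g" using assms by (intro Re_ip_le) auto
  finally show ?thesis using assms c by (simp add: nrm_sc)
qed (use assms in simp)

lemma nrm_triangle:
  assumes "f \<in> H" "g \<in> H"
  shows "nrm (f + g) \<le> nrm f + nrm g"
proof -
  have "(nrm (f + g))\<^sup>2 \<le> (nrm f + nrm g)\<^sup>2"
    unfolding nrm_expand[OF assms] power2_sum using Re_ip_le[OF assms] by linarith
  then show ?thesis by (rule power2_le_imp_le) (use assms in simp)
qed

lemma nrm_diff: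
  assumes "f \<in> H" "g \<in> H"
  shows "nrm (f - g) \<le> nrm f + nrm g"
  using nrm_triangle[of f "- g"] nrm_sc[of g "-1"] assms by (simp add: sc_minus_one)

lemma nrm_zero [simp]: "nrm 0 = 0"
  by (simp add: nrm_def)

lemma nrm_sum:
  "(\<And>i. i \<in> I \<Longrightarrow> f i \<in> H) \<Longrightarrow> nrm (\<Sum>i\<in>I. f i) \<le> (\<Sum>i\<in>I. nrm (f i))"
  by (induction I rule: infinite_finite_induct) (auto intro: order_trans[OF nrm_triangle])

end

text \<open>
  Averaging operators of a Markov chain are linear, and form a semigroup, only up to null sets.
  Hence these laws are required of the inner products with all vectors and not of the vectors
  themselves.
\<close>

locale weak_contraction_semigroup = semi_inner_product +
  fixes U :: "nat \<Rightarrow> 'a \<Rightarrow> 'a"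
  assumes U_closed [simp]: "f \<in> H \<Longrightarrow> U n f \<in> H"
    and U_add: "f \<in> H \<Longrightarrow> g \<in> H \<Longrightarrow> h \<in> H \<Longrightarrow> ip (U n (f + g)) h = ip (U n f) h + ip (U n g) h"
    and U_sc: "f \<in> H \<Longrightarrow> h \<in> H \<Longrightarrow> ip (U n (sc c f)) h = c * ip (U n f) h"
    and U_U: "f \<in> H \<Longrightarrow> h \<in> H \<Longrightarrow> ip (U m (U n f)) h = ip (U (m + n) f) h"
    and U_0: "f \<in> H \<Longrightarrow> h \<in> H \<Longrightarrow> ip (U 0 f) h = ip f h"
    and U_contraction: "f \<in> H \<Longrightarrow> nrm (U n f) \<le> nrm f"
begin

lemma U_zero [simp]: "h \<in> H \<Longrightarrow> ip (U n 0) h = 0"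
  using U_add[of 0 0 h n] by simp

lemma U_sum:
  "(\<And>i. i \<in> I \<Longrightarrow> f i \<in> H) \<Longrightarrow> h \<in> H \<Longrightarrow> ip (U n (\<Sum>i\<in>I. f i)) h = (\<Sum>i\<in>I. ip (U n (f i)) h)"
  by (induction I rule: infinite_finite_induct) (auto simp: U_add)

lemma nrm_eqI:
  assumes "f \<in> H" "g \<in> H" "\<And>h. h \<in> H \<Longrightarrow> ip f h = ip g h"
  shows "nrm f = nrm g"
proof -
  have "ip f f = ip g f" using assms by simp
  also have "\<dots> = cnj (ip f g)" using assms by (intro ip_cnj) auto
  also have "\<dots> = cnj (ip g g)" using assms by simp
  finally show ?thesis by (simp add: nrm_def)
qed

text \<open>
  A bound on the numerical radius. For a nonnormal operator it is weaker than the same bound on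
  the norm, and the Metropolis-Hastings kernels give only this weaker bound.
\<close>

definition num_radius_le :: "nat \<Rightarrow> real \<Rightarrow> bool" where
  "num_radius_le n b \<longleftrightarrow> (\<forall>f\<in>H. cmod (ip (U n f) f) \<le> b * (nrm f)\<^sup>2)"

lemma num_radius_leD: "num_radius_le n b \<Longrightarrow> f \<in> H \<Longrightarrow> cmod (ip (U n f) f) \<le> b * (nrm f)\<^sup>2"
  by (simp add: num_radius_le_def)

lemma parallelogram4:
  assumes f: "f \<in> H" and g: "g \<in> H"
  shows "(\<Sum>k<4. (nrm (f + sc (\<i> ^ k) g))\<^sup>2) = 4 * ((nrm f)\<^sup>2 + (nrm g)\<^sup>2)"
  using assms
  by (simp add: nrm_expand nrm_sc ip_sc_right sum_lessThan_4 ii_cubed)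

lemma polarization:
  assumes f: "f \<in> H" and g: "g \<in> H"
  shows "(\<Sum>k<4. \<i> ^ k * ip (U n (f + sc (\<i> ^ k) g)) (f + sc (\<i> ^ k) g)) = 4 * ip (U n f) g"
  using assms
  by (simp add: U_add U_sc ip_add_right ip_sc_right sum_lessThan_4 ii_cubed algebra_simps)

text \<open>
  By polarisation the form at a pair \<open>f, g\<close> is an average of four values of the
  quadratic form, which the parallelogram law bounds by \<open>b (\<parallel>f\<parallel>\<^sup>2
  + \<parallel>g\<parallel>\<^sup>2)\<close>. The choice of \<open>g\<close> as the multiple of
  \<open>U n f\<close> with the norm of \<open>f\<close> gives the constant 2.
\<close>

lemma nrm_U_le_num_radius:
  assumes w: "num_radius_le n b" and f: "f \<in> H"
  shows "nrm (U n f) \<le> 2 * b * nrm f"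
proof (cases "nrm (U n f) = 0 \<or> nrm f = 0")
  case True
  then have "nrm (U n f) = 0" using U_contraction[OF f, of n] nrm_nonneg[OF U_closed[OF f, of n]] by auto
  moreover have "0 \<le> b * nrm f"
  proof (cases "nrm f = 0")
    case False
    have "0 \<le> b * (nrm f)\<^sup>2" using num_radius_leD[OF w f] norm_ge_zero order_trans by blast
    then show ?thesis using False nrm_nonneg[OF f] by (simp add: zero_le_mult_iff)
  qed simp
  ultimately show ?thesis by simp
next
  case False
  define x y where "x = nrm f" and "y = nrm (U n f)"
  have pos: "x > 0" "y > 0" using False f nrm_nonneg[OF f] nrm_nonneg[of "U n f"]
    by (auto simp: x_def y_def order_less_le)
  define g where "g = sc (of_real (x / y)) (U n f)"
  have g: "g \<in> H" using f by (simp add: g_def)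
  have ng: "nrm g = x" using pos f by (simp add: g_def nrm_sc y_def[symmetric] norm_divide)
  have "4 * cmod (ip (U n f) g) = cmod (\<Sum>k<4. \<i> ^ k * ip (U n (f + sc (\<i> ^ k) g)) (f + sc (\<i> ^ k) g))"
    by (simp add: polarization[OF f g] norm_mult)
  also have "\<dots> \<le> (\<Sum>k<4. cmod (ip (U n (f + sc (\<i> ^ k) g)) (f + sc (\<i> ^ k) g)))"
    by (rule order_trans[OF norm_sum]) (simp add: norm_mult norm_power)
  also have "\<dots> \<le> (\<Sum>k<4. b * (nrm (f + sc (\<i> ^ k) g))\<^sup>2)"
    using w f g by (intro sum_mono num_radius_leD) auto
  also have "\<dots> = 4 * (b * (x\<^sup>2 + x\<^sup>2))"
    by (simp add: parallelogram4[OF f g] ng x_def flip: sum_distrib_left)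
  finally have "cmod (ip (U n f) g) \<le> 2 * b * x\<^sup>2" by simp
  moreover have "ip (U n f) g = of_real (x * y)"
    using f pos by (simp add: g_def ip_sc_right ip_self y_def[symmetric] power2_eq_square)
  moreover have "cmod (of_real (x * y)) = x * y" using pos by (simp only: norm_of_real) simp
  ultimately have "x * y \<le> x * (2 * b * x)" by (simp only: power2_eq_square mult_ac)
  then show ?thesis using pos by (simp add: x_def y_def)
qed

text \<open>
  The numerical radius of the tensor product of an operator with a shift is at most that of the
  operator. The vectors \<open>u i\<close> are replaced by their discrete Fourier transforms
  \<open>F t\<close>: the weighted average over \<open>t\<close> of the quadratic form at \<open>F
  t\<close> keeps exactly the pairs of neighbouring indices, and Parseval gives the sum of the
  squared norms. A bound by the norm of the operator would lose the factor 2 between norm and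
  numerical radius.
\<close>

lemma num_radius_shift:
  assumes w: "num_radius_le k b" and u: "\<And>i. u i \<in> H"
  shows "cmod (\<Sum>i<n. ip (U k (u (Suc i))) (u i)) \<le> b * (\<Sum>i\<le>n. (nrm (u i))\<^sup>2)"
proof -
  \<comment> \<open>The differences \<open>i - j - 1\<close> of indices up to \<open>n\<close> have absolute value at most \<open>n + 1\<close>, so modulo \<open>M\<close> only zero is congruent to zero.\<close>
  define M :: nat where "M = n + 2"
  have M: "M > 0" by (simp add: M_def)
  define \<omega> :: "int \<Rightarrow> nat \<Rightarrow> complex" where "\<omega> d t = cis (2 * pi * of_int d / M) ^ t" for d t
  have om_mult: "\<omega> d t * \<omega> d' t = \<omega> (d + d') t" for d d' t
    by (simp add: \<omega>_def flip: power_mult_distrib) (simp add: cis_mult add_divide_distrib algebra_simps)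
  have om_cnj: "cnj (\<omega> d t) = \<omega> (- d) t" for d t
    by (simp add: \<omega>_def cis_cnj)
  have om_norm: "cmod (\<omega> d t) = 1" for d t by (simp add: \<omega>_def norm_power)
  have om_sum: "(\<Sum>t<M. \<omega> d t) = (if d = 0 then of_nat M else 0)" if "\<bar>d\<bar> < int M" for d
  proof (cases "d = 0")
    case False
    then have "\<not> int M dvd d" using that zdvd_not_zless[of "\<bar>d\<bar>" "int M"] by auto
    then show ?thesis using sum_roots_of_unity[OF M, of d] False by (simp add: \<omega>_def)
  qed (simp add: \<omega>_def)
  define F where "F t = (\<Sum>i\<le>n. sc (\<omega> (int i) t) (u i))" for t
  have FH: "F t \<in> H" for t using u by (simp add: F_def)
  have ipU: "ip (U k (F t)) (F t) = (\<Sum>i\<le>n. \<Sum>j\<le>n. \<omega> (int i - int j) t * ip (U k (u i)) (u j))" for t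
    unfolding F_def using u
    by (simp add: U_sum ip_sum_right U_sc ip_sc_right om_cnj sum_distrib_left mult.assoc[symmetric]
        om_mult mult.commute[of "\<omega> (- _) t"]) (rule sum.swap)
  have ipF: "ip (F t) (F t) = (\<Sum>i\<le>n. \<Sum>j\<le>n. \<omega> (int i - int j) t * ip (u i) (u j))" for t
    unfolding F_def using u
    by (simp add: ip_sum_left ip_sum_right ip_sc_left ip_sc_right om_cnj sum_distrib_left mult.assoc[symmetric]
        om_mult mult.commute[of "\<omega> (- _) t"]) (rule sum.swap)
  have "(\<Sum>t<M. \<omega> (- 1) t * ip (U k (F t)) (F t))
      = (\<Sum>t<M. \<Sum>i\<le>n. \<Sum>j\<le>n. \<omega> (int i - int j - 1) t * ip (U k (u i)) (u j))"
    by (simp add: ipU sum_distrib_left mult.assoc[symmetric] om_mult algebra_simps)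
  also have "\<dots> = (\<Sum>i\<le>n. \<Sum>j\<le>n. \<Sum>t<M. \<omega> (int i - int j - 1) t * ip (U k (u i)) (u j))"
    by (subst sum.swap, rule sum.cong[OF refl], rule sum.swap)
  also have "\<dots> = (\<Sum>i\<le>n. \<Sum>j\<le>n. if i = Suc j then of_nat M * ip (U k (u i)) (u j) else 0)"
  proof (intro sum.cong refl)
    fix i j assume "i \<in> {..n}" "j \<in> {..n}"
    then have "\<bar>int i - int j - 1\<bar> < int M" by (simp add: M_def)
    from om_sum[OF this] show "(\<Sum>t<M. \<omega> (int i - int j - 1) t * ip (U k (u i)) (u j))
        = (if i = Suc j then of_nat M * ip (U k (u i)) (u j) else 0)"
      by (auto simp: sum_distrib_right[symmetric])
  qed
  also have "\<dots> = (\<Sum>j\<le>n. \<Sum>i\<le>n. if i = Suc j then of_nat M * ip (U k (u i)) (u j) else 0)"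
    by (rule sum.swap)
  also have "\<dots> = (\<Sum>j\<le>n. if j < n then of_nat M * ip (U k (u (Suc j))) (u j) else 0)"
    by (intro sum.cong refl) (auto simp: Suc_le_eq)
  also have "\<dots> = (\<Sum>j<n. of_nat M * ip (U k (u (Suc j))) (u j))"
    by (intro sum.mono_neutral_cong_right) auto
  also have "\<dots> = of_nat M * (\<Sum>j<n. ip (U k (u (Suc j))) (u j))"
    by (simp add: sum_distrib_left)
  finally have A: "of_nat M * (\<Sum>j<n. ip (U k (u (Suc j))) (u j)) = (\<Sum>t<M. \<omega> (- 1) t * ip (U k (F t)) (F t))" ..
  have "of_real (\<Sum>t<M. (nrm (F t))\<^sup>2) = (\<Sum>t<M. ip (F t) (F t))"
    using FH by (simp add: ip_self)
  also have "\<dots> = (\<Sum>i\<le>n. \<Sum>j\<le>n. \<Sum>t<M. \<omega> (int i - int j) t * ip (u i) (u j))"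
    unfolding ipF by (subst sum.swap, rule sum.cong[OF refl], rule sum.swap)
  also have "\<dots> = (\<Sum>i\<le>n. \<Sum>j\<le>n. if i = j then of_nat M * ip (u i) (u j) else 0)"
  proof (intro sum.cong refl)
    fix i j assume "i \<in> {..n}" "j \<in> {..n}"
    then have "\<bar>int i - int j\<bar> < int M" by (simp add: M_def)
    from om_sum[OF this] show "(\<Sum>t<M. \<omega> (int i - int j) t * ip (u i) (u j))
        = (if i = j then of_nat M * ip (u i) (u j) else 0)"
      by (auto simp: sum_distrib_right[symmetric])
  qed
  also have "\<dots> = of_real (M * (\<Sum>i\<le>n. (nrm (u i))\<^sup>2))"
    using u by (simp add: ip_self sum_distrib_left)
  finally have B: "(\<Sum>t<M. (nrm (F t))\<^sup>2) = M * (\<Sum>i\<le>n. (nrm (u i))\<^sup>2)"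
    by (simp only: of_real_eq_iff)
  have "M * cmod (\<Sum>j<n. ip (U k (u (Suc j))) (u j)) = cmod (\<Sum>t<M. \<omega> (- 1) t * ip (U k (F t)) (F t))"
    by (simp add: norm_mult flip: A)
  also have "\<dots> \<le> (\<Sum>t<M. cmod (ip (U k (F t)) (F t)))"
    by (rule order_trans[OF norm_sum]) (simp add: norm_mult om_norm)
  also have "\<dots> \<le> (\<Sum>t<M. b * (nrm (F t))\<^sup>2)"
    by (intro sum_mono num_radius_leD w FH)
  also have "\<dots> = M * (b * (\<Sum>i\<le>n. (nrm (u i))\<^sup>2))"
    by (simp add: B flip: sum_distrib_left)
  finally show ?thesis using M by simp
qed

text \<open>
  The left-hand side is the second moment of a sum along a chain with one-step operator \<open>N =
  U K\<close>. With the vectors \<open>u i = g i + N (u (i + 1))\<close>, the solution of a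
  Poisson equation run backwards in time, it equals \<open>2 S - (\<Sum>i. \<parallel>g
  i\<parallel>\<^sup>2)\<close> where \<open>S\<close> sums the real parts of the inner products
  of \<open>u i\<close> and \<open>g i\<close>. Substituting \<open>g i = u i - N (u (i +
  1))\<close> and using the shift estimate bounds \<open>S\<close> below by \<open>(1 - b)
  (\<Sum>i. \<parallel>u i\<parallel>\<^sup>2)\<close>; by Cauchy-Schwarz this forces \<open>S
  \<le> (\<Sum>i. \<parallel>g i\<parallel>\<^sup>2) / (1 - b)\<close>.
\<close>

lemma block_bound:
  assumes w: "num_radius_le K b" and b: "b < 1" and g: "\<And>i. g i \<in> H"
  shows "(\<Sum>i<n. (nrm (g i))\<^sup>2) + 2 * (\<Sum>i<n. \<Sum>j\<in>{i<..<n}. Re (ip (U (K * (j - i)) (g j)) (g i)))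
       \<le> (2 / (1 - b) - 1) * (\<Sum>i<n. (nrm (g i))\<^sup>2)"
proof -
  define u where "u i = (\<Sum>j\<in>{i..<n}. U (K * (j - i)) (g j))" for i
  have uH: "u i \<in> H" for i using g by (simp add: u_def)
  have split: "{i..<n} = insert i {i<..<n}" if "i < n" for i using that by auto
  have u1: "ip (u i) h = ip (g i) h + (\<Sum>j\<in>{i<..<n}. ip (U (K * (j - i)) (g j)) h)"
    if "i < n" "h \<in> H" for i h
    using that g by (simp add: u_def split ip_add_left ip_sum_left U_0)
  have u2: "ip (u i) h = ip (g i) h + ip (U K (u (Suc i))) h" if "i < n" "h \<in> H" for i h
  proof -
    have "ip (U K (u (Suc i))) h = (\<Sum>j\<in>{Suc i..<n}. ip (U (K + K * (j - Suc i)) (g j)) h)"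
      using that g by (simp add: u_def U_sum U_U)
    also have "\<dots> = (\<Sum>j\<in>{i<..<n}. ip (U (K * (j - i)) (g j)) h)"
    proof (rule sum.cong)
      fix j assume j: "j \<in> {i<..<n}"
      have "K + K * (j - Suc i) = K * (j - i)" using j by (simp add: Suc_diff_Suc flip: mult_Suc_right)
      then show "ip (U (K + K * (j - Suc i)) (g j)) h = ip (U (K * (j - i)) (g j)) h" by simp
    qed auto
    finally show ?thesis using u1[OF that] by simp
  qed
  define S where "S = (\<Sum>i<n. Re (ip (u i) (g i)))"
  define A where "A = (\<Sum>i<n. (nrm (u i))\<^sup>2)"
  define G where "G = (\<Sum>i<n. (nrm (g i))\<^sup>2)"
  have Seq: "S = G + (\<Sum>i<n. \<Sum>j\<in>{i<..<n}. Re (ip (U (K * (j - i)) (g j)) (g i)))"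
    using g by (simp add: S_def G_def u1 ip_self sum.distrib)
  have "Re (ip (u i) (g i)) = (nrm (u i))\<^sup>2 - Re (ip (U K (u (Suc i))) (u i))" if "i < n" for i
  proof -
    have "Re (ip (u i) (g i)) = Re (ip (g i) (u i))" using ip_cnj[OF uH g, of i i] by simp
    moreover have "Re (ip (u i) (u i)) = Re (ip (g i) (u i)) + Re (ip (U K (u (Suc i))) (u i))"
      using u2[OF that uH, of i] by simp
    ultimately show ?thesis by (simp add: nrm_sq[OF uH])
  qed
  then have "S = A - Re (\<Sum>i<n. ip (U K (u (Suc i))) (u i))"
    by (simp add: S_def A_def sum_subtractf)
  moreover have "Re (\<Sum>i<n. ip (U K (u (Suc i))) (u i)) \<le> b * A"
  proof -
    have "u n = 0" by (simp add: u_def)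
    then have "(\<Sum>i\<le>n. (nrm (u i))\<^sup>2) = A" by (simp add: A_def lessThan_Suc_atMost[symmetric])
    then show ?thesis
      using num_radius_shift[OF w, where u = u and n = n] uH
      by (intro order_trans[OF complex_Re_le_cmod]) simp
  qed
  ultimately have low: "(1 - b) * A \<le> S" by (simp add: algebra_simps)
  have "Re (ip (u i) (g i)) \<le> ((1 - b) * (nrm (u i))\<^sup>2 + (nrm (g i))\<^sup>2 / (1 - b)) / 2" for i
  proof -
    have "Re (ip (u i) (g i)) \<le> nrm (u i) * nrm (g i)" by (rule Re_ip_le[OF uH g])
    moreover have "0 \<le> ((1 - b) * nrm (u i) - nrm (g i))\<^sup>2 / (1 - b)" using b by simp
    moreover have "((1 - b) * nrm (u i) - nrm (g i))\<^sup>2 / (1 - b)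
       = (1 - b) * (nrm (u i))\<^sup>2 + (nrm (g i))\<^sup>2 / (1 - b) - 2 * (nrm (u i) * nrm (g i))"
      using b by (simp add: power2_diff divide_simps) (simp add: power2_eq_square algebra_simps)
    ultimately show ?thesis by simp
  qed
  then have "S \<le> (\<Sum>i<n. ((1 - b) * (nrm (u i))\<^sup>2 + (nrm (g i))\<^sup>2 / (1 - b)) / 2)"
    unfolding S_def by (intro sum_mono)
  also have "\<dots> = ((1 - b) * A + G / (1 - b)) / 2"
    by (simp add: A_def G_def sum.distrib sum_distrib_left flip: sum_divide_distrib)
  finally have "S \<le> G / (1 - b)" using low by simp
  then have "2 * S - G \<le> 2 * (G / (1 - b)) - G" by simp
  also have "\<dots> = (2 / (1 - b) - 1) * G" by (simp add: algebra_simps)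
  finally have "2 * S - G \<le> (2 / (1 - b) - 1) * G" .
  then show ?thesis using Seq by (simp add: G_def)
qed

definition partial_resolvent :: "nat \<Rightarrow> 'a \<Rightarrow> 'a" where
  "partial_resolvent N g = (\<Sum>k<N. U k g)"

lemma partial_resolvent_closed [simp]: "g \<in> H \<Longrightarrow> partial_resolvent N g \<in> H"
  by (simp add: partial_resolvent_def)

text \<open>
  Times below \<open>M K\<close> are split into a multiple of \<open>K\<close> and a remainder.
  For \<open>v\<close>, the sum over the multiples of \<open>K\<close>, the difference \<open>v -
  U K v\<close> telescopes, while the numerical radius bounds its inner product with
  \<open>v\<close> below by \<open>(1 - b) \<parallel>v\<parallel>\<^sup>2\<close>. Each remainder
  contributes at most the norm of \<open>v\<close>.
\<close>

lemma partial_resolvent_skeleton_bound: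
  assumes w: "num_radius_le K b" and b: "b < 1" and g: "g \<in> H"
  shows "nrm (partial_resolvent (M * K) g) \<le> K / (1 - b) * (nrm g + nrm (U (K * M) g))"
proof -
  define v where "v = (\<Sum>j<M. U (K * j) g)"
  have v: "v \<in> H" using g by (simp add: v_def)
  have "ip (U K v) v = (\<Sum>j<M. ip (U (K * Suc j) g) v)"
    using g v by (subst v_def) (simp add: U_sum U_U)
  moreover have "ip v v = (\<Sum>j<M. ip (U (K * j) g) v)"
    using g v by (subst v_def) (simp add: ip_sum_left del: sum_closed)
  ultimately have "ip v v - ip (U K v) v = ip g v - ip (U (K * M) g) v"
    using g v sum_lessThan_telescope'[of "\<lambda>j. ip (U (K * j) g) v" M]
    by (simp add: sum_subtractf[symmetric] U_0 del: mult_Suc_right)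
  also have "\<dots> = ip (g - U (K * M) g) v" using g v by (simp add: ip_diff_left)
  finally have "(nrm v)\<^sup>2 - Re (ip (U K v) v) = Re (ip (g - U (K * M) g) v)"
    using v by (metis minus_complex.sel(1) nrm_sq)
  also have "\<dots> \<le> nrm (g - U (K * M) g) * nrm v" using g v by (intro Re_ip_le) auto
  finally have "(nrm v)\<^sup>2 - Re (ip (U K v) v) \<le> nrm (g - U (K * M) g) * nrm v" .
  moreover have "Re (ip (U K v) v) \<le> b * (nrm v)\<^sup>2"
    using num_radius_leD[OF w v] complex_Re_le_cmod order_trans by blast
  ultimately have "((1 - b) * nrm v) * nrm v \<le> nrm (g - U (K * M) g) * nrm v"
    by (simp add: algebra_simps power2_eq_square)
  then have "(1 - b) * nrm v \<le> nrm (g - U (K * M) g)"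
    using v nrm_nonneg[OF v] g by (cases "nrm v = 0") (auto simp: mult_le_cancel_right)
  also have "\<dots> \<le> nrm g + nrm (U (K * M) g)" using g by (intro nrm_diff) auto
  finally have nv: "nrm v \<le> (nrm g + nrm (U (K * M) g)) / (1 - b)"
    using b by (simp add: field_simps)
  have "ip (partial_resolvent (M * K) g) h = ip (\<Sum>r<K. U r v) h" if h: "h \<in> H" for h
  proof -
    have "ip (partial_resolvent (M * K) g) h = (\<Sum>k<M * K. ip (U k g) h)"
      using g h by (simp add: partial_resolvent_def ip_sum_left)
    also have "\<dots> = (\<Sum>r<K. \<Sum>j<M. ip (U (r + K * j) g) h)" by (rule sum_nat_residues)
    also have "\<dots> = ip (\<Sum>r<K. U r v) h"
      using g h v by (simp add: ip_sum_left) (simp add: v_def U_sum U_U)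
    finally show ?thesis .
  qed
  then have "nrm (partial_resolvent (M * K) g) = nrm (\<Sum>r<K. U r v)"
    using g v by (intro nrm_eqI) auto
  also have "\<dots> \<le> (\<Sum>r<K. nrm (U r v))" using v by (intro nrm_sum) auto
  also have "\<dots> \<le> (\<Sum>r<K. nrm v)" using v by (intro sum_mono U_contraction)
  also have "\<dots> \<le> K * ((nrm g + nrm (U (K * M) g)) / (1 - b))" using mult_left_mono[OF nv, of "real K"] by simp
  finally show ?thesis by simp
qed

text \<open>
  If \<open>R\<close> is the resolvent at 1, the double sum of autocovariances is the inner
  product of \<open>(U 1 - U (n + 1)) R R f\<close> with \<open>f\<close>, hence at most \<open>2
  d\<^sup>2 \<parallel>f\<parallel>\<^sup>2\<close>. Finite partial sums replace the resolvent,
  since \<open>H\<close> need not be complete; the error \<open>a (i + (N + l))\<close> they leave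
  vanishes in the limit.
\<close>

lemma tail_sum_bound:
  assumes f: "f \<in> H" and a: "summable (\<lambda>k. ip (U k f) f)"
    and N: "filterlim N at_top sequentially" and D: "D \<longlonglongrightarrow> d"
    and bound: "\<And>m g. g \<in> H \<Longrightarrow> nrm (partial_resolvent (N m) g) \<le> D m * nrm g"
    and D0: "\<And>m. 0 \<le> D m"
  shows "cmod (\<Sum>l=1..n. \<Sum>i. ip (U (i + l) f) f) \<le> 2 * d\<^sup>2 * (nrm f)\<^sup>2"
proof -
  define a where "a k = ip (U k f) f" for k
  have sum_a: "summable (\<lambda>i. a (i + l))" for l
    using a by (subst summable_iff_shift) (simp add: a_def[abs_def])
  have id: "(\<Sum>l=1..n. (\<Sum>i<N. a (i + l)) - (\<Sum>i<N. a (i + (N + l))))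
      = ip (U 1 (partial_resolvent N (partial_resolvent N f)) - U (n + 1) (partial_resolvent N (partial_resolvent N f))) f"
    (is "?L = ?R") for N
  proof -
    define c where "c k = (\<Sum>i<N. a (k + i))" for k
    have U_res: "ip (U k (partial_resolvent N g)) h = (\<Sum>i<N. ip (U (k + i) g) h)"
      if "g \<in> H" "h \<in> H" for k g h
      using that by (simp add: partial_resolvent_def U_sum U_U)
    have "ip (U k (partial_resolvent N (partial_resolvent N f))) f = (\<Sum>i<N. c (k + i))" for k
      using f by (simp add: U_res c_def a_def)
    then have "?R = (\<Sum>i<N. c (1 + i)) - (\<Sum>i<N. c (n + 1 + i))"
      using f by (simp add: ip_diff_left)
    also have "\<dots> = (\<Sum>i<N. \<Sum>j<N. a (1 + i + j) - a (n + 1 + i + j))"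
      by (simp add: c_def sum_subtractf)
    also have "\<dots> = (\<Sum>i<N. (\<Sum>l=1..n. a (i + l)) - (\<Sum>l=1..n. a (i + (N + l))))"
    proof (rule sum.cong[OF refl])
      fix i
      have "(\<Sum>j<N. a (1 + i + j) - a (n + 1 + i + j)) = (\<Sum>l=1..n. a (i + l)) - (\<Sum>l=1..n. a (i + (N + l)))"
      proof (induction N)
        case 0
        then show ?case by simp
      next
        case (Suc N)
        have "(\<Sum>l=1..n. a (i + (Suc N + l))) = (\<Sum>l=1..n. a (i + (N + l))) + a (i + N + n + 1) - a (i + N + 1)"
          by (induction n) (auto simp: algebra_simps)
        moreover have "(\<Sum>j<Suc N. a (1 + i + j) - a (n + 1 + i + j))
            = (\<Sum>j<N. a (1 + i + j) - a (n + 1 + i + j)) + (a (i + N + 1) - a (i + N + n + 1))"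
          by (simp add: ac_simps)
        ultimately show ?case using Suc by (simp only: Suc) (simp add: algebra_simps)
      qed
      then show "(\<Sum>j<N. a (1 + i + j) - a (n + 1 + i + j)) = (\<Sum>l=1..n. a (i + l)) - (\<Sum>l=1..n. a (i + (N + l)))" .
    qed
    also have "\<dots> = ?L"
      by (simp only: sum_subtractf sum.swap[of _ "{1..n}"])
    finally show ?thesis ..
  qed
  have ineq: "cmod (\<Sum>l=1..n. (\<Sum>i<N m. a (i + l)) - (\<Sum>i<N m. a (i + (N m + l)))) \<le> 2 * (D m)\<^sup>2 * (nrm f)\<^sup>2" for m
  proof -
    define v where "v = partial_resolvent (N m) (partial_resolvent (N m) f)"
    have v: "v \<in> H" using f by (simp add: v_def)
    have "nrm v \<le> D m * nrm (partial_resolvent (N m) f)" using f by (auto simp: v_def intro: bound)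
    also have "\<dots> \<le> D m * (D m * nrm f)" using f D0 by (intro mult_left_mono bound) auto
    finally have nv: "nrm v \<le> (D m)\<^sup>2 * nrm f" by (simp add: power2_eq_square)
    have "cmod (ip (U 1 v - U (n + 1) v) f) \<le> nrm (U 1 v - U (n + 1) v) * nrm f"
      using v f by (intro Cauchy_Schwarz) auto
    also have "\<dots> \<le> (nrm v + nrm v) * nrm f"
      using v f by (intro mult_right_mono order_trans[OF nrm_diff] add_mono U_contraction) auto
    also have "\<dots> \<le> 2 * ((D m)\<^sup>2 * nrm f) * nrm f"
      using nv f by (intro mult_right_mono) auto
    finally show ?thesis unfolding id v_def[symmetric] by (simp add: power2_eq_square)
  qed
  have "(\<lambda>m. \<Sum>l=1..n. (\<Sum>i<m. a (i + l)) - (\<Sum>i<m. a (i + (m + l)))) \<longlonglongrightarrow> (\<Sum>l=1..n. (\<Sum>i. a (i + l)) - 0)"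
  proof (intro tendsto_sum tendsto_diff)
    fix l
    show 1: "(\<lambda>m. \<Sum>i<m. a (i + l)) \<longlonglongrightarrow> (\<Sum>i. a (i + l))"
      by (rule summable_LIMSEQ[OF sum_a])
    have "(\<lambda>m. (\<Sum>i<m + m. a (i + l)) - (\<Sum>i<m. a (i + l))) \<longlonglongrightarrow> (\<Sum>i. a (i + l)) - (\<Sum>i. a (i + l))"
      by (intro tendsto_diff 1 filterlim_compose[OF 1]) (rule filterlim_at_top_mono[OF filterlim_ident]; simp)
    moreover have "(\<Sum>i<m + m. a (i + l)) - (\<Sum>i<m. a (i + l)) = (\<Sum>i<m. a (i + (m + l)))" for m
    proof -
      have "(\<Sum>i<m + k. a (i + l)) = (\<Sum>i<m. a (i + l)) + (\<Sum>i<k. a (i + (m + l)))" for k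
        by (induction k) (auto simp: algebra_simps)
      then show ?thesis by simp
    qed
    ultimately show "(\<lambda>m. \<Sum>i<m. a (i + (m + l))) \<longlonglongrightarrow> 0" by simp
  qed
  then have "(\<lambda>m. \<Sum>l=1..n. (\<Sum>i<N m. a (i + l)) - (\<Sum>i<N m. a (i + (N m + l)))) \<longlonglongrightarrow> (\<Sum>l=1..n. \<Sum>i. a (i + l))"
    by (auto intro: filterlim_compose[OF _ N])
  then have "(\<lambda>m. cmod (\<Sum>l=1..n. (\<Sum>i<N m. a (i + l)) - (\<Sum>i<N m. a (i + (N m + l))))) \<longlonglongrightarrow> cmod (\<Sum>l=1..n. \<Sum>i. a (i + l))"
    by (rule tendsto_norm)
  moreover have "(\<lambda>m. 2 * (D m)\<^sup>2 * (nrm f)\<^sup>2) \<longlonglongrightarrow> 2 * d\<^sup>2 * (nrm f)\<^sup>2"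
    by (intro tendsto_intros D)
  ultimately show ?thesis unfolding a_def[symmetric] by (rule LIMSEQ_le) (use ineq in blast)
qed

end

section \<open>Constants for semigroups with finitely many exceptional times\<close>

text \<open>
  The right-hand side is \<open>1 - \<beta>\<close> times the sum of \<open>\<beta> ^ 1, \<dots>,
  \<beta> ^ K\<close>, whose smallest term is \<open>\<beta> ^ K\<close>.
\<close>

lemma of_nat_mult_power_le_geometric:
  fixes \<beta> :: real
  assumes "0 \<le> \<beta>" "\<beta> < 1"
  shows "K * \<beta> ^ K * (1 - \<beta>) \<le> \<beta> * (1 - \<beta> ^ K)"
proof -
  have "K * \<beta> ^ K = (\<Sum>j<K. \<beta> ^ K)" by simp
  also have "\<dots> \<le> (\<Sum>j<K. \<beta> * \<beta> ^ j)"
    using assms by (intro sum_mono) (simp add: power_decreasing flip: power_Suc)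
  also have "\<dots> = \<beta> * (\<Sum>j<K. \<beta> ^ j)" by (simp add: sum_distrib_left)
  finally have "(1 - \<beta>) * (K * \<beta> ^ K) \<le> (1 - \<beta>) * (\<beta> * (\<Sum>j<K. \<beta> ^ j))"
    using assms by (intro mult_left_mono) auto
  also have "\<dots> = \<beta> * (1 - \<beta> ^ K)" by (simp add: one_diff_power_eq algebra_simps)
  finally show ?thesis by (simp add: algebra_simps)
qed

text \<open>
  Passing to every \<open>K\<close>-th time costs the factor \<open>K\<close>; the improved gap
  \<open>1 - \<beta> ^ K\<close> compensates for it up to the number of times that are skipped.
\<close>

lemma block_constant_le:
  fixes \<beta> :: real
  assumes "0 \<le> \<beta>" "\<beta> < 1" "K \<ge> 1" "K \<le> m + 1"
  shows "K * (2 / (1 - \<beta> ^ K) - 1) \<le> m + 2 / (1 - \<beta>)"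
proof -
  have y: "\<beta> ^ K < 1" using assms by (simp add: power_less_one_iff)
  have "K * \<beta> ^ K / (1 - \<beta> ^ K) \<le> \<beta> / (1 - \<beta>)"
    using of_nat_mult_power_le_geometric[OF assms(1,2), of K] assms y by (simp add: field_simps)
  moreover have "K * (2 / (1 - \<beta> ^ K) - 1) = K + 2 * (K * \<beta> ^ K / (1 - \<beta> ^ K))"
    using y by (simp add: field_simps)
  moreover have "2 * (\<beta> / (1 - \<beta>)) = 2 / (1 - \<beta>) - 2" using assms by (simp add: field_simps)
  moreover have "real K \<le> m + 1" using assms by linarith
  ultimately show ?thesis by linarith
qed

text \<open>
  The two left-hand sides are available bounds for the resolvent, from the \<open>K\<close>-step
  skeleton and from summing the norms of the powers; neither suffices alone. Put \<open>y =
  \<beta> ^ K\<close>. If \<open>e \<ge> K y / (1 - y)\<close>, the first is at most \<open>K +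
  e\<close>. Otherwise \<open>\<beta> ^ e \<ge> exp (y ln y / (1 - y))\<close>. For \<open>y \<le>
  1 / 2\<close> this is at least \<open>1 / 2\<close> and the second bound works; for \<open>y > 1
  / 2\<close> it dominates \<open>- ln y / (4 (1 - y))\<close>, which is enough for the first.
\<close>

lemma resolvent_constant_cases:
  fixes \<beta> :: real
  assumes \<beta>: "0 \<le> \<beta>" "\<beta> < 1" and K: "K \<ge> 1"
  shows "K / (1 - \<beta> ^ K) \<le> K + e + 4 * \<beta> ^ (K + e) / (1 - \<beta>) \<or>
         K + e + 2 * \<beta> ^ K / (1 - \<beta>) \<le> K + e + 4 * \<beta> ^ (K + e) / (1 - \<beta>)"
proof (cases "\<beta> = 0")
  case True
  then show ?thesis using K by (simp add: power_0_left)
next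
  case False
  then have b0: "0 < \<beta>" using \<beta> by simp
  define y where "y = \<beta> ^ K"
  have y: "0 < y" "y < 1" using b0 \<beta> K by (auto simp: y_def power_less_one_iff)
  have split: "K / (1 - y) = K + K * y / (1 - y)" using y by (simp add: field_simps)
  show ?thesis
  proof (cases "K * y / (1 - y) \<le> e")
    case True
    moreover have "0 \<le> 4 * \<beta> ^ (K + e) / (1 - \<beta>)" using \<beta> by simp
    ultimately show ?thesis using split by (simp add: y_def)
  next
    case False
    define L where "L = - ln y"
    have L: "L = K * (- ln \<beta>)" using b0 by (simp add: L_def y_def ln_realpow)
    have lam: "- ln \<beta> > 0" using b0 \<beta> by simp
    have "e * (- ln \<beta>) \<le> (K * y / (1 - y)) * (- ln \<beta>)"
      using False lam by (intro mult_right_mono) auto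
    also have "\<dots> = y * L / (1 - y)" by (simp add: L)
    finally have "- (y * L / (1 - y)) \<le> e * ln \<beta>" by simp
    then have "exp (- (y * L / (1 - y))) \<le> exp (e * ln \<beta>)" by simp
    also have "exp (e * ln \<beta>) = \<beta> ^ e" using b0 by (simp add: exp_of_nat_mult)
    finally have be: "exp (- (y * L / (1 - y))) \<le> \<beta> ^ e" .
    show ?thesis
    proof (cases "y \<le> 1 / 2")
      case True
      have "- ln (2 * y) \<le> 1 / (2 * y) - 1"
        using ln_le_minus_one[of "1 / (2 * y)"] y by (simp add: ln_div)
      then have "y * (- ln (2 * y)) \<le> y * (1 / (2 * y) - 1)" using y by (intro mult_left_mono) auto
      also have "\<dots> = 1 / 2 - y" using y by (simp add: field_simps)
      finally have "y * L \<le> y * ln 2 + (1 - 2 * y) * (1 / 2)"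
        using y by (simp add: L_def ln_mult algebra_simps)
      also have "\<dots> \<le> y * ln 2 + (1 - 2 * y) * ln 2"
        using True ln2_ge_two_thirds by (intro add_left_mono mult_left_mono) auto
      also have "\<dots> = (1 - y) * ln 2" by (simp add: algebra_simps)
      finally have "y * L / (1 - y) \<le> ln 2" using y by (simp add: field_simps)
      then have "exp (- ln 2) \<le> exp (- (y * L / (1 - y)))" by simp
      then have "1 / 2 \<le> \<beta> ^ e" using be by (simp add: exp_minus)
      then have "2 * \<beta> ^ K \<le> 4 * \<beta> ^ (K + e)"
        using y by (simp add: power_add y_def[symmetric])
      then have "2 * \<beta> ^ K / (1 - \<beta>) \<le> 4 * \<beta> ^ (K + e) / (1 - \<beta>)"
        using \<beta> by (intro divide_right_mono) auto
      then show ?thesis by simp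
    next
      case False
      \<comment> \<open>The bound \<open>ln x \<le> x - 1\<close> is too weak near \<open>y = 1 / 2\<close>; applied to \<open>1 / sqrt y\<close> it suffices, because \<open>exp 1 \<le> 4 sqrt y\<close>.\<close>
      define s where "s = sqrt y"
      have s: "0 < s" "s < 1" "s\<^sup>2 = y" using y by (auto simp: s_def)
      have s_ge: "0.7 \<le> s" unfolding s_def using False by (intro real_le_rsqrt) (simp add: power2_eq_square)
      have "L = 2 * ln (1 / s)" using s by (simp add: L_def ln_div ln_realpow flip: s(3))
      also have "\<dots> \<le> 2 * (1 / s - 1)" using ln_le_minus_one[of "1 / s"] s by simp
      finally have "L / (1 - y) \<le> 2 * (1 / s - 1) / (1 - y)" using y by (intro divide_right_mono) auto
      also have "\<dots> = 2 / (s * (1 + s))"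
      proof -
        have "1 - y = (1 - s) * (1 + s)" by (simp add: s(3)[symmetric] power2_eq_square algebra_simps)
        then show ?thesis using s by (simp add: divide_simps) 
      qed
      finally have t: "L / (1 - y) \<le> 2 / (s * (1 + s))" .
      have "y * L / (1 - y) \<le> y * (2 / (s * (1 + s)))"
        using mult_left_mono[OF t, of y] y by simp
      also have "\<dots> = 1 - (1 - s) / (1 + s)"
        using s by (simp add: s(3)[symmetric] divide_simps) (simp add: power2_eq_square algebra_simps)
      finally have "exp ((1 - s) / (1 + s) - 1) \<le> exp (- (y * L / (1 - y)))" by simp
      then have b1: "exp ((1 - s) / (1 + s) - 1) \<le> \<beta> ^ e" using be by linarith
      have "exp 1 \<le> 4 * s"
        using s_ge e_less_272 by linarith
      then have "2 / s * inverse (1 + s) \<le> 8 / exp 1 * inverse (1 + s)"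
        using s by (intro mult_right_mono) (auto simp: field_simps)
      then have "2 / (s * (1 + s)) \<le> 4 * (2 / (1 + s)) / exp 1"
        by (simp add: divide_inverse mult_ac)
      also have "\<dots> \<le> 4 * exp ((1 - s) / (1 + s)) / exp 1"
      proof -
        have "2 / (1 + s) = 1 + (1 - s) / (1 + s)" using s by (simp add: field_simps)
        also have "\<dots> \<le> exp ((1 - s) / (1 + s))" by (rule exp_ge_add_one_self)
        finally show ?thesis by (intro divide_right_mono mult_left_mono) auto
      qed
      also have "\<dots> \<le> 4 * \<beta> ^ e" using b1 by (simp add: exp_diff)
      finally have t4: "L / (1 - y) \<le> 4 * \<beta> ^ e" using t by linarith
      have "1 - \<beta> \<le> - ln \<beta>" using ln_le_minus_one[of \<beta>] b0 by simp
      then have "K * (1 - \<beta>) \<le> L" using L mult_left_mono[of "1 - \<beta>" "- ln \<beta>" "real K"] by simp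
      then have "K * (1 - \<beta>) / (1 - y) \<le> L / (1 - y)" using y by (intro divide_right_mono) auto
      then have "K * (1 - \<beta>) / (1 - y) \<le> 4 * \<beta> ^ e" using t4 by linarith
      then have "y * (K * (1 - \<beta>) / (1 - y)) \<le> y * (4 * \<beta> ^ e)" using y by (intro mult_left_mono) auto
      then have "K * y / (1 - y) \<le> 4 * \<beta> ^ (K + e) / (1 - \<beta>)"
        using \<beta> by (simp add: pos_le_divide_eq power_add y_def[symmetric] mult_ac)
      then show ?thesis using split by (simp add: y_def)
    qed
  qed
qed

context weak_contraction_semigroup
begin

context
  fixes C :: "nat set" and \<beta> :: real
  assumes C_pos: "C \<subseteq> {1..}" and Cc_fin: "finite ({1..} - C)"
    and \<beta>0: "0 \<le> \<beta>" and \<beta>1: "\<beta> < 1"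
    and rad: "\<And>k. k \<in> C \<Longrightarrow> num_radius_le k (\<beta> ^ k)"
begin

text \<open>
  If \<open>K\<close> is the least good time, the exceptional times are the \<open>K - 1\<close>
  earlier times and those from \<open>K\<close> on.
\<close>

lemma exceptional_set_split:
  obtains K where "K \<in> C" "K \<ge> 1" "card ({1..} - C) + 1 = K + card ({K..} - C)"
proof -
  have "C \<noteq> {}"
    using Cc_fin infinite_Ici[of "1::nat"] by auto
  define K where "K = (LEAST k. k \<in> C)"
  have K: "K \<in> C" unfolding K_def using \<open>C \<noteq> {}\<close> by (auto intro: LeastI)
  have least: "k \<notin> C" if "k < K" for k using that not_less_Least unfolding K_def by blast
  have K1: "K \<ge> 1" using K C_pos by auto
  have "{1..} - C = {1..<K} \<union> ({K..} - C)" using least K1 by fastforce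
  moreover have "finite ({K..} - C)" by (rule finite_subset[OF _ Cc_fin]) (use K1 in auto)
  ultimately have "card ({1..} - C) = card {1..<K} + card ({K..} - C)"
    by (simp add: card_Un_disjoint disjoint_iff)
  then show thesis using that[OF K K1] K1 by simp
qed

lemma block_bound_constant:
  obtains K where "K \<ge> 1" "\<beta> ^ K < 1" "num_radius_le K (\<beta> ^ K)"
    "K * (2 / (1 - \<beta> ^ K) - 1) \<le> card ({1..} - C) + 2 / (1 - \<beta>)"
proof -
  obtain K where K: "K \<in> C" "K \<ge> 1" "card ({1..} - C) + 1 = K + card ({K..} - C)"
    by (rule exceptional_set_split)
  have "K * (2 / (1 - \<beta> ^ K) - 1) \<le> card ({1..} - C) + 2 / (1 - \<beta>)"
    using K by (intro block_constant_le \<beta>0 \<beta>1) auto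
  then show thesis using that[of K] K rad \<beta>0 \<beta>1 by (auto simp: power_less_one_iff)
qed

lemma autocovariance_summable:
  assumes "f \<in> H"
  shows "summable (\<lambda>k. ip (U k f) f)"
proof (rule summable_comparison_test_ev)
  have "finite (- C)"
    by (rule finite_subset[of _ "insert 0 ({1..} - C)"]) (use Cc_fin in auto)
  then have "eventually (\<lambda>k. k \<in> C) sequentially"
    unfolding cofinite_eq_sequentially[symmetric] eventually_cofinite by (simp add: Compl_eq)
  then show "eventually (\<lambda>k. norm (ip (U k f) f) \<le> \<beta> ^ k * (nrm f)\<^sup>2) sequentially"
    by eventually_elim (use num_radius_leD rad assms in blast)
  show "summable (\<lambda>k. \<beta> ^ k * (nrm f)\<^sup>2)"
    using \<beta>0 \<beta>1 by (intro summable_mult2 summable_geometric) auto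
qed

text \<open>
  The first \<open>K\<close> powers and the exceptional ones are contractions, and the other
  powers have norm at most \<open>2 \<beta> ^ k\<close>.
\<close>

lemma partial_resolvent_bound_direct:
  assumes K: "K \<in> C" "K \<ge> 1" and g: "g \<in> H"
  shows "nrm (partial_resolvent N g) \<le> (K + card ({K..} - C) + 2 * \<beta> ^ K / (1 - \<beta>)) * nrm g"
proof -
  define E where "E = {K..} - C"
  have finE: "finite E" unfolding E_def by (rule finite_subset[OF _ Cc_fin]) (use K in auto)
  define c :: "nat \<Rightarrow> real" where
    "c k = (if k < K then 1 else 0) + (if k \<in> E then 1 else 0) + (if K \<le> k then 2 * \<beta> ^ k else 0)" for k
  have "nrm (partial_resolvent N g) \<le> (\<Sum>k<N. nrm (U k g))"
    unfolding partial_resolvent_def using g by (intro nrm_sum) auto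
  also have "\<dots> \<le> (\<Sum>k<N. c k * nrm g)"
  proof (rule sum_mono)
    fix k
    show "nrm (U k g) \<le> c k * nrm g"
    proof (cases "k < K \<or> k \<in> E")
      case True
      then have "1 \<le> c k" using \<beta>0 by (auto simp: c_def)
      then have "1 * nrm g \<le> c k * nrm g" using g by (intro mult_right_mono) auto
      then show ?thesis using U_contraction[OF g, of k] by simp
    next
      case False
      then have "k \<in> C" by (auto simp: E_def)
      from nrm_U_le_num_radius[OF rad[OF this] g] show ?thesis using False by (simp add: c_def)
    qed
  qed
  also have "\<dots> = (\<Sum>k<N. c k) * nrm g" by (simp add: sum_distrib_right)
  also have "\<dots> \<le> (K + card E + 2 * \<beta> ^ K / (1 - \<beta>)) * nrm g"
  proof (rule mult_right_mono)
    have "(\<Sum>k<N. if k < K then 1 else 0) = real (card ({..<N} \<inter> {..<K}))"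
      by (subst sum.inter_restrict[symmetric, where B = "{..<K}", unfolded lessThan_iff]) auto
    also have "\<dots> \<le> K" using card_mono[of "{..<K}" "{..<N} \<inter> {..<K}"] by simp
    finally have 1: "(\<Sum>k<N. if k < K then 1 else 0) \<le> real K" .
    have "(\<Sum>k<N. if k \<in> E then 1 else 0) = real (card ({..<N} \<inter> E))"
      by (subst sum.inter_restrict[symmetric]) auto
    also have "\<dots> \<le> card E" using card_mono[OF finE, of "{..<N} \<inter> E"] by simp
    finally have 2: "(\<Sum>k<N. if k \<in> E then 1 else 0) \<le> real (card E)" .
    have "(\<Sum>k<N. if K \<le> k then 2 * \<beta> ^ k else 0) \<le> (\<Sum>k. 2 * \<beta> ^ K * \<beta> ^ k)"
    proof -
      have "(\<Sum>k<N. if K \<le> k then 2 * \<beta> ^ k else 0) \<le> (\<Sum>k<K + N. if K \<le> k then 2 * \<beta> ^ k else 0)"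
        using \<beta>0 by (intro sum_mono2) auto
      also have "\<dots> = (\<Sum>k\<in>{K..<K + N}. 2 * \<beta> ^ k)"
        by (intro sum.mono_neutral_cong_right) auto
      also have "\<dots> = (\<Sum>k<N. 2 * \<beta> ^ K * \<beta> ^ k)"
        by (rule sum.reindex_bij_witness[of _ "\<lambda>k. k + K" "\<lambda>k. k - K"]) (auto simp flip: power_add)
      also have "\<dots> \<le> (\<Sum>k. 2 * \<beta> ^ K * \<beta> ^ k)"
        using \<beta>0 \<beta>1 by (intro sum_le_suminf summable_mult summable_geometric) auto
      finally show ?thesis .
    qed
    also have "\<dots> = 2 * \<beta> ^ K / (1 - \<beta>)"
      using \<beta>0 \<beta>1 by (simp add: suminf_mult suminf_geometric summable_geometric)
    finally show "(\<Sum>k<N. c k) \<le> K + card E + 2 * \<beta> ^ K / (1 - \<beta>)"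
      using 1 2 by (simp add: c_def sum.distrib)
  qed (use g in simp)
  finally show ?thesis by (simp add: E_def)
qed

text \<open>
  Of the two resolvent bounds, the one that lies below the required constant is used. The skeleton
  bound needs a correction term that decays only along good times, so the skeleton is followed
  beyond the last exceptional time.
\<close>

lemma tail_sum_bound_constant:
  assumes f: "f \<in> H"
  shows "cmod (\<Sum>l=1..n. \<Sum>i. ip (U (i + l) f) f)
     \<le> 2 * (1 + card ({1..} - C) + 4 * \<beta> ^ (card ({1..} - C) + 1) / (1 - \<beta>))\<^sup>2 * (nrm f)\<^sup>2"
proof -
  obtain K where K: "K \<in> C" "K \<ge> 1" and m: "card ({1..} - C) + 1 = K + card ({K..} - C)"
    by (rule exceptional_set_split)
  define e where "e = card ({K..} - C)"
  define D where "D = K + e + 4 * \<beta> ^ (K + e) / (1 - \<beta>)"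
  have D_eq: "1 + card ({1..} - C) + 4 * \<beta> ^ (card ({1..} - C) + 1) / (1 - \<beta>) = D"
  proof -
    have "1 + real (card ({1..} - C)) = real K + real e" using m by (simp add: e_def flip: of_nat_add)
    then show ?thesis unfolding m D_def e_def[symmetric] by simp
  qed
  have bK: "\<beta> ^ K < 1" using K \<beta>0 \<beta>1 by (simp add: power_less_one_iff)
  have "\<exists>d. 0 \<le> d \<and> d \<le> D \<and> cmod (\<Sum>l=1..n. \<Sum>i. ip (U (i + l) f) f) \<le> 2 * d\<^sup>2 * (nrm f)\<^sup>2"
  proof -
    consider "K / (1 - \<beta> ^ K) \<le> D" | "K + e + 2 * \<beta> ^ K / (1 - \<beta>) \<le> D"
      using resolvent_constant_cases[OF \<beta>0 \<beta>1 K(2), of e] unfolding D_def of_nat_add by blast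
    then show ?thesis
    proof cases
      case 1
      obtain B where B: "\<And>k. k \<in> {1..} - C \<Longrightarrow> k < B"
        using finite_nat_bounded[OF Cc_fin] by (auto simp: subset_eq)
      have inC: "k \<in> C" if "k \<ge> B" "k \<ge> 1" for k using B[of k] that by fastforce
      define N where "N i = (i + B + 1) * K" for i
      have NC: "N i \<in> C" for i
      proof -
        have "(i + B + 1) * 1 \<le> N i" unfolding N_def using K by (intro mult_left_mono) auto
        then show ?thesis by (intro inC) auto
      qed
      have N_lim: "filterlim N at_top sequentially"
      proof (rule filterlim_at_top_mono[OF filterlim_ident])
        have "i * 1 \<le> N i" for i unfolding N_def using K by (intro mult_mono) auto
        then show "eventually (\<lambda>i. i \<le> N i) sequentially" by simp
      qed
      have "(\<lambda>i. K / (1 - \<beta> ^ K) * (1 + 2 * \<beta> ^ N i)) \<longlonglongrightarrow> K / (1 - \<beta> ^ K) * (1 + 2 * 0)"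
        using \<beta>0 \<beta>1 by (intro tendsto_intros filterlim_compose[OF LIMSEQ_realpow_zero N_lim])
      then have "cmod (\<Sum>l=1..n. \<Sum>i. ip (U (i + l) f) f) \<le> 2 * (K / (1 - \<beta> ^ K) * (1 + 2 * 0))\<^sup>2 * (nrm f)\<^sup>2"
      proof (rule tail_sum_bound[OF f autocovariance_summable[OF f] N_lim])
        fix i g assume g: "g \<in> H"
        have "nrm (partial_resolvent (N i) g) \<le> K / (1 - \<beta> ^ K) * (nrm g + nrm (U (K * (i + B + 1)) g))"
          unfolding N_def by (rule partial_resolvent_skeleton_bound[OF rad[OF K(1)] bK g])
        also have "\<dots> \<le> K / (1 - \<beta> ^ K) * (nrm g + 2 * \<beta> ^ N i * nrm g)"
          using nrm_U_le_num_radius[OF rad[OF NC[of i]] g] bK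
          by (intro mult_left_mono add_left_mono) (auto simp: N_def mult.commute)
        finally show "nrm (partial_resolvent (N i) g) \<le> K / (1 - \<beta> ^ K) * (1 + 2 * \<beta> ^ N i) * nrm g"
          by (simp add: algebra_simps)
      qed (use bK \<beta>0 in simp)
      then show ?thesis using 1 bK by (intro exI[of _ "K / (1 - \<beta> ^ K)"]) auto
    next
      case 2
      have "cmod (\<Sum>l=1..n. \<Sum>i. ip (U (i + l) f) f) \<le> 2 * (K + e + 2 * \<beta> ^ K / (1 - \<beta>))\<^sup>2 * (nrm f)\<^sup>2"
        by (rule tail_sum_bound[OF f autocovariance_summable[OF f] filterlim_ident tendsto_const])
           (use partial_resolvent_bound_direct[OF K] \<beta>0 \<beta>1 in \<open>auto simp: e_def\<close>)
      then show ?thesis using 2 \<beta>0 \<beta>1 by (intro exI[of _ "K + e + 2 * \<beta> ^ K / (1 - \<beta>)"]) auto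
    qed
  qed
  then obtain d where d: "0 \<le> d" "d \<le> D"
    "cmod (\<Sum>l=1..n. \<Sum>i. ip (U (i + l) f) f) \<le> 2 * d\<^sup>2 * (nrm f)\<^sup>2" by blast
  then have "2 * d\<^sup>2 * (nrm f)\<^sup>2 \<le> 2 * D\<^sup>2 * (nrm f)\<^sup>2"
    by (intro mult_right_mono mult_left_mono power_mono) auto
  with d(3) show ?thesis unfolding D_eq by linarith
qed

end
end

section \<open>Finite partitions and antisymmetric densities\<close>

context prob_space
begin

abbreviation "MM \<equiv> M \<Otimes>\<^sub>M M"

interpretation sq: pair_prob_space M M ..

text \<open>
  Twice the mass that the antisymmetric part of \<open>h\<close> puts on the pairs of points which
  the finite partition into level sets of \<open>c\<close> does not separate.
\<close>

abbreviation defect :: "('a \<Rightarrow> nat) \<Rightarrow> ('a \<times> 'a \<Rightarrow> real) \<Rightarrow> real" where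
  "defect c h \<equiv> \<integral>p. indicator {p. c (fst p) = c (snd p)} p * \<bar>h p - h (prod.swap p)\<bar> \<partial>MM"

text \<open>
  On an atom an antisymmetric function vanishes, and elsewhere a fine partition has small diagonal
  blocks; every integrable \<open>h\<close> therefore has partitions of arbitrarily small defect.
  The proof approximates \<open>h\<close> by indicators of rectangles, for which a finite
  partition has defect zero.
\<close>

definition resolves :: "('a \<times> 'a \<Rightarrow> real) \<Rightarrow> bool" where
  "resolves h \<longleftrightarrow> (\<forall>\<epsilon>>0. \<exists>c::'a \<Rightarrow> nat. c \<in> M \<rightarrow>\<^sub>M count_space UNIV \<and> finite (range c) \<and>
     defect c h < \<epsilon>)"

lemma resolvesE:
  assumes "resolves h" "0 < \<epsilon>"
  obtains c :: "'a \<Rightarrow> nat" where "c \<in> M \<rightarrow>\<^sub>M count_space UNIV" "finite (range c)"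
    "defect c h < \<epsilon>"
proof -
  note assms(1)[unfolded resolves_def, rule_format, OF assms(2)]
  then show thesis using that by (elim exE conjE) 
qed

lemma swap_case_prod: "prod.swap = (\<lambda>(x, y). (y, x))"
  by auto

lemma swap_measurable [measurable]: "prod.swap \<in> MM \<rightarrow>\<^sub>M MM"
  unfolding swap_case_prod by (rule measurable_pair_swap')

lemma integrable_swap:
  fixes h :: "'a \<times> 'a \<Rightarrow> 'b::{banach, second_countable_topology}"
  assumes "integrable MM h"
  shows "integrable MM (\<lambda>p. h (prod.swap p))"
  using sq.integrable_product_swap[OF assms] by (simp add: case_prod_unfold swap_case_prod)

lemma integral_swap:
  fixes h :: "'a \<times> 'a \<Rightarrow> 'b::{banach, second_countable_topology}"
  assumes "h \<in> borel_measurable MM"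
  shows "(\<integral>p. h (prod.swap p) \<partial>MM) = (\<integral>p. h p \<partial>MM)"
  using sq.integral_product_swap[OF assms] by (simp add: case_prod_unfold swap_case_prod)

lemma same_class_sets [measurable]:
  assumes [measurable]: "c \<in> M \<rightarrow>\<^sub>M count_space (UNIV :: nat set)"
  shows "Measurable.pred MM (\<lambda>p. c (fst p) = c (snd p))"
proof -
  have "Measurable.pred MM (\<lambda>p. \<exists>n. c (snd p) = n \<and> c (fst p) = n)" by measurable
  then show ?thesis by simp
qed

lemma integrable_same_class:
  assumes [measurable]: "c \<in> M \<rightarrow>\<^sub>M count_space (UNIV :: nat set)" 
    and k: "integrable MM (k :: _ \<Rightarrow> real)"
  shows "integrable MM (\<lambda>p. indicator {p. c (fst p) = c (snd p)} p * k p)"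
proof (rule Bochner_Integration.integrable_bound[OF k])
  have [measurable]: "k \<in> borel_measurable MM" using k by simp
  have "(\<lambda>p. (if c (fst p) = c (snd p) then 1 else 0) * k p) \<in> borel_measurable MM"
    by measurable
  then show "(\<lambda>p. indicator {p. c (fst p) = c (snd p)} p * k p) \<in> borel_measurable MM"
    by (simp add: indicator_def of_bool_def)
qed (auto simp: indicator_def)

text \<open>
  The defect is 2-Lipschitz in \<open>h\<close> for the \<open>L\<^sup>1\<close> distance.
\<close>

lemma resolves_limit:
  assumes h: "integrable MM h"
    and approx: "\<And>\<epsilon>. \<epsilon> > 0 \<Longrightarrow> \<exists>h'. integrable MM h' \<and> resolves h' \<and> (\<integral>p. \<bar>h p - h' p\<bar> \<partial>MM) < \<epsilon>"
  shows "resolves h"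
  unfolding resolves_def
proof (intro allI impI)
  fix \<epsilon> :: real assume "\<epsilon> > 0"
  then obtain h' where h': "integrable MM h'" "resolves h'" "(\<integral>p. \<bar>h p - h' p\<bar> \<partial>MM) < \<epsilon> / 3"
    using approx[of "\<epsilon> / 3"] by auto
  then have e: "\<epsilon> / 3 > 0" using \<open>\<epsilon> > 0\<close> by simp
  obtain c :: "'a \<Rightarrow> nat" where c: "c \<in> M \<rightarrow>\<^sub>M count_space UNIV" "finite (range c)"
    "defect c h' < \<epsilon> / 3"
    by (rule resolvesE[OF h'(2) e])
  let ?I = "indicator {p. c (fst p) = c (snd p)} :: _ \<Rightarrow> real"
  note int = h h'(1) integrable_swap[OF h] integrable_swap[OF h'(1)]
  have abs4: "\<bar>x - y\<bar> \<le> \<bar>x' - y'\<bar> + (\<bar>x - x'\<bar> + \<bar>y - y'\<bar>)" for x y x' y' :: real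
    by arith
  have le: "?I p * \<bar>h p - h (prod.swap p)\<bar>
     \<le> ?I p * \<bar>h' p - h' (prod.swap p)\<bar> + (\<bar>h p - h' p\<bar> + \<bar>h (prod.swap p) - h' (prod.swap p)\<bar>)" for p
    using abs4[of "h p" "h (prod.swap p)" "h' p" "h' (prod.swap p)"] by (simp add: indicator_def)
  have "(\<integral>p. ?I p * \<bar>h p - h (prod.swap p)\<bar> \<partial>MM)
     \<le> (\<integral>p. ?I p * \<bar>h' p - h' (prod.swap p)\<bar> + (\<bar>h p - h' p\<bar> + \<bar>h (prod.swap p) - h' (prod.swap p)\<bar>) \<partial>MM)"
    by (intro integral_mono Bochner_Integration.integrable_add integrable_same_class c(1)
         Bochner_Integration.integrable_abs Bochner_Integration.integrable_diff int le)
  also have "\<dots> = (\<integral>p. ?I p * \<bar>h' p - h' (prod.swap p)\<bar> \<partial>MM)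
      + ((\<integral>p. \<bar>h p - h' p\<bar> \<partial>MM) + (\<integral>p. \<bar>h (prod.swap p) - h' (prod.swap p)\<bar> \<partial>MM))"
    by (subst Bochner_Integration.integral_add Bochner_Integration.integral_add;
        (intro Bochner_Integration.integrable_add integrable_same_class c(1)
         Bochner_Integration.integrable_abs Bochner_Integration.integrable_diff int)?)+ simp
  also have "(\<integral>p. \<bar>h (prod.swap p) - h' (prod.swap p)\<bar> \<partial>MM) = (\<integral>p. \<bar>h p - h' p\<bar> \<partial>MM)"
    using h h'(1) by (intro integral_swap[of "\<lambda>p. \<bar>h p - h' p\<bar>"]) simp
  finally have "(\<integral>p. ?I p * \<bar>h p - h (prod.swap p)\<bar> \<partial>MM) < \<epsilon>"
    using h'(3) c(3) by simp
  then show "\<exists>c::'a \<Rightarrow> nat. c \<in> M \<rightarrow>\<^sub>M count_space UNIV \<and> finite (range c) \<and>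
     defect c h < \<epsilon>"
    using c by blast
qed

text \<open>
  The common refinement of two partitions, encoded by pairing the labels, has at most the sum of
  the two defects.
\<close>

lemma resolves_add:
  assumes h: "integrable MM h" "resolves h" and k: "integrable MM k" "resolves k"
  shows "resolves (\<lambda>p. h p + k p)"
  unfolding resolves_def
proof (intro allI impI)
  fix \<epsilon> :: real assume "\<epsilon> > 0"
  then have e: "\<epsilon> / 2 > 0" by simp
  obtain c :: "'a \<Rightarrow> nat" where c[measurable]: "c \<in> M \<rightarrow>\<^sub>M count_space UNIV" and fc: "finite (range c)"
    and hc: "defect c h < \<epsilon> / 2"
    by (rule resolvesE[OF h(2) e])
  obtain d :: "'a \<Rightarrow> nat" where d[measurable]: "d \<in> M \<rightarrow>\<^sub>M count_space UNIV" and fd: "finite (range d)"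
    and kd: "defect d k < \<epsilon> / 2"
    by (rule resolvesE[OF k(2) e])
  define b where "b x = prod_encode (c x, d x)" for x
  have b: "b \<in> M \<rightarrow>\<^sub>M count_space UNIV" unfolding b_def by measurable
  have "range b \<subseteq> prod_encode ` (range c \<times> range d)" by (auto simp: b_def)
  then have fb: "finite (range b)" using fc fd by (meson finite_SigmaI finite_imageI finite_subset)
  note int = h(1) k(1) integrable_swap[OF h(1)] integrable_swap[OF k(1)]
  note rules = Bochner_Integration.integrable_add integrable_same_class b c d
         Bochner_Integration.integrable_abs Bochner_Integration.integrable_diff int
  have "(\<integral>p. indicator {p. b (fst p) = b (snd p)} p * \<bar>(h p + k p) - (h (prod.swap p) + k (prod.swap p))\<bar> \<partial>MM)
     \<le> (\<integral>p. indicator {p. c (fst p) = c (snd p)} p * \<bar>h p - h (prod.swap p)\<bar>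
            + indicator {p. d (fst p) = d (snd p)} p * \<bar>k p - k (prod.swap p)\<bar> \<partial>MM)"
  proof (intro integral_mono rules)
    fix p
    have abs: "\<bar>(x + y) - (x' + y')\<bar> \<le> \<bar>x - x'\<bar> + \<bar>y - y'\<bar>" for x y x' y' :: real by arith
    show "indicator {p. b (fst p) = b (snd p)} p * \<bar>(h p + k p) - (h (prod.swap p) + k (prod.swap p))\<bar>
       \<le> indicator {p. c (fst p) = c (snd p)} p * \<bar>h p - h (prod.swap p)\<bar>
            + indicator {p. d (fst p) = d (snd p)} p * \<bar>k p - k (prod.swap p)\<bar>"
    proof (cases "b (fst p) = b (snd p)")
      case True
      then have "c (fst p) = c (snd p)" "d (fst p) = d (snd p)" by (simp_all add: b_def)
      then show ?thesis using abs[of "h p" "k p"] True by simp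
    qed (simp add: indicator_def)
  qed
  also have "\<dots> < \<epsilon>"
    using hc kd by (subst Bochner_Integration.integral_add) (auto intro!: rules)
  finally show "\<exists>c::'a \<Rightarrow> nat. c \<in> M \<rightarrow>\<^sub>M count_space UNIV \<and> finite (range c) \<and>
     defect c (\<lambda>p. h p + k p) < \<epsilon>"
    using b fb by blast
qed

lemma resolves_zero: "resolves (\<lambda>p. 0)"
  unfolding resolves_def by (auto intro!: exI[of _ "\<lambda>x. 0"])

lemma resolves_sum:
  assumes "\<And>i. i < (n::nat) \<Longrightarrow> integrable MM (h i)" "\<And>i. i < n \<Longrightarrow> resolves (h i)"
  shows "resolves (\<lambda>p. \<Sum>i<n. h i p)"
  using assms by (induction n) (auto intro!: resolves_add resolves_zero)

lemma resolves_mult: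
  assumes "resolves h"
  shows "resolves (\<lambda>p. h p * c)"
proof (cases "c = 0")
  case False
  show ?thesis unfolding resolves_def
  proof (intro allI impI)
    fix \<epsilon> :: real assume "\<epsilon> > 0"
    then have e: "\<epsilon> / \<bar>c\<bar> > 0" using False by simp
    obtain d :: "'a \<Rightarrow> nat" where d: "d \<in> M \<rightarrow>\<^sub>M count_space UNIV" "finite (range d)"
      "defect d h < \<epsilon> / \<bar>c\<bar>"
      by (rule resolvesE[OF assms e])
    have "(\<integral>p. indicator {p. d (fst p) = d (snd p)} p * \<bar>h p * c - h (prod.swap p) * c\<bar> \<partial>MM)
      = (\<integral>p. \<bar>c\<bar> * (indicator {p. d (fst p) = d (snd p)} p * \<bar>h p - h (prod.swap p)\<bar>) \<partial>MM)"
      by (intro Bochner_Integration.integral_cong) (auto simp: abs_mult[symmetric] algebra_simps)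
    also have "\<dots> < \<epsilon>" using d(3) False by (simp add: field_simps)
    finally show "\<exists>d::'a \<Rightarrow> nat. d \<in> M \<rightarrow>\<^sub>M count_space UNIV \<and> finite (range d) \<and>
      defect d (\<lambda>p. h p * c) < \<epsilon>"
      using d by blast
  qed
qed (simp add: resolves_zero)

text \<open>
  A rectangle \<open>A \<times> B\<close> is symmetric on the blocks of the partition generated by
  \<open>A\<close> and \<open>B\<close>. The remaining sets follow by Dynkin's lemma, where a
  disjoint union is the \<open>L\<^sup>1\<close> limit of its finite parts.
\<close>

lemma resolves_indicator:
  assumes "E \<in> sets MM"
  shows "resolves (indicator E)"
proof -
  let ?R = "{A \<times> B | A B. A \<in> sets M \<and> B \<in> sets M}"
  have E: "E \<in> sigma_sets (space M \<times> space M) ?R" using assms by (simp add: sets_pair_measure)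
  have stable: "Int_stable ?R" by (rule Int_stable_pair_measure_generator)
  have sub: "?R \<subseteq> Pow (space M \<times> space M)" using sets.sets_into_space by fast
  show ?thesis using stable sub E
  proof (induction rule: sigma_sets_induct_disjoint)
    case (basic E)
    then obtain A B where AB: "A \<in> sets M" "B \<in> sets M" "E = A \<times> B" by auto
    define c :: "'a \<Rightarrow> nat" where "c x = (if x \<in> A then 1 else 0) + 2 * (if x \<in> B then 1 else 0)" for x
    have 1: "c \<in> M \<rightarrow>\<^sub>M count_space UNIV" using AB unfolding c_def by measurable
    have 2: "finite (range c)" by (rule finite_subset[of _ "{..3}"]) (auto simp: c_def)
    have "indicator {p. c (fst p) = c (snd p)} p * \<bar>indicator E p - indicator E (prod.swap p)\<bar> = (0::real)" for p :: "'a \<times> 'a"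
      by (cases p) (auto simp: indicator_def AB(3) c_def split: if_splits)
    then have "(\<integral>p. indicator {p. c (fst p) = c (snd p)} p * \<bar>indicator E p - indicator E (prod.swap p)\<bar> \<partial>MM) = (0::real)"
      by (simp only: Bochner_Integration.integral_zero)
    then show ?case unfolding resolves_def using 1 2 by (intro allI impI exI[of _ c]) simp
  next
    case empty
    then show ?case using resolves_zero by (simp add: indicator_def)
  next
    case (compl E)
    have *: "(\<integral>p. indicator {p. c (fst p) = c (snd p)} p *
        \<bar>indicator (space M \<times> space M - E) p - (indicator (space M \<times> space M - E) (prod.swap p) :: real)\<bar> \<partial>MM)
       = (\<integral>p. indicator {p. c (fst p) = c (snd p)} p *
        \<bar>indicator E p - indicator E (prod.swap p)\<bar> \<partial>MM)" for c :: "'a \<Rightarrow> nat"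
      by (rule Bochner_Integration.integral_cong) (auto simp: indicator_def space_pair_measure)
    show ?case using compl(2) unfolding resolves_def * by simp
  next
    case (union A)
    have A: "A i \<in> sets MM" for i
      using union(2) by (auto simp: sets_pair_measure)
    have intA: "integrable MM (indicator B :: _ \<Rightarrow> real)" if "B \<in> sets MM" for B
      using that by (intro sq.integrable_const_bound[where B=1]) (auto simp: indicator_def)
    show ?case
    proof (rule resolves_limit)
      show "integrable MM (indicator (\<Union>i. A i) :: _ \<Rightarrow> real)" using A by (intro intA) auto
      fix \<epsilon> :: real assume e: "\<epsilon> > 0"
      have "(\<lambda>n. \<Sum>i<n. measure MM (A i)) \<longlonglongrightarrow> measure MM (\<Union>i. A i)"
        using sq.finite_measure_UNION[of A] A union(1) by (auto simp: sums_def)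
      from order_tendstoD(1)[OF this, of "measure MM (\<Union>i. A i) - \<epsilon>"] e
      obtain n where n: "measure MM (\<Union>i. A i) - \<epsilon> < (\<Sum>i<n. measure MM (A i))"
        by (auto simp: eventually_sequentially)
      have le: "(\<Sum>i<n. indicator (A i) p) \<le> (indicator (\<Union>i. A i) p :: real)" for p
      proof -
        have "(\<Sum>i<n. indicator (A i) p) = (indicator (\<Union>i<n. A i) p :: real)"
          using union(1) by (intro indicator_UN_disjoint[symmetric]) (auto simp: disjoint_family_on_def)
        then show ?thesis by (auto simp: indicator_def)
      qed
      have "(\<integral>p. \<bar>indicator (\<Union>i. A i) p - (\<Sum>i<n. indicator (A i) p) :: real\<bar> \<partial>MM)
          = (\<integral>p. indicator (\<Union>i. A i) p - (\<Sum>i<n. indicator (A i) p) \<partial>MM)"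
        using le by (intro Bochner_Integration.integral_cong) auto
      also have "\<dots> = measure MM (\<Union>i. A i) - (\<Sum>i<n. measure MM (A i))"
        using A by (subst Bochner_Integration.integral_diff)
          (auto intro!: intA Bochner_Integration.integrable_sum simp: Bochner_Integration.integral_sum intA)
      finally have "(\<integral>p. \<bar>indicator (\<Union>i. A i) p - (\<Sum>i<n. indicator (A i) p)\<bar> \<partial>MM) < \<epsilon>"
        using n by simp
      then show "\<exists>h'. integrable MM h' \<and> resolves h' \<and> (\<integral>p. \<bar>indicator (\<Union>i. A i) p - h' p\<bar> \<partial>MM) < \<epsilon>"
        using A union(3)
        by (intro exI[of _ "\<lambda>p. \<Sum>i<n. indicator (A i) p"])
           (auto intro!: resolves_sum intA Bochner_Integration.integrable_sum)
    qed
  qed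
qed

lemma resolves_integrable:
  assumes "integrable MM h"
  shows "resolves h"
  using assms
proof (induction h rule: integrable_induct)
  case (base A c)
  then show ?case using resolves_mult[OF resolves_indicator[of A], of c] by simp
next
  case (add f g)
  then show ?case by (intro resolves_add)
next
  case (lim f s)
  show ?case
  proof (rule resolves_limit)
    fix \<epsilon> :: real assume e: "\<epsilon> > 0"
    have "(\<lambda>i. \<integral>p. \<bar>f p - s i p\<bar> \<partial>MM) \<longlonglongrightarrow> (\<integral>p. 0 \<partial>MM)"
    proof (rule integral_dominated_convergence[where w = "\<lambda>p. 3 * \<bar>f p\<bar>"])
      show "AE p in MM. (\<lambda>i. \<bar>f p - s i p\<bar>) \<longlonglongrightarrow> 0"
      proof (rule AE_I2)
        fix p assume "p \<in> space MM"
        from \<open>\<And>x. x \<in> space MM \<Longrightarrow> (\<lambda>i. s i x) \<longlonglongrightarrow> f x\<close>[OF this] have "(\<lambda>i. \<bar>f p - s i p\<bar>) \<longlonglongrightarrow> \<bar>f p - f p\<bar>" by (intro tendsto_intros)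
        then show "(\<lambda>i. \<bar>f p - s i p\<bar>) \<longlonglongrightarrow> 0" by simp
      qed
      show "AE p in MM. norm \<bar>f p - s i p\<bar> \<le> 3 * \<bar>f p\<bar>" for i
      proof (rule AE_I2)
        fix p assume "p \<in> space MM"
        from \<open>\<And>i x. x \<in> space MM \<Longrightarrow> norm (s i x) \<le> 2 * norm (f x)\<close>[OF this, of i]
        show "norm \<bar>f p - s i p\<bar> \<le> 3 * \<bar>f p\<bar>" by (simp add: abs_le_iff) linarith
      qed
    qed (use lim in auto)
    from order_tendstoD(2)[OF this, of \<epsilon>] e obtain i where "(\<integral>p. \<bar>f p - s i p\<bar> \<partial>MM) < \<epsilon>"
      by (auto simp: eventually_sequentially)
    then show "\<exists>h'. integrable MM h' \<and> resolves h' \<and> (\<integral>p. \<bar>f p - h' p\<bar> \<partial>MM) < \<epsilon>"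
      using lim by blast
  qed fact
qed

end

section \<open>Numerical radius of a doubly stochastic density\<close>

lemma L2_measurable: "f \<in> L2 M \<Longrightarrow> f \<in> borel_measurable M"
  by (simp add: L2_def)

lemma L2_square_integrable: "f \<in> L2 M \<Longrightarrow> integrable M (\<lambda>x. (cmod (f x))\<^sup>2)"
  by (simp add: L2_def)

lemma borel_measurable_cnj [measurable (raw)]:
  "f \<in> borel_measurable M \<Longrightarrow> (\<lambda>x. cnj (f x)) \<in> borel_measurable M"
  by (rule borel_measurable_continuous_on[where f = cnj]) (auto intro!: continuous_intros)

text \<open>
  The value \<open>b0 + s + i t\<close> of the form of the kernel splits into the real part
  \<open>b0\<close> from its minimum with its reversal and \<open>s + i t\<close> from the excess
  over this minimum, which is at most \<open>\<rho>\<close> in absolute value. The two bounds on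
  the Metropolis-Hastings forms say that \<open>\<bar>b0 + s\<bar> \<le> \<beta> - \<rho> +
  s\<close>, and \<open>\<rho> \<le> \<beta>\<close> is what turns this into a bound on the
  modulus.
\<close>

lemma min_max_radius:
  fixes b0 \<rho> s t \<beta> :: real
  assumes 1: "b0 + \<rho> \<le> \<beta>" and 2: "- \<beta> \<le> b0 + 2 * s - \<rho>" and 3: "\<rho> \<le> \<beta>" and 4: "s\<^sup>2 + t\<^sup>2 \<le> \<rho>\<^sup>2"
    and \<rho>: "0 \<le> \<rho>"
  shows "(b0 + s)\<^sup>2 + t\<^sup>2 \<le> \<beta>\<^sup>2"
proof -
  have "s \<le> \<rho>" using 4 \<rho> by (meson abs_le_D1 abs_le_square_iff le_add_same_cancel1 order_trans zero_le_power2 power2_le_imp_le)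
  have "\<bar>b0 + s\<bar> \<le> \<beta> - \<rho> + s" using 1 2 by (auto simp: abs_le_iff)
  then have "(b0 + s)\<^sup>2 \<le> (\<beta> - \<rho> + s)\<^sup>2" using abs_le_square_iff by fastforce
  then have "(b0 + s)\<^sup>2 + t\<^sup>2 \<le> (\<beta> - \<rho>)\<^sup>2 + 2 * ((\<beta> - \<rho>) * s) + \<rho>\<^sup>2"
  proof -
    have "(\<beta> - \<rho> + s)\<^sup>2 = (\<beta> - \<rho>)\<^sup>2 + 2 * ((\<beta> - \<rho>) * s) + s\<^sup>2"
      by (simp add: power2_eq_square algebra_simps)
    with 4 \<open>(b0 + s)\<^sup>2 \<le> (\<beta> - \<rho> + s)\<^sup>2\<close> show ?thesis by linarith
  qed
  also have "\<dots> \<le> (\<beta> - \<rho>)\<^sup>2 + 2 * ((\<beta> - \<rho>) * \<rho>) + \<rho>\<^sup>2"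
    using \<open>s \<le> \<rho>\<close> 3 by (simp add: mult_left_mono)
  also have "\<dots> = \<beta>\<^sup>2" by (simp add: power2_eq_square algebra_simps)
  finally show ?thesis .
qed

lemma norm_mult_le_squares: "cmod (a * cnj b) \<le> (cmod a)\<^sup>2 + (cmod b)\<^sup>2"
proof -
  have "2 * (cmod a * cmod b) \<le> (cmod a)\<^sup>2 + (cmod b)\<^sup>2" using sum_squares_bound[of "cmod a" "cmod b"] by (simp add: mult.assoc)
  moreover have "0 \<le> cmod a * cmod b" by simp
  ultimately show ?thesis unfolding norm_mult complex_mod_cnj by linarith
qed

text \<open>
  \<open>Q\<close> is the density, with respect to the stationary law, of a transition kernel for
  which that law is stationary. The kernel has density \<open>Q (x, y)\<close> and its time
  reversal has density \<open>Q (y, x)\<close>, so all Metropolis-Hastings quantities become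
  expressions in \<open>Q\<close> and its reversal \<open>Q'\<close>.
\<close>

locale doubly_stochastic = prob_space +
  fixes Q :: "'a \<times> 'a \<Rightarrow> real"
  assumes Q_measurable [measurable]: "Q \<in> borel_measurable MM"
    and Q_nonneg [simp]: "0 \<le> Q p"
    and row: "AE x in M. (\<integral>\<^sup>+y. Q (x, y) \<partial>M) = 1"
    and col: "AE y in M. (\<integral>\<^sup>+x. Q (x, y) \<partial>M) = 1"
begin

sublocale sq: pair_prob_space M M ..

abbreviation "Q' p \<equiv> Q (prod.swap p)"

text \<open>
  \<open>Q\<close> is the density of a coupling of the stationary law with itself.
\<close>

lemma marginal_fst: "distr (density MM Q) M fst = M"
proof (rule measure_eqI)
  fix A assume "A \<in> sets (distr (density MM Q) M fst)"
  then have A [measurable]: "A \<in> sets M" by simp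
  have "emeasure (distr (density MM Q) M fst) A
      = (\<integral>\<^sup>+p. ennreal (Q p) * indicator A (fst p) \<partial>MM)"
    by (subst emeasure_distr)
       (auto simp: emeasure_density space_pair_measure indicator_def intro!: nn_integral_cong)
  also have "\<dots> = (\<integral>\<^sup>+x. \<integral>\<^sup>+y. ennreal (Q (x, y)) * indicator A x \<partial>M \<partial>M)"
    by (subst nn_integral_fst[symmetric]) auto
  also have "\<dots> = (\<integral>\<^sup>+x. (\<integral>\<^sup>+y. ennreal (Q (x, y)) \<partial>M) * indicator A x \<partial>M)"
    by (intro nn_integral_cong nn_integral_multc) measurable
  also have "\<dots> = (\<integral>\<^sup>+x. indicator A x \<partial>M)"
    by (intro nn_integral_cong_AE) (use row in eventually_elim, simp)
  finally show "emeasure (distr (density MM Q) M fst) A = emeasure M A" by simp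
qed simp

lemma marginal_snd: "distr (density MM Q) M snd = M"
proof (rule measure_eqI)
  fix A assume "A \<in> sets (distr (density MM Q) M snd)"
  then have A [measurable]: "A \<in> sets M" by simp
  have "emeasure (distr (density MM Q) M snd) A
      = (\<integral>\<^sup>+p. ennreal (Q p) * indicator A (snd p) \<partial>MM)"
    by (subst emeasure_distr)
       (auto simp: emeasure_density space_pair_measure indicator_def intro!: nn_integral_cong)
  also have "\<dots> = (\<integral>\<^sup>+y. \<integral>\<^sup>+x. ennreal (Q (x, y)) * indicator A y \<partial>M \<partial>M)"
    by (subst sq.nn_integral_snd[symmetric]) auto
  also have "\<dots> = (\<integral>\<^sup>+y. (\<integral>\<^sup>+x. ennreal (Q (x, y)) \<partial>M) * indicator A y \<partial>M)"
    by (intro nn_integral_cong nn_integral_multc) measurable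
  also have "\<dots> = (\<integral>\<^sup>+x. indicator A x \<partial>M)"
    by (intro nn_integral_cong_AE) (use col in eventually_elim, simp)
  finally show "emeasure (distr (density MM Q) M snd) A = emeasure M A" by simp
qed simp

lemma integral_marginal:
  fixes u :: "'a \<Rightarrow> 'c::{banach, second_countable_topology}"
  assumes u: "integrable M u"
  shows integrable_Q_fst_scaleR: "integrable MM (\<lambda>p. Q p *\<^sub>R u (fst p))"
    and integral_Q_fst_scaleR: "(\<integral>p. Q p *\<^sub>R u (fst p) \<partial>MM) = (\<integral>x. u x \<partial>M)"
    and integrable_Q_snd_scaleR: "integrable MM (\<lambda>p. Q p *\<^sub>R u (snd p))"
    and integral_Q_snd_scaleR: "(\<integral>p. Q p *\<^sub>R u (snd p) \<partial>MM) = (\<integral>x. u x \<partial>M)"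
proof -
  have [measurable]: "u \<in> borel_measurable M" using u by simp
  have "integrable (distr (density MM Q) M fst) u" "integrable (distr (density MM Q) M snd) u"
    using u by (simp_all add: marginal_fst marginal_snd)
  then show "integrable MM (\<lambda>p. Q p *\<^sub>R u (fst p))" "integrable MM (\<lambda>p. Q p *\<^sub>R u (snd p))"
    by (simp_all add: integrable_distr_eq integrable_density)
  have "(\<integral>x. u x \<partial>M) = (\<integral>x. u x \<partial>distr (density MM Q) M fst)" by (simp add: marginal_fst)
  then show "(\<integral>p. Q p *\<^sub>R u (fst p) \<partial>MM) = (\<integral>x. u x \<partial>M)"
    by (simp add: integral_distr integral_density)
  have "(\<integral>x. u x \<partial>M) = (\<integral>x. u x \<partial>distr (density MM Q) M snd)" by (simp add: marginal_snd)
  then show "(\<integral>p. Q p *\<^sub>R u (snd p) \<partial>MM) = (\<integral>x. u x \<partial>M)"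
    by (simp add: integral_distr integral_density)
qed

lemmas integral_marginal_real = integral_marginal[where ?'c = real, unfolded real_scaleR_def]
lemmas integrable_Q_fst = integral_marginal_real(1)
lemmas integral_Q_fst = integral_marginal_real(2)
lemmas integrable_Q_snd = integral_marginal_real(3)
lemmas integral_Q_snd = integral_marginal_real(4)

text \<open>
  All kernels that occur lie between zero and \<open>Q + Q'\<close>; this is enough for their
  forms to converge on \<open>L\<^sup>2\<close>.
\<close>

definition dominated :: "('a \<times> 'a \<Rightarrow> real) \<Rightarrow> bool" where
  "dominated k \<longleftrightarrow> k \<in> borel_measurable MM \<and> (\<forall>p. \<bar>k p\<bar> \<le> Q p + Q' p)"

lemma dominated_integrable:
  assumes k: "dominated k" and u: "integrable M u" "\<And>x. 0 \<le> u x"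
  shows "integrable MM (\<lambda>p. k p * u (fst p))" "integrable MM (\<lambda>p. k p * u (snd p))"
proof -
  have [measurable]: "u \<in> borel_measurable M" "k \<in> borel_measurable MM"
    using u k by (auto simp: dominated_def)
  have sw: "integrable MM (\<lambda>p. Q' p * u (fst p))" "integrable MM (\<lambda>p. Q' p * u (snd p))"
    using integrable_swap[OF integrable_Q_snd[OF u(1)]] integrable_swap[OF integrable_Q_fst[OF u(1)]] by simp_all
  have bd: "norm (k p * v) \<le> Q p * v + Q' p * v" if "0 \<le> v" for p v
  proof -
    have "\<bar>k p\<bar> \<le> Q p + Q' p" using k unfolding dominated_def by blast
    from mult_right_mono[OF this that] show ?thesis using that by (simp add: abs_mult distrib_right)
  qed
  show "integrable MM (\<lambda>p. k p * u (fst p))"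
    by (rule Bochner_Integration.integrable_bound[OF Bochner_Integration.integrable_add[OF integrable_Q_fst[OF u(1)] sw(1)]])
       (use bd u in \<open>auto intro!: AE_I2 order_trans[OF bd]\<close>)
  show "integrable MM (\<lambda>p. k p * u (snd p))"
    by (rule Bochner_Integration.integrable_bound[OF Bochner_Integration.integrable_add[OF integrable_Q_snd[OF u(1)] sw(2)]])
       (use bd u in \<open>auto intro!: AE_I2 order_trans[OF bd]\<close>)
qed

definition form :: "('a \<times> 'a \<Rightarrow> real) \<Rightarrow> ('a \<Rightarrow> complex) \<Rightarrow> ('a \<Rightarrow> complex) \<Rightarrow> complex" where
  "form k f g = (\<integral>p. of_real (k p) * (f (snd p) * cnj (g (fst p))) \<partial>MM)"

lemma form_integrable:
  assumes k: "dominated k" and f: "f \<in> L2 M" and g: "g \<in> L2 M"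
  shows "integrable MM (\<lambda>p. of_real (k p) * (f (snd p) * cnj (g (fst p))))"
proof -
  have [measurable]: "f \<in> borel_measurable M" "g \<in> borel_measurable M" "k \<in> borel_measurable MM"
    using f g k by (auto simp: dominated_def L2_measurable)
  have k': "dominated (\<lambda>p. \<bar>k p\<bar>)" using k by (simp add: dominated_def)
  have "integrable MM (\<lambda>p. \<bar>k p\<bar> * (cmod (f (snd p)))\<^sup>2 + \<bar>k p\<bar> * (cmod (g (fst p)))\<^sup>2)"
    by (intro Bochner_Integration.integrable_add dominated_integrable[OF k'] L2_square_integrable f g) auto
  then show ?thesis
  proof (rule Bochner_Integration.integrable_bound)
    show "AE p in MM. norm (of_real (k p) * (f (snd p) * cnj (g (fst p))))
        \<le> norm (\<bar>k p\<bar> * (cmod (f (snd p)))\<^sup>2 + \<bar>k p\<bar> * (cmod (g (fst p)))\<^sup>2)"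
    proof (rule AE_I2)
      fix p
      have "norm (of_real (k p) * (f (snd p) * cnj (g (fst p)))) = \<bar>k p\<bar> * cmod (f (snd p) * cnj (g (fst p)))"
        by (simp add: norm_mult)
      also have "\<dots> \<le> \<bar>k p\<bar> * ((cmod (f (snd p)))\<^sup>2 + (cmod (g (fst p)))\<^sup>2)"
        by (intro mult_left_mono norm_mult_le_squares) auto
      finally show "norm (of_real (k p) * (f (snd p) * cnj (g (fst p))))
        \<le> norm (\<bar>k p\<bar> * (cmod (f (snd p)))\<^sup>2 + \<bar>k p\<bar> * (cmod (g (fst p)))\<^sup>2)"
        by (simp add: distrib_left)
    qed
  qed measurable
qed

lemma form_add:
  assumes "dominated k" "dominated l" "f \<in> L2 M" "g \<in> L2 M" "\<And>p. j p = k p + l p"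
  shows "form j f g = form k f g + form l f g"
  unfolding form_def assms(5) of_real_add distrib_right
  by (intro Bochner_Integration.integral_add form_integrable assms)

lemma form_swap:
  assumes k: "dominated k" and f: "f \<in> L2 M"
  shows "form (\<lambda>p. k (prod.swap p)) f f = cnj (form k f f)"
proof -
  have "form k f f = (\<integral>p. of_real (k (prod.swap p)) * (f (fst p) * cnj (f (snd p))) \<partial>MM)"
    using form_integrable[OF k f f] unfolding form_def
    by (subst integral_swap[symmetric]) auto
  then have "cnj (form k f f) = (\<integral>p. cnj (of_real (k (prod.swap p)) * (f (fst p) * cnj (f (snd p)))) \<partial>MM)"
    by (simp only: Bochner_Integration.integral_cnj)
  then show ?thesis by (simp add: form_def mult.commute)
qed

text \<open>
  The mass removed from \<open>Q\<close> by the first Metropolis-Hastings kernel and returned to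
  the diagonal.
\<close>

definition excess :: "'a \<times> 'a \<Rightarrow> real" where
  "excess p = Q p - min (Q p) (Q' p)"

lemma excess_measurable [measurable]: "excess \<in> borel_measurable MM"
  unfolding excess_def by measurable

lemma excess_nonneg [simp]: "0 \<le> excess p"
  by (simp add: excess_def)

lemma dominated_kernels: "dominated Q" "dominated excess" "dominated (\<lambda>p. excess (prod.swap p))"
  "dominated (\<lambda>p. min (Q p) (Q' p))" "dominated (\<lambda>p. max (Q p) (Q' p))" "dominated Q'"
proof -
  have [measurable]: "Q' \<in> borel_measurable MM" "(\<lambda>p. excess (prod.swap p)) \<in> borel_measurable MM"
    by measurable
  have "0 \<le> Q p" "0 \<le> Q' p" for p by auto
  note this[simp]
  show "dominated Q" "dominated excess" "dominated (\<lambda>p. excess (prod.swap p))"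
  "dominated (\<lambda>p. min (Q p) (Q' p))" "dominated (\<lambda>p. max (Q p) (Q' p))" "dominated Q'"
    unfolding dominated_def excess_def
    by (auto simp: abs_le_iff min_le_iff_disj le_max_iff_disj intro: order_trans[OF _ Q_nonneg])
qed

text \<open>
  The excess differs from its reversal by \<open>Q - Q'\<close>, whose marginals vanish by
  stationarity.
\<close>

lemma excess_marginals:
  assumes u: "integrable M u" "\<And>x. 0 \<le> u x"
  shows "(\<integral>p. excess p * u (snd p) \<partial>MM) = (\<integral>p. excess p * u (fst p) \<partial>MM)"
proof -
  note D = dominated_integrable[OF _ u]
  have [measurable]: "u \<in> borel_measurable M" using u by simp
  have "(\<integral>p. excess p * u (snd p) \<partial>MM) = (\<integral>p. Q p * u (snd p) - min (Q p) (Q' p) * u (snd p) \<partial>MM)"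
    by (simp add: excess_def left_diff_distrib)
  also have "\<dots> = (\<integral>x. u x \<partial>M) - (\<integral>p. min (Q p) (Q' p) * u (snd p) \<partial>MM)"
    by (subst Bochner_Integration.integral_diff) (auto intro: D dominated_kernels simp: integral_Q_snd u)
  also have "(\<integral>p. min (Q p) (Q' p) * u (snd p) \<partial>MM) = (\<integral>p. min (Q p) (Q' p) * u (fst p) \<partial>MM)"
    by (subst integral_swap[symmetric]) (auto simp: min.commute)
  also have "(\<integral>x. u x \<partial>M) - \<dots> = (\<integral>p. Q p * u (fst p) - min (Q p) (Q' p) * u (fst p) \<partial>MM)"
    by (subst Bochner_Integration.integral_diff) (auto intro: D dominated_kernels simp: integral_Q_fst u)
  also have "\<dots> = (\<integral>p. excess p * u (fst p) \<partial>MM)"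
    by (simp add: excess_def left_diff_distrib)
  finally show ?thesis .
qed

text \<open>
  The function \<open>\<rho>\<close> in the definition of the Metropolis-Hastings kernels.
\<close>

definition rejection :: "'a \<Rightarrow> real" where
  "rejection x = (\<integral>y. excess (x, y) \<partial>M)"

lemma rejection_nonneg [simp]: "0 \<le> rejection x"
  by (simp add: rejection_def)

lemma rejection_measurable [measurable]: "rejection \<in> borel_measurable M"
  unfolding rejection_def by measurable

lemma rejection_integral:
  assumes u: "integrable M u" "\<And>x. 0 \<le> u x"
  shows "(\<integral>x. rejection x * u x \<partial>M) = (\<integral>p. excess p * u (fst p) \<partial>MM)"
    and "integrable M (\<lambda>x. rejection x * u x)"
proof -
  have int: "integrable MM (\<lambda>p. excess p * u (fst p))"
    by (intro dominated_integrable dominated_kernels u)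
  have eq: "(\<lambda>x. \<integral>y. excess (x, y) * u x \<partial>M) = (\<lambda>x. rejection x * u x)"
    by (simp add: rejection_def)
  show "(\<integral>x. rejection x * u x \<partial>M) = (\<integral>p. excess p * u (fst p) \<partial>MM)"
    using sq.integral_fst'[OF int] by (simp add: eq[symmetric])
  show "integrable M (\<lambda>x. rejection x * u x)"
    using sq.integrable_fst'[OF int] by (simp add: eq[symmetric])
qed

text \<open>
  The Dirichlet form of the excess is half the difference of the two Metropolis-Hastings forms.
\<close>

lemma excess_dirichlet:
  assumes f: "f \<in> L2 M"
  shows "2 * ((\<integral>x. rejection x * (cmod (f x))\<^sup>2 \<partial>M) - Re (form excess f f))
     = (\<integral>p. excess p * (cmod (f (fst p) - f (snd p)))\<^sup>2 \<partial>MM)"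
proof -
  have [measurable]: "f \<in> borel_measurable M" using f by (rule L2_measurable)
  note D = dominated_integrable[OF dominated_kernels(2) L2_square_integrable[OF f]]
  note F = form_integrable[OF dominated_kernels(2) f f]
  have sq: "(cmod (a - b))\<^sup>2 = (cmod a)\<^sup>2 + (cmod b)\<^sup>2 - 2 * Re (b * cnj a)" for a b
    by (simp add: cmod_power2 power2_diff algebra_simps)
  have "(\<integral>p. excess p * (cmod (f (fst p) - f (snd p)))\<^sup>2 \<partial>MM)
     = (\<integral>p. excess p * (cmod (f (fst p)))\<^sup>2 + excess p * (cmod (f (snd p)))\<^sup>2
          - 2 * Re (of_real (excess p) * (f (snd p) * cnj (f (fst p)))) \<partial>MM)"
    by (intro Bochner_Integration.integral_cong) (auto simp: sq algebra_simps)
  also have "\<dots> = (\<integral>p. excess p * (cmod (f (fst p)))\<^sup>2 \<partial>MM) + (\<integral>p. excess p * (cmod (f (snd p)))\<^sup>2 \<partial>MM)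
      - 2 * Re (form excess f f)"
    unfolding form_def integral_Re[OF F, symmetric]
    by (subst Bochner_Integration.integral_diff Bochner_Integration.integral_add; 
        (intro Bochner_Integration.integrable_add D integrable_mult_right integrable_Re[OF F] zero_le_power2)?)+
       (simp del: Re_complex_of_real times_complex.sel)
  finally show ?thesis
    using rejection_integral(1)[OF L2_square_integrable[OF f]] excess_marginals[OF L2_square_integrable[OF f]] by simp
qed

text \<open>
  The hypotheses bound the quadratic forms of the first and the second Metropolis-Hastings
  operator on \<open>L\<^sup>2\<^sub>0\<close>, from above and from below.
\<close>

context
  fixes \<beta> :: real
  assumes \<beta>0: "0 \<le> \<beta>"
    and MH1: "\<And>f. f \<in> L2_0 M \<Longrightarrow>
      Re (form (\<lambda>p. min (Q p) (Q' p)) f f) + (\<integral>x. rejection x * (cmod (f x))\<^sup>2 \<partial>M) \<le> \<beta> * (\<integral>x. (cmod (f x))\<^sup>2 \<partial>M)"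
    and MH2: "\<And>f. f \<in> L2_0 M \<Longrightarrow>
      - (\<beta> * (\<integral>x. (cmod (f x))\<^sup>2 \<partial>M)) \<le> Re (form (\<lambda>p. max (Q p) (Q' p)) f f) - (\<integral>x. rejection x * (cmod (f x))\<^sup>2 \<partial>M)"
begin

lemma form_Q: "f \<in> L2 M \<Longrightarrow> form Q f f = form (\<lambda>p. min (Q p) (Q' p)) f f + form excess f f"
  by (rule form_add[OF dominated_kernels(4,2)]) (simp_all add: excess_def)

lemma form_max: "f \<in> L2 M \<Longrightarrow> Re (form (\<lambda>p. max (Q p) (Q' p)) f f)
   = Re (form (\<lambda>p. min (Q p) (Q' p)) f f) + 2 * Re (form excess f f)"
proof -
  assume f: "f \<in> L2 M"
  have "form (\<lambda>p. max (Q p) (Q' p)) f f = form Q f f + form (\<lambda>p. excess (prod.swap p)) f f"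
    by (rule form_add[OF dominated_kernels(1,3) f f]) (simp add: excess_def)
  then show ?thesis using form_swap[OF dominated_kernels(2) f] form_Q[OF f] by simp
qed

lemma excess_dirichlet_bound:
  assumes "f \<in> L2_0 M"
  shows "(\<integral>p. excess p * (cmod (f (fst p) - f (snd p)))\<^sup>2 \<partial>MM) \<le> 2 * (\<beta> * (\<integral>x. (cmod (f x))\<^sup>2 \<partial>M))"
proof -
  have f: "f \<in> L2 M" using assms by (simp add: L2_0_def)
  show ?thesis using MH1[OF assms] MH2[OF assms] excess_dirichlet[OF f] form_max[OF f] by simp
qed

text \<open>
  The Dirichlet form of an indicator counts the excess that crosses the boundary of the set.
  Indicators are centred to lie in \<open>L\<^sup>2\<^sub>0\<close>; constants do not change the
  Dirichlet form.
\<close>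

lemma excess_boundary_bound:
  assumes [measurable]: "A \<in> sets M"
  shows "(\<integral>p. excess p * indicator A (fst p) \<partial>MM)
      \<le> \<beta> * prob A + (\<integral>p. excess p * (indicator A (fst p) * indicator A (snd p)) \<partial>MM)"
proof -
  define f :: "'a \<Rightarrow> complex" where "f x = of_real (indicator A x - prob A)" for x
  have [measurable]: "f \<in> borel_measurable M" unfolding f_def by measurable
  have f_sq: "(cmod (f x))\<^sup>2 = indicator A x * (1 - 2 * prob A) + (prob A)\<^sup>2" for x
    unfolding f_def norm_of_real power2_abs by (simp add: indicator_def power2_eq_square algebra_simps)
  have int_A: "integrable M (indicator A :: 'a \<Rightarrow> real)"
    by (intro integrable_const_bound[where B=1]) (auto simp: indicator_def)
  have "integrable M (\<lambda>x. (cmod (f x))\<^sup>2)" unfolding f_sq using int_A by auto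
  then have "f \<in> L2 M" by (simp add: L2_def)
  moreover have "(\<integral>x. f x \<partial>M) = 0"
    unfolding f_def integral_of_real using int_A by (simp add: prob_space)
  ultimately have f0: "f \<in> L2_0 M" by (simp add: L2_0_def)
  have norm_f: "(\<integral>x. (cmod (f x))\<^sup>2 \<partial>M) = prob A - (prob A)\<^sup>2"
    unfolding f_sq using int_A by (simp add: prob_space) (simp add: power2_eq_square algebra_simps)
  note D = dominated_integrable[OF dominated_kernels(2) int_A]
  have D2: "integrable MM (\<lambda>p. excess p * (indicator A (fst p) * indicator A (snd p)))"
    by (rule Bochner_Integration.integrable_bound[OF D(1)]) (auto simp: indicator_def)
  have "(\<integral>p. excess p * (cmod (f (fst p) - f (snd p)))\<^sup>2 \<partial>MM)
      = (\<integral>p. excess p * indicator A (fst p) + excess p * indicator A (snd p)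
          - 2 * (excess p * (indicator A (fst p) * indicator A (snd p))) \<partial>MM)"
  proof (intro Bochner_Integration.integral_cong refl)
    fix p
    have "(cmod (f (fst p) - f (snd p)))\<^sup>2 = (indicator A (fst p) - indicator A (snd p))\<^sup>2"
      unfolding f_def of_real_diff[symmetric] norm_of_real power2_abs by simp
    then show "excess p * (cmod (f (fst p) - f (snd p)))\<^sup>2
      = excess p * indicator A (fst p) + excess p * indicator A (snd p)
          - 2 * (excess p * (indicator A (fst p) * indicator A (snd p)))"
      by (simp add: indicator_def)
  qed
  also have "\<dots> = (\<integral>p. excess p * indicator A (fst p) \<partial>MM) + (\<integral>p. excess p * indicator A (snd p) \<partial>MM)
      - 2 * (\<integral>p. excess p * (indicator A (fst p) * indicator A (snd p)) \<partial>MM)"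
    using D D2 by simp
  also have "(\<integral>p. excess p * indicator A (snd p) \<partial>MM) = (\<integral>p. excess p * indicator A (fst p) \<partial>MM)"
    by (rule excess_marginals[OF int_A]) simp
  finally have "(\<integral>p. excess p * indicator A (fst p) \<partial>MM)
      \<le> \<beta> * (prob A - (prob A)\<^sup>2) + (\<integral>p. excess p * (indicator A (fst p) * indicator A (snd p)) \<partial>MM)"
    using excess_dirichlet_bound[OF f0] by (simp add: norm_f)
  moreover have "\<beta> * (prob A - (prob A)\<^sup>2) \<le> \<beta> * prob A"
    using \<beta>0 by (intro mult_left_mono) auto
  ultimately show ?thesis by linarith
qed

text \<open>
  The boundary bound is applied to each piece of a finite partition of \<open>A\<close> and
  summed. The excess inside the pieces is at most \<open>\<bar>Q - Q'\<bar>\<close> there, hence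
  arbitrarily small for a suitable partition.
\<close>

lemma excess_marginal_bound:
  assumes A [measurable]: "A \<in> sets M"
  shows "(\<integral>p. excess p * indicator A (fst p) \<partial>MM) \<le> \<beta> * prob A"
proof (rule field_le_epsilon)
  fix \<epsilon> :: real assume e: "0 < \<epsilon>"
  have int_1: "integrable M (\<lambda>x. 1 :: real)" by simp
  have int_Q: "integrable MM Q" using integrable_Q_fst[OF int_1] by simp
  obtain c :: "'a \<Rightarrow> nat" where c [measurable]: "c \<in> M \<rightarrow>\<^sub>M count_space UNIV" and fin: "finite (range c)"
    and small: "(\<integral>p. indicator {p. c (fst p) = c (snd p)} p * \<bar>Q p - Q' p\<bar> \<partial>MM) < \<epsilon>"
    by (rule resolvesE[OF resolves_integrable[OF int_Q] e])
  define B where "B i = A \<inter> (c -` {i} \<inter> space M)" for i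
  have B [measurable]: "B i \<in> sets M" for i unfolding B_def by measurable
  let ?J = "\<lambda>p. \<Sum>i\<in>range c. indicator (B i) (fst p) * indicator (B i) (snd p) :: real"
  have ind: "integrable M (indicator C :: 'a \<Rightarrow> real)" if "C \<in> sets M" for C
    using that by (intro integrable_const_bound[where B=1]) (auto simp: indicator_def)
  note D = dominated_integrable[OF dominated_kernels(2) ind]
  have DB: "integrable MM (\<lambda>p. excess p * (indicator (B i) (fst p) * indicator (B i) (snd p)))" for i
    by (rule Bochner_Integration.integrable_bound[OF D(1)[OF B[of i]]]) (auto simp: indicator_def)
  have A_sum: "indicator A x = (\<Sum>i\<in>range c. indicator (B i) x :: real)" if "x \<in> space M" for x
  proof -
    have "(\<Sum>i\<in>range c. indicator (B i) x) = (\<Sum>i\<in>range c. if c x = i then indicator A x else (0::real))"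
      using that by (intro sum.cong) (auto simp: B_def indicator_def)
    then show ?thesis using fin by simp
  qed
  have J_le: "?J p \<le> indicator {p. c (fst p) = c (snd p)} p" for p
  proof -
    have "?J p \<le> (\<Sum>i\<in>range c. if c (fst p) = i then indicator {p. c (fst p) = c (snd p)} p else 0)"
      by (intro sum_mono) (auto simp: B_def indicator_def)
    then show ?thesis using fin by simp
  qed
  have "(\<integral>p. excess p * indicator A (fst p) \<partial>MM)
      = (\<integral>p. (\<Sum>i\<in>range c. excess p * indicator (B i) (fst p)) \<partial>MM)"
    by (intro Bochner_Integration.integral_cong) (auto simp: A_sum space_pair_measure sum_distrib_left)
  also have "\<dots> = (\<Sum>i\<in>range c. \<integral>p. excess p * indicator (B i) (fst p) \<partial>MM)"
    by (intro Bochner_Integration.integral_sum D B) auto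
  also have "\<dots> \<le> (\<Sum>i\<in>range c. \<beta> * prob (B i)
      + (\<integral>p. excess p * (indicator (B i) (fst p) * indicator (B i) (snd p)) \<partial>MM))"
    by (intro sum_mono excess_boundary_bound B)
  also have "\<dots> = \<beta> * (\<Sum>i\<in>range c. prob (B i)) + (\<integral>p. excess p * ?J p \<partial>MM)"
    using DB by (simp add: sum.distrib sum_distrib_left Bochner_Integration.integral_sum)
  also have "(\<Sum>i\<in>range c. prob (B i)) = prob (\<Union>i\<in>range c. B i)"
    by (rule finite_measure_finite_Union[symmetric]) (auto simp: fin disjoint_family_on_def B_def)
  also have "(\<Union>i\<in>range c. B i) = A" using sets.sets_into_space[OF A] by (auto simp: B_def)
  also have "(\<integral>p. excess p * ?J p \<partial>MM)
      \<le> (\<integral>p. indicator {p. c (fst p) = c (snd p)} p * \<bar>Q p - Q' p\<bar> \<partial>MM)"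
  proof (rule integral_mono)
    show "integrable MM (\<lambda>p. excess p * ?J p)"
      using DB by (simp add: sum_distrib_left)
    show "integrable MM (\<lambda>p. indicator {p. c (fst p) = c (snd p)} p * \<bar>Q p - Q' p\<bar>)"
      using int_Q integrable_swap[OF int_Q] by (intro integrable_same_class c) auto
    show "excess p * ?J p \<le> indicator {p. c (fst p) = c (snd p)} p * \<bar>Q p - Q' p\<bar>" for p
    proof -
      have "excess p * ?J p \<le> excess p * indicator {p. c (fst p) = c (snd p)} p"
        by (intro mult_left_mono J_le) simp
      also have "\<dots> \<le> \<bar>Q p - Q' p\<bar> * indicator {p. c (fst p) = c (snd p)} p"
        by (intro mult_right_mono) (auto simp: excess_def)
      finally show ?thesis by (simp add: mult.commute)
    qed
  qed
  finally show "(\<integral>p. excess p * indicator A (fst p) \<partial>MM) \<le> \<beta> * prob A + \<epsilon>" using small by simp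
qed

lemma rejection_le: "AE x in M. rejection x \<le> \<beta>"
proof -
  define A where "A = {x \<in> space M. \<beta> < rejection x}"
  have A [measurable]: "A \<in> sets M" unfolding A_def by measurable
  have int_A: "integrable M (indicator A :: 'a \<Rightarrow> real)"
    by (intro integrable_const_bound[where B=1]) (auto simp: indicator_def)
  note R = rejection_integral[OF int_A]
  have "(\<integral>x. rejection x * indicator A x \<partial>M) \<le> \<beta> * prob A"
    using excess_marginal_bound[OF A] R(1) by simp
  also have "\<beta> * prob A = (\<integral>x. \<beta> * indicator A x \<partial>M)" by simp
  finally have "(\<integral>x. rejection x * indicator A x - \<beta> * indicator A x \<partial>M) \<le> 0"
    using R(2) int_A by simp
  moreover have nn: "0 \<le> rejection x * indicator A x - \<beta> * indicator A x" for x
    by (auto simp: A_def indicator_def)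
  ultimately have "(\<integral>x. rejection x * indicator A x - \<beta> * indicator A x \<partial>M) = 0"
    by (intro antisym Bochner_Integration.integral_nonneg) auto
  then have "AE x in M. rejection x * indicator A x - \<beta> * indicator A x = 0"
    using R(2) int_A nn by (subst (asm) integral_nonneg_eq_0_iff_AE) auto
  with AE_space show ?thesis
    by eventually_elim (auto simp: A_def indicator_def split: if_splits)
qed

text \<open>
  The Metropolis-Hastings forms only see the symmetric part of \<open>Q\<close> and the excess.
  The bound on the rejection function supplies what is needed to control the antisymmetric part as
  well.
\<close>

theorem form_bound:
  assumes f0: "f \<in> L2_0 M"
  shows "cmod (form Q f f) \<le> \<beta> * (\<integral>x. (cmod (f x))\<^sup>2 \<partial>M)"
proof -
  have f: "f \<in> L2 M" using f0 by (simp add: L2_0_def)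
  have [measurable]: "f \<in> borel_measurable M" using f by (rule L2_measurable)
  define I where "I = (\<integral>x. (cmod (f x))\<^sup>2 \<partial>M)"
  define R where "R = (\<integral>x. rejection x * (cmod (f x))\<^sup>2 \<partial>M)"
  let ?m = "\<lambda>p. min (Q p) (Q' p)"
  have "form ?m f f = cnj (form ?m f f)"
    using form_swap[OF dominated_kernels(4) f] by (simp add: min.commute)
  then have Im_m: "Im (form ?m f f) = 0" by (metis Im_complex_of_real complex_In_mult_cnj_zero complex_cnj_cancel_iff Reals_cnj_iff complex_is_Real_iff)
  have R_le: "R \<le> \<beta> * I"
  proof -
    have "R \<le> (\<integral>x. \<beta> * (cmod (f x))\<^sup>2 \<partial>M)" unfolding R_def
      using rejection_le
      by (intro integral_mono_AE rejection_integral L2_square_integrable f integrable_mult_right)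
         (auto intro: mult_right_mono elim!: eventually_mono)
    then show ?thesis by (simp add: I_def)
  qed
  have R0: "0 \<le> R" unfolding R_def by simp
  have "cmod (form excess f f) \<le> (\<integral>p. norm (of_real (excess p) * (f (snd p) * cnj (f (fst p)))) \<partial>MM)"
    unfolding form_def by (rule integral_norm_bound)
  also have "\<dots> \<le> (\<integral>p. (excess p * (cmod (f (fst p)))\<^sup>2 + excess p * (cmod (f (snd p)))\<^sup>2) / 2 \<partial>MM)"
  proof (rule integral_mono)
    show "integrable MM (\<lambda>p. norm (of_real (excess p) * (f (snd p) * cnj (f (fst p)))))"
      by (intro integrable_norm form_integrable dominated_kernels f)
    show "integrable MM (\<lambda>p. (excess p * (cmod (f (fst p)))\<^sup>2 + excess p * (cmod (f (snd p)))\<^sup>2) / 2)"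
      by (intro integrable_divide Bochner_Integration.integrable_add dominated_integrable dominated_kernels
           L2_square_integrable f zero_le_power2)
    fix p
    have "cmod (f (snd p)) * cmod (f (fst p)) \<le> ((cmod (f (fst p)))\<^sup>2 + (cmod (f (snd p)))\<^sup>2) / 2"
      using sum_squares_bound[of "cmod (f (fst p))" "cmod (f (snd p))"] by (simp add: mult_ac)
    from mult_left_mono[OF this excess_nonneg[of p]]
    show "norm (of_real (excess p) * (f (snd p) * cnj (f (fst p))))
      \<le> (excess p * (cmod (f (fst p)))\<^sup>2 + excess p * (cmod (f (snd p)))\<^sup>2) / 2"
      by (simp add: norm_mult distrib_left)
  qed
  also have "\<dots> = R"
    using excess_marginals[OF L2_square_integrable[OF f]] rejection_integral(1)[OF L2_square_integrable[OF f]]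
      dominated_integrable[OF dominated_kernels(2) L2_square_integrable[OF f]]
    by (simp add: R_def)
  finally have "(Re (form excess f f))\<^sup>2 + (Im (form excess f f))\<^sup>2 \<le> R\<^sup>2"
    using power_mono[of "cmod (form excess f f)" R 2] by (simp add: cmod_power2)
  from min_max_radius[OF _ _ R_le this R0, of "Re (form ?m f f)"]
  have "(Re (form ?m f f) + Re (form excess f f))\<^sup>2 + (Im (form excess f f))\<^sup>2 \<le> (\<beta> * I)\<^sup>2"
    using MH1[OF f0] MH2[OF f0] form_max[OF f] by (simp add: R_def I_def)
  then have "(cmod (form Q f f))\<^sup>2 \<le> (\<beta> * I)\<^sup>2"
    by (simp add: form_Q[OF f] cmod_power2 Im_m)
  moreover have "0 \<le> \<beta> * I" using \<beta>0 by (simp add: I_def)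
  ultimately show ?thesis unfolding I_def by (rule power2_le_imp_le)
qed

end
end

section \<open>Averaging operators and powers of densities\<close>

lemma (in prob_space) L2_integrable: "f \<in> L2 M \<Longrightarrow> integrable M f"
proof (rule Bochner_Integration.integrable_bound[of _ "\<lambda>x. 1 + (cmod (f x))\<^sup>2"])
  assume f: "f \<in> L2 M"
  show "integrable M (\<lambda>x. 1 + (cmod (f x))\<^sup>2)" using L2_square_integrable[OF f] by simp
  show "f \<in> borel_measurable M" using f by (rule L2_measurable)
  show "AE x in M. norm (f x) \<le> norm (1 + (cmod (f x))\<^sup>2)"
  proof (rule AE_I2)
    fix x
    have "2 * cmod (f x) \<le> 1 + (cmod (f x))\<^sup>2" using sum_squares_bound[of 1 "cmod (f x)"] by simp
    moreover have "0 \<le> cmod (f x)" by simp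
    ultimately have "cmod (f x) \<le> 1 + (cmod (f x))\<^sup>2" by linarith
    then show "norm (f x) \<le> norm (1 + (cmod (f x))\<^sup>2)" by simp
  qed
qed

context doubly_stochastic
begin

definition avg :: "('a \<Rightarrow> complex) \<Rightarrow> 'a \<Rightarrow> complex" where
  "avg f x = (\<integral>y. of_real (Q (x, y)) * f y \<partial>M)"

lemma avg_measurable [measurable]:
  assumes [measurable]: "f \<in> borel_measurable M"
  shows "avg f \<in> borel_measurable M"
  unfolding avg_def[abs_def] by measurable

text \<open>
  For almost every \<open>x\<close> the density \<open>Q (x, \<cdot>)\<close> is that of a
  probability measure, under which the variance of \<open>f\<close> is nonnegative.
\<close>

lemma Jensen_row:
  assumes f: "f \<in> L2 M"
  shows "AE x in M. (cmod (avg f x))\<^sup>2 \<le> (\<integral>y. Q (x, y) * (cmod (f y))\<^sup>2 \<partial>M)"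
proof -
  have [measurable]: "f \<in> borel_measurable M" using f by (rule L2_measurable)
  have "AE x in M. integrable M (\<lambda>y. Q (x, y) * (cmod (f y))\<^sup>2)"
    using sq.AE_integrable_fst'[OF integrable_Q_snd[OF L2_square_integrable[OF f]]] by simp
  moreover have "AE x in M. integrable M (\<lambda>y. of_real (Q (x, y)) * f y)"
    using sq.AE_integrable_fst'[OF integrable_Q_snd_scaleR[OF L2_integrable[OF f]]]
    by (simp add: scaleR_conv_of_real)
  ultimately show ?thesis using row AE_space
  proof eventually_elim
    case (elim x)
    then have [measurable]: "x \<in> space M" by simp
    define a where "a = avg f x"
    have Q1: "integrable M (\<lambda>y. Q (x, y))"
      by (rule integrableI_nn_integral_finite[where x = 1]) (use elim in auto)
    have Q2: "(\<integral>y. Q (x, y) \<partial>M) = 1"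
      by (subst integral_eq_nn_integral) (use elim in auto)
    define h where "h y = Re (of_real (Q (x, y)) * f y * cnj a)" for y
    have h_int: "integrable M h" unfolding h_def
      by (intro integrable_Re integrable_mult_left elim)
    have h_eq: "(\<integral>y. h y \<partial>M) = (cmod a)\<^sup>2"
    proof -
      have "(\<integral>y. of_real (Q (x, y)) * f y * cnj a \<partial>M) = a * cnj a"
        using elim by (simp add: a_def avg_def)
      moreover have "(\<integral>y. h y \<partial>M) = Re (\<integral>y. of_real (Q (x, y)) * f y * cnj a \<partial>M)"
        unfolding h_def by (rule integral_Re) (intro integrable_mult_left elim)
      ultimately show ?thesis by (simp add: complex_mult_cnj cmod_power2)
    qed
    have "0 \<le> (\<integral>y. Q (x, y) * (cmod (f y - a))\<^sup>2 \<partial>M)" by simp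
    also have "\<dots> = (\<integral>y. Q (x, y) * (cmod (f y))\<^sup>2 - 2 * h y + Q (x, y) * (cmod a)\<^sup>2 \<partial>M)"
      by (intro Bochner_Integration.integral_cong)
         (auto simp: h_def cmod_power2 power2_diff algebra_simps)
    also have "\<dots> = (\<integral>y. Q (x, y) * (cmod (f y))\<^sup>2 \<partial>M) - (cmod a)\<^sup>2"
      using elim(1) h_int h_eq Q1 Q2 by simp
    finally show ?case by (simp add: a_def)
  qed
qed

lemma avg_L2: 
  assumes f: "f \<in> L2 M"
  shows "avg f \<in> L2 M" and avg_contraction: "(\<integral>x. (cmod (avg f x))\<^sup>2 \<partial>M) \<le> (\<integral>x. (cmod (f x))\<^sup>2 \<partial>M)"
proof -
  have [measurable]: "f \<in> borel_measurable M" using f by (rule L2_measurable)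
  have int: "integrable M (\<lambda>x. \<integral>y. Q (x, y) * (cmod (f y))\<^sup>2 \<partial>M)"
    using sq.integrable_fst'[OF integrable_Q_snd[OF L2_square_integrable[OF f]]] by simp
  have "integrable M (\<lambda>x. (cmod (avg f x))\<^sup>2)"
    by (rule Bochner_Integration.integrable_bound[OF int])
       (use Jensen_row[OF f] in \<open>auto elim!: eventually_mono intro: order_trans\<close>)
  then show "avg f \<in> L2 M" by (simp add: L2_def)
  have "(\<integral>x. (cmod (avg f x))\<^sup>2 \<partial>M) \<le> (\<integral>x. \<integral>y. Q (x, y) * (cmod (f y))\<^sup>2 \<partial>M \<partial>M)"
    by (intro integral_mono_AE int Jensen_row f) fact
  also have "\<dots> = (\<integral>x. (cmod (f x))\<^sup>2 \<partial>M)"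
    using sq.integral_fst'[OF integrable_Q_snd[OF L2_square_integrable[OF f]]]
      integral_Q_snd[OF L2_square_integrable[OF f]] by simp
  finally show "(\<integral>x. (cmod (avg f x))\<^sup>2 \<partial>M) \<le> (\<integral>x. (cmod (f x))\<^sup>2 \<partial>M)" .
qed

lemma avg_integral:
  assumes f: "f \<in> L2 M"
  shows "(\<integral>x. avg f x \<partial>M) = (\<integral>x. f x \<partial>M)"
  using sq.integral_fst'[OF integrable_Q_snd_scaleR[OF L2_integrable[OF f]]]
    integral_Q_snd_scaleR[OF L2_integrable[OF f]] by (simp add: avg_def scaleR_conv_of_real)

lemma form_fubini:
  assumes k: "dominated k" and f: "f \<in> L2 M" and g: "g \<in> L2 M"
  shows "(\<integral>x. (\<integral>y. of_real (k (x, y)) * f y \<partial>M) * cnj (g x) \<partial>M) = form k f g"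
proof -
  have "(\<integral>x. (\<integral>y. of_real (k (x, y)) * f y \<partial>M) * cnj (g x) \<partial>M)
      = (\<integral>x. \<integral>y. of_real (k (x, y)) * (f y * cnj (g x)) \<partial>M \<partial>M)"
    by (simp add: mult.assoc[symmetric])
  then show ?thesis using sq.integral_fst'[OF form_integrable[OF k f g]] by (simp add: form_def)
qed

lemma inner_avg:
  assumes "f \<in> L2 M" "g \<in> L2 M"
  shows "inner_L2 M (avg f) g = form Q f g"
  using form_fubini[OF dominated_kernels(1) assms] by (simp add: inner_L2_def avg_def)

lemma form_add_left:
  assumes "dominated k" "f \<in> L2 M" "g \<in> L2 M" "h \<in> L2 M"
  shows "form k (\<lambda>x. f x + g x) h = form k f h + form k g h"
  unfolding form_def distrib_left distrib_right
  by (intro Bochner_Integration.integral_add form_integrable assms)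

lemma form_scale:
  shows "form k (\<lambda>x. c * f x) h = c * form k f h"
    and "form k f (\<lambda>x. c * h x) = cnj c * form k f h"
  unfolding form_def
  by (subst integral_mult_right_zero[symmetric], simp add: mult_ac)+

lemma form_norm_le:
  assumes k: "dominated k" and f: "f \<in> L2 M"
  shows "cmod (form k f f) \<le> 4 * (\<integral>x. (cmod (f x))\<^sup>2 \<partial>M)"
proof -
  note D = dominated_integrable[OF dominated_kernels(1) L2_square_integrable[OF f]]
    dominated_integrable[OF dominated_kernels(6) L2_square_integrable[OF f]]
  have [measurable]: "f \<in> borel_measurable M" using f by (rule L2_measurable)
  let ?B = "\<lambda>p. (Q p * (cmod (f (fst p)))\<^sup>2 + Q p * (cmod (f (snd p)))\<^sup>2)
        + (Q' p * (cmod (f (fst p)))\<^sup>2 + Q' p * (cmod (f (snd p)))\<^sup>2)"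
  have "cmod (form k f f) \<le> (\<integral>p. norm (of_real (k p) * (f (snd p) * cnj (f (fst p)))) \<partial>MM)"
    unfolding form_def by (rule integral_norm_bound)
  also have "\<dots> \<le> (\<integral>p. ?B p \<partial>MM)"
  proof (rule integral_mono)
    show "integrable MM (\<lambda>p. norm (of_real (k p) * (f (snd p) * cnj (f (fst p)))))"
      by (intro integrable_norm form_integrable k f)
    show "integrable MM ?B"
      by (intro Bochner_Integration.integrable_add D) auto
    fix p
    have "norm (of_real (k p) * (f (snd p) * cnj (f (fst p)))) = \<bar>k p\<bar> * cmod (f (snd p) * cnj (f (fst p)))"
      by (simp add: norm_mult)
    also have "\<dots> \<le> (Q p + Q' p) * ((cmod (f (snd p)))\<^sup>2 + (cmod (f (fst p)))\<^sup>2)"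
    proof (intro mult_mono norm_mult_le_squares)
      show "\<bar>k p\<bar> \<le> Q p + Q' p" using k unfolding dominated_def by blast
    qed auto
    finally show "norm (of_real (k p) * (f (snd p) * cnj (f (fst p)))) \<le> ?B p"
      by (simp add: algebra_simps)
  qed
  also have "\<dots> = 4 * (\<integral>x. (cmod (f x))\<^sup>2 \<partial>M)"
  proof -
    have "(\<integral>p. Q' p * (cmod (f (fst p)))\<^sup>2 \<partial>MM) = (\<integral>p. Q p * (cmod (f (snd p)))\<^sup>2 \<partial>MM)"
      using integral_swap[of "\<lambda>p. Q p * (cmod (f (snd p)))\<^sup>2"] by simp
    moreover have "(\<integral>p. Q' p * (cmod (f (snd p)))\<^sup>2 \<partial>MM) = (\<integral>p. Q p * (cmod (f (fst p)))\<^sup>2 \<partial>MM)"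
      using integral_swap[of "\<lambda>p. Q p * (cmod (f (fst p)))\<^sup>2"] by simp
    ultimately show ?thesis
      using D integral_Q_fst[OF L2_square_integrable[OF f]] integral_Q_snd[OF L2_square_integrable[OF f]] by simp
  qed
  finally show ?thesis .
qed

lemma rejection_form_le:
  assumes f: "f \<in> L2 M"
  shows "(\<integral>x. rejection x * (cmod (f x))\<^sup>2 \<partial>M) \<le> (\<integral>x. (cmod (f x))\<^sup>2 \<partial>M)"
  unfolding rejection_integral(1)[OF L2_square_integrable[OF f] zero_le_power2]
    integral_Q_fst[OF L2_square_integrable[OF f], symmetric]
  by (intro integral_mono dominated_integrable dominated_kernels L2_square_integrable f zero_le_power2 mult_right_mono)
     (simp add: excess_def)

end

text \<open>
  Fubini's theorem for fixed \<open>x\<close>. It applies for those \<open>x\<close> at which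
  \<open>f\<close> is integrable under the composed kernel, which is almost every
  \<open>x\<close>.
\<close>

lemma (in prob_space) avg_compose:
  assumes "doubly_stochastic M Q1" "doubly_stochastic M Q2" "doubly_stochastic M Q3"
    and comp: "\<And>x. x \<in> space M \<Longrightarrow> AE y in M. (\<integral>\<^sup>+z. ennreal (Q1 (x, z)) * ennreal (Q2 (z, y)) \<partial>M) = ennreal (Q3 (x, y))"
    and f: "f \<in> L2 M"
  shows "AE x in M. doubly_stochastic.avg M Q1 (doubly_stochastic.avg M Q2 f) x = doubly_stochastic.avg M Q3 f x"
proof -
  interpret A: doubly_stochastic M Q1 by fact
  interpret B: doubly_stochastic M Q2 by fact
  interpret C: doubly_stochastic M Q3 by fact
  have [measurable]: "f \<in> borel_measurable M" using f by (rule L2_measurable)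
  have "AE x in M. integrable M (\<lambda>y. of_real (Q3 (x, y)) * f y)"
    using A.sq.AE_integrable_fst'[OF C.integrable_Q_snd_scaleR[OF L2_integrable[OF f]]]
    by (simp add: scaleR_conv_of_real)
  with AE_space show ?thesis
  proof eventually_elim
    case (elim x)
    then have x [measurable]: "x \<in> space M" by simp
    let ?G = "\<lambda>(z, y). of_real (Q1 (x, z)) * (of_real (Q2 (z, y)) * f y)"
    have "(\<integral>\<^sup>+p. ennreal (norm (?G p)) \<partial>MM)
        = (\<integral>\<^sup>+y. \<integral>\<^sup>+z. (ennreal (Q1 (x, z)) * ennreal (Q2 (z, y))) * ennreal (norm (f y)) \<partial>M \<partial>M)"
      by (subst A.sq.nn_integral_snd[symmetric]) (auto simp: norm_mult ennreal_mult mult.assoc)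
    also have "\<dots> = (\<integral>\<^sup>+y. (\<integral>\<^sup>+z. ennreal (Q1 (x, z)) * ennreal (Q2 (z, y)) \<partial>M) * ennreal (norm (f y)) \<partial>M)"
      by (intro nn_integral_cong nn_integral_multc) measurable
    also have "\<dots> = (\<integral>\<^sup>+y. ennreal (norm (of_real (Q3 (x, y)) * f y)) \<partial>M)"
      by (intro nn_integral_cong_AE) (use comp[OF x] in eventually_elim, simp add: norm_mult ennreal_mult)
    also have "\<dots> < \<infinity>" using elim by (simp add: integrable_iff_bounded)
    finally have G: "integrable MM ?G" by (simp add: integrable_iff_bounded)
    have "A.avg (B.avg f) x = (\<integral>z. \<integral>y. ?G (z, y) \<partial>M \<partial>M)"
      by (simp add: A.avg_def B.avg_def)
    also have "\<dots> = (\<integral>y. \<integral>z. ?G (z, y) \<partial>M \<partial>M)"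
      using A.sq.Fubini_integral[of "\<lambda>z y. ?G (z, y)"] G by simp
    also have "\<dots> = (\<integral>y. of_real (Q3 (x, y)) * f y \<partial>M)"
    proof (rule integral_cong_AE)
      show "AE y in M. (\<integral>z. ?G (z, y) \<partial>M) = of_real (Q3 (x, y)) * f y"
        using comp[OF x] AE_space
      proof eventually_elim
        case (elim y)
        then have [measurable]: "y \<in> space M" by simp
        have "(\<integral>z. Q1 (x, z) * Q2 (z, y) \<partial>M) = Q3 (x, y)"
          by (subst integral_eq_nn_integral) (use elim in \<open>auto simp: ennreal_mult\<close>)
        moreover have int: "integrable M (\<lambda>z. Q1 (x, z) * Q2 (z, y))"
          by (rule integrableI_nn_integral_finite[where x = "Q3 (x, y)"]) (use elim in \<open>auto simp: ennreal_mult\<close>)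
        moreover have "(\<integral>z. complex_of_real (Q1 (x, z) * Q2 (z, y)) \<partial>M) = of_real (\<integral>z. Q1 (x, z) * Q2 (z, y) \<partial>M)"
          by (rule integral_of_real[OF int])
        ultimately show ?case by (simp add: mult.assoc[symmetric])
      qed
    qed measurable
    finally show ?case by (simp add: C.avg_def)
  qed
qed

text \<open>
  The index is shifted by one: \<open>density_pow M k n\<close> is the density of the \<open>(n +
  1)\<close>-st power, since the zeroth power, the identity kernel, has none.
\<close>

primrec density_pow :: "'a measure \<Rightarrow> ('a \<Rightarrow> 'a \<Rightarrow> ennreal) \<Rightarrow> nat \<Rightarrow> 'a \<Rightarrow> 'a \<Rightarrow> ennreal" where
  "density_pow M k 0 = k"
| "density_pow M k (Suc n) = (\<lambda>x y. \<integral>\<^sup>+z. k x z * density_pow M k n z y \<partial>M)"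

context prob_space
begin

lemma density_pow_measurable [measurable]:
  assumes [measurable]: "case_prod k \<in> borel_measurable MM"
  shows "case_prod (density_pow M k n) \<in> borel_measurable MM"
proof (induction n)
  case (Suc n)
  note [measurable] = Suc
  have [measurable]: "(\<lambda>p. k (fst (fst p)) (snd p)) \<in> borel_measurable (MM \<Otimes>\<^sub>M M)"
    using measurable_compose[of "\<lambda>p. (fst (fst p), snd p)" "MM \<Otimes>\<^sub>M M" "MM" "case_prod k" borel] by simp
  have [measurable]: "(\<lambda>p. density_pow M k n (snd p) (snd (fst p))) \<in> borel_measurable (MM \<Otimes>\<^sub>M M)"
    using measurable_compose[of "\<lambda>p. (snd p, snd (fst p))" "MM \<Otimes>\<^sub>M M" "MM" "case_prod (density_pow M k n)" borel] by simp
  have "(\<lambda>p. \<integral>\<^sup>+z. k (fst p) z * density_pow M k n z (snd p) \<partial>M) \<in> borel_measurable MM"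
    by (rule borel_measurable_nn_integral) (simp add: case_prod_unfold)
  then show ?case by (simp add: case_prod_unfold)
qed simp

lemma density_pow_add:
  assumes k [measurable]: "case_prod k \<in> borel_measurable MM" and y: "y \<in> space M" and x: "x \<in> space M"
  shows "(\<integral>\<^sup>+z. density_pow M k m x z * density_pow M k n z y \<partial>M) = density_pow M k (Suc (m + n)) x y"
  using x
proof (induction m arbitrary: x)
  case (Suc m)
  interpret sq: pair_prob_space M M ..
  note [measurable] = density_pow_measurable[OF k] y Suc.prems
  have "(\<integral>\<^sup>+z. density_pow M k (Suc m) x z * density_pow M k n z y \<partial>M)
     = (\<integral>\<^sup>+z. \<integral>\<^sup>+w. (k x w * density_pow M k m w z) * density_pow M k n z y \<partial>M \<partial>M)"
    by (intro nn_integral_cong) (simp add: nn_integral_multc)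
  also have "\<dots> = (\<integral>\<^sup>+w. \<integral>\<^sup>+z. (k x w * density_pow M k m w z) * density_pow M k n z y \<partial>M \<partial>M)"
    by (rule sq.Fubini') measurable
  also have "\<dots> = (\<integral>\<^sup>+w. k x w * density_pow M k (Suc (m + n)) w y \<partial>M)"
    by (intro nn_integral_cong)
       (simp add: mult.assoc nn_integral_cmult Suc.IH del: density_pow.simps)
  finally show ?case by simp
qed simp

lemma kernel_pow_density:
  assumes k [measurable]: "case_prod k \<in> borel_measurable MM"
    and K: "K \<in> \<mu> \<rightarrow>\<^sub>M prob_algebra \<mu>" and s: "sets M = sets \<mu>"
    and d: "\<And>x. x \<in> space \<mu> \<Longrightarrow> K x = density M (k x)"
    and x: "x \<in> space \<mu>"
  shows "kernel_pow \<mu> K (Suc n) x = density M (density_pow M k n x)"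
  using x
proof (induction n arbitrary: x)
  interpret sq: pair_prob_space M M ..
  have K': "K \<in> \<mu> \<rightarrow>\<^sub>M subprob_algebra \<mu>" using K by (rule measurable_prob_algebraD)
  have sp: "space M = space \<mu>" using s by (rule sets_eq_imp_space_eq)
  {
    case 0
    have "sets (K x) = sets \<mu>" by (rule sets_kernel[OF K' 0])
    then have "return \<mu> = return (K x)" by (intro ext return_cong) simp
    then show ?case using d[OF 0] by (simp add: bind_return''[OF refl])
  next
    case (Suc n)
    note [measurable] = density_pow_measurable[OF k]
    have [measurable]: "x \<in> space M" using Suc.prems sp by simp
    have Kn: "kernel_pow \<mu> K (Suc n) \<in> \<mu> \<rightarrow>\<^sub>M subprob_algebra \<mu>"
      using kernel_pow_measurable[OF K] by (rule measurable_prob_algebraD)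
    have sK: "sets (K x) = sets \<mu>" by (rule sets_kernel[OF K' Suc.prems])
    have spK: "space (K x) = space \<mu>" using sK by (rule sets_eq_imp_space_eq)
    have Kn': "kernel_pow \<mu> K (Suc n) \<in> K x \<rightarrow>\<^sub>M subprob_algebra \<mu>"
      using Kn by (simp add: measurable_cong_sets[OF sK refl] del: kernel_pow.simps)
    show ?case
    proof (rule measure_eqI)
      show "sets (kernel_pow \<mu> K (Suc (Suc n)) x) = sets (density M (density_pow M k (Suc n) x))"
        using Suc.prems by (subst kernel_pow.simps, subst sets_bind[OF sets_kernel[OF Kn']])
          (auto simp: s spK simp del: kernel_pow.simps)
      fix A assume "A \<in> sets (kernel_pow \<mu> K (Suc (Suc n)) x)"
      then have A: "A \<in> sets \<mu>"
        using Suc.prems by (subst (asm) kernel_pow.simps, subst (asm) sets_bind[OF sets_kernel[OF Kn']])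
          (auto simp: s spK simp del: kernel_pow.simps)
      then have [measurable]: "A \<in> sets M" using s by simp
      have "emeasure (kernel_pow \<mu> K (Suc (Suc n)) x) A = (\<integral>\<^sup>+z. emeasure (kernel_pow \<mu> K (Suc n) z) A \<partial>K x)"
        by (subst kernel_pow.simps, rule emeasure_bind[OF _ Kn' A]) (use Suc.prems spK in auto)
      also have "\<dots> = (\<integral>\<^sup>+z. (\<integral>\<^sup>+y. density_pow M k n z y * indicator A y \<partial>M) \<partial>K x)"
        by (intro nn_integral_cong)
           (simp add: spK Suc.IH emeasure_density sp[symmetric] del: kernel_pow.simps)
      also have "\<dots> = (\<integral>\<^sup>+z. k x z * (\<integral>\<^sup>+y. density_pow M k n z y * indicator A y \<partial>M) \<partial>M)"
        unfolding d[OF Suc.prems] by (rule nn_integral_density) measurable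
      also have "\<dots> = (\<integral>\<^sup>+z. \<integral>\<^sup>+y. k x z * (density_pow M k n z y * indicator A y) \<partial>M \<partial>M)"
        by (intro nn_integral_cong nn_integral_cmult[symmetric]) measurable
      also have "\<dots> = (\<integral>\<^sup>+y. \<integral>\<^sup>+z. k x z * (density_pow M k n z y * indicator A y) \<partial>M \<partial>M)"
        by (rule sq.Fubini'[symmetric]) measurable
      also have "\<dots> = (\<integral>\<^sup>+y. density_pow M k (Suc n) x y * indicator A y \<partial>M)"
        by (intro nn_integral_cong) (simp add: mult.assoc[symmetric] nn_integral_multc)
      finally show "emeasure (kernel_pow \<mu> K (Suc (Suc n)) x) A = emeasure (density M (density_pow M k (Suc n) x)) A"
        by (simp add: emeasure_density del: kernel_pow.simps density_pow.simps)
    qed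
  }
qed

end

section \<open>Stationary chains with densities\<close>

lemma finite_pair_measure_eqI:
  assumes "finite_measure N1" and sets1: "sets N1 = sets (M1 \<Otimes>\<^sub>M M2)" and sets2: "sets N2 = sets (M1 \<Otimes>\<^sub>M M2)"
    and rect: "\<And>A B. A \<in> sets M1 \<Longrightarrow> B \<in> sets M2 \<Longrightarrow> emeasure N1 (A \<times> B) = emeasure N2 (A \<times> B)"
  shows "N1 = N2"
proof (rule measure_eqI_generator_eq[where A = "\<lambda>_::nat. space M1 \<times> space M2" and \<Omega> = "space M1 \<times> space M2"
      and E = "{a \<times> b |a b. a \<in> sets M1 \<and> b \<in> sets M2}"])
  interpret finite_measure N1 by fact
  show "{a \<times> b |a b. a \<in> sets M1 \<and> b \<in> sets M2} \<subseteq> Pow (space M1 \<times> space M2)"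
    by (auto dest: sets.sets_into_space)
  show "Int_stable {a \<times> b |a b. a \<in> sets M1 \<and> b \<in> sets M2}" by (rule Int_stable_pair_measure_generator)
  show "emeasure N1 (space M1 \<times> space M2) \<noteq> \<infinity>" for i :: nat by simp
qed (use rect sets1 sets2 in \<open>auto simp: sets_pair_measure\<close>)

lemma enn_min: "0 \<le> a \<Longrightarrow> 0 \<le> b \<Longrightarrow> min (ennreal a) (ennreal b) = ennreal (min a b)"
  by (simp add: min_def ennreal_le_iff)

lemma enn_max: "0 \<le> a \<Longrightarrow> 0 \<le> b \<Longrightarrow> max (ennreal a) (ennreal b) = ennreal (max a b)"
  by (simp add: max_def ennreal_le_iff)

locale density_chain =
  fixes \<mu> \<pi> :: "'a measure" and P Ps :: "'a \<Rightarrow> 'a measure"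
    and p ps :: "'a \<Rightarrow> 'a \<Rightarrow> ennreal" and dpi :: "'a \<Rightarrow> ennreal"
  assumes kernel_P: "P \<in> \<mu> \<rightarrow>\<^sub>M prob_algebra \<mu>"
    and kernel_Ps: "Ps \<in> \<mu> \<rightarrow>\<^sub>M prob_algebra \<mu>"
    and pi_prob: "prob_space \<pi>" and sets_pi: "sets \<pi> = sets \<mu>"
    and Ps_reversal: "time_reversal \<pi> P Ps"
    and p_meas: "(\<lambda>(x, y). p x y) \<in> borel_measurable (\<mu> \<Otimes>\<^sub>M \<mu>)"
    and ps_meas: "(\<lambda>(x, y). ps x y) \<in> borel_measurable (\<mu> \<Otimes>\<^sub>M \<mu>)"
    and dpi_meas: "dpi \<in> borel_measurable \<mu>"
    and P_density: "\<And>x. x \<in> space \<mu> \<Longrightarrow> P x = density \<mu> (p x)"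
    and Ps_density: "\<And>x. x \<in> space \<mu> \<Longrightarrow> Ps x = density \<mu> (ps x)"
    and pi_density: "\<pi> = density \<mu> dpi"
    and dpi_pos: "{x \<in> space \<mu>. dpi x = 0} \<in> null_sets \<mu>"
begin

sublocale prob_space \<pi> by (rule pi_prob)
sublocale sq: pair_prob_space \<pi> \<pi> ..

lemma space_pi: "space \<pi> = space \<mu>"
  using sets_pi by (rule sets_eq_imp_space_eq)

lemma measurable_pi: "measurable \<pi> N = measurable \<mu> N"
  by (rule measurable_cong_sets[OF sets_pi refl])

lemma dpi_measurable [measurable]: "dpi \<in> borel_measurable \<pi>"
  using dpi_meas by (simp add: measurable_pi)

lemma sets_pair_pi: "sets (\<pi> \<Otimes>\<^sub>M \<pi>) = sets (\<mu> \<Otimes>\<^sub>M \<mu>)"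
  by (rule sets_pair_measure_cong[OF sets_pi sets_pi])

text \<open>
  As the density of a probability measure, \<open>dpi\<close> is almost everywhere finite, and its
  zeros form a null set; hence \<open>\<mu>\<close> and \<open>\<pi>\<close> have the same null
  sets and densities can be taken with respect to \<open>\<pi>\<close>.
\<close>

lemma dpi_finite_pos: "AE x in \<mu>. 0 < dpi x \<and> dpi x < \<infinity>"
proof -
  have "(\<integral>\<^sup>+x. dpi x \<partial>\<mu>) = emeasure \<pi> (space \<pi>)"
    using dpi_meas by (subst pi_density, subst emeasure_density)
      (auto simp: space_pi intro!: nn_integral_cong)
  then have "AE x in \<mu>. dpi x \<noteq> \<infinity>"
    using dpi_meas by (intro nn_integral_PInf_AE) (auto simp: emeasure_space_1)
  moreover have "AE x in \<mu>. dpi x \<noteq> 0"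
    by (rule AE_I'[OF dpi_pos]) auto
  ultimately show ?thesis by eventually_elim (auto simp: zero_less_iff_neq_zero less_top)
qed

lemma AE_pi_iff: "(AE x in \<pi>. R x) \<longleftrightarrow> (AE x in \<mu>. R x)"
  unfolding pi_density AE_density[OF dpi_meas] using dpi_finite_pos by (auto elim: eventually_elim2)

lemma density_mu_eq_pi:
  assumes "g \<in> borel_measurable \<mu>"
  shows "density \<mu> g = density \<pi> (\<lambda>x. g x / dpi x)"
proof -
  have "density \<pi> (\<lambda>x. g x / dpi x) = density \<mu> (\<lambda>x. dpi x * (g x / dpi x))"
    using assms dpi_meas by (subst pi_density, subst density_density_eq) auto
  also have "\<dots> = density \<mu> g"
    using dpi_finite_pos assms dpi_meas
  proof (intro density_cong)
    show "AE x in \<mu>. dpi x * (g x / dpi x) = g x"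
      using dpi_finite_pos
    proof eventually_elim
      case (elim x)
      have "dpi x * (g x / dpi x) = g x * dpi x / dpi x" by (simp add: ennreal_times_divide mult.commute)
      then show ?case using elim ennreal_mult_divide_eq[of "dpi x" "g x"] by auto
    qed
  qed auto
  finally show ?thesis ..
qed

text \<open>
  \<open>\<mu>\<close> has the almost everywhere finite density \<open>1 / dpi\<close> with
  respect to the finite measure \<open>\<pi>\<close>. This makes Radon-Nikodym derivatives with
  respect to \<open>\<mu>\<close> unique up to null sets.
\<close>

lemma sigma_finite_mu: "sigma_finite_measure \<mu>"
proof -
  have "density \<mu> (\<lambda>x. 1) = density \<pi> (\<lambda>x. 1 / dpi x)" by (rule density_mu_eq_pi) simp
  moreover have "AE x in \<pi>. 1 / dpi x \<noteq> \<infinity>"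
    unfolding AE_pi_iff using dpi_finite_pos by eventually_elim (auto simp: ennreal_divide_eq_top_iff)
  then have "sigma_finite_measure (density \<pi> (\<lambda>x. 1 / dpi x))"
    by (subst sigma_finite_iff_density_finite) auto
  ultimately show ?thesis using density_1[of \<mu>] by metis
qed

definition has_density :: "('a \<Rightarrow> 'a measure) \<Rightarrow> ('a \<Rightarrow> 'a \<Rightarrow> ennreal) \<Rightarrow> bool" where
  "has_density K k \<longleftrightarrow> K \<in> \<mu> \<rightarrow>\<^sub>M prob_algebra \<mu> \<and> case_prod k \<in> borel_measurable (\<pi> \<Otimes>\<^sub>M \<pi>)
     \<and> (\<forall>x\<in>space \<mu>. K x = density \<mu> (k x))"

lemma P_has_density: "has_density P p" and Ps_has_density: "has_density Ps ps"
  using kernel_P kernel_Ps p_meas ps_meas P_density Ps_density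
  by (simp_all add: has_density_def measurable_cong_sets[OF sets_pair_pi refl])

text \<open>
  The jointly measurable density of the \<open>n\<close>-th power of a kernel with respect to
  \<open>\<pi>\<close>, for positive \<open>n\<close>. Joint measurability may be lost for
  Radon-Nikodym derivatives chosen separately at every \<open>x\<close>.
\<close>

definition dens :: "('a \<Rightarrow> 'a \<Rightarrow> ennreal) \<Rightarrow> nat \<Rightarrow> 'a \<Rightarrow> 'a \<Rightarrow> ennreal" where
  "dens k n = density_pow \<pi> (\<lambda>x y. k x y / dpi y) (n - 1)"

definition rdens :: "('a \<Rightarrow> 'a \<Rightarrow> ennreal) \<Rightarrow> nat \<Rightarrow> 'a \<times> 'a \<Rightarrow> real" where
  "rdens k n z = enn2real (dens k n (fst z) (snd z))"

definition rdpi :: "'a \<Rightarrow> real" where "rdpi y = enn2real (dpi y)"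

lemma rdpi_nonneg [simp]: "0 \<le> rdpi y" by (simp add: rdpi_def)

lemma rdpi_measurable [measurable]: "rdpi \<in> borel_measurable \<mu>"
  using dpi_meas unfolding rdpi_def[abs_def] by measurable

lemma dpi_eq_rdpi: "AE y in \<mu>. dpi y = ennreal (rdpi y)"
  using dpi_finite_pos by eventually_elim (auto simp: rdpi_def)

lemma pi_density_rdpi: "\<pi> = density \<mu> (\<lambda>y. ennreal (rdpi y))"
  using dpi_meas dpi_eq_rdpi by (subst pi_density, intro density_cong) auto

context
  fixes K k
  assumes Kk: "has_density K k"
begin

lemma quotient_measurable: "(\<lambda>(x, y). k x y / dpi y) \<in> borel_measurable (\<pi> \<Otimes>\<^sub>M \<pi>)"
proof -
  have [measurable]: "case_prod k \<in> borel_measurable (\<pi> \<Otimes>\<^sub>M \<pi>)"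
    using Kk by (simp add: has_density_def)
  show ?thesis by measurable
qed

lemma dens_measurable: "case_prod (dens k n) \<in> borel_measurable (\<pi> \<Otimes>\<^sub>M \<pi>)"
  unfolding dens_def using quotient_measurable by (intro density_pow_measurable) simp

lemma kernel_pow_dens:
  assumes "n \<ge> 1" "x \<in> space \<mu>"
  shows "kernel_pow \<mu> K n x = density \<pi> (dens k n x)"
proof -
  have "K x = density \<pi> (\<lambda>y. k x y / dpi y)" if "x \<in> space \<mu>" for x
  proof -
    have "k x \<in> borel_measurable \<mu>"
      using measurable_Pair2[of "case_prod k" \<pi> \<pi> borel x] Kk that
      by (simp add: has_density_def space_pi measurable_pi)
    then show ?thesis using density_mu_eq_pi[of "k x"] Kk that by (simp add: has_density_def)
  qed
  then have "kernel_pow \<mu> K (Suc (n - 1)) x = density \<pi> (dens k n x)"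
    unfolding dens_def using Kk quotient_measurable assms(2) sets_pi
    by (intro kernel_pow_density) (auto simp: has_density_def)
  then show ?thesis using assms(1) by (simp del: kernel_pow.simps)
qed

lemma dens_row:
  assumes n: "n \<ge> 1" and x: "x \<in> space \<mu>"
  shows "(\<integral>\<^sup>+y. dens k n x y \<partial>\<pi>) = 1"
proof -
  note [measurable] = dens_measurable
  have [measurable]: "x \<in> space \<pi>" using x by (simp add: space_pi)
  have "kernel_pow \<mu> K n x \<in> space (prob_algebra \<mu>)"
    using measurable_space[OF kernel_pow_measurable x] Kk by (simp add: has_density_def)
  then have "prob_space (kernel_pow \<mu> K n x)" "space (kernel_pow \<mu> K n x) = space \<pi>"
    using sets_eq_imp_space_eq[of "kernel_pow \<mu> K n x" \<mu>] by (auto simp: space_prob_algebra space_pi)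
  then have "1 = emeasure (kernel_pow \<mu> K n x) (space \<pi>)"
    using prob_space.emeasure_space_1[of "kernel_pow \<mu> K n x"] by simp
  also have "\<dots> = (\<integral>\<^sup>+y. dens k n x y * indicator (space \<pi>) y \<partial>\<pi>)"
    unfolding kernel_pow_dens[OF n x] by (rule emeasure_density) measurable
  also have "\<dots> = (\<integral>\<^sup>+y. dens k n x y \<partial>\<pi>)" by (intro nn_integral_cong) simp
  finally show ?thesis ..
qed

lemma dens_section_measurable: "x \<in> space \<mu> \<Longrightarrow> dens k n x \<in> borel_measurable \<pi>"
  using measurable_Pair2[OF dens_measurable, of x n] by (simp add: space_pi)

lemma rdens_eq:
  assumes n: "n \<ge> 1" and x: "x \<in> space \<mu>"
  shows "AE y in \<pi>. ennreal (rdens k n (x, y)) = dens k n x y"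
proof -
  have "AE y in \<pi>. dens k n x y \<noteq> \<infinity>"
    using dens_row[OF n x] dens_section_measurable[OF x] by (intro nn_integral_PInf_AE) auto
  then show ?thesis by eventually_elim (simp add: rdens_def less_top)
qed

text \<open>
  This holds at every \<open>x\<close> and not just at almost every one, which makes the
  Metropolis-Hastings operators measurable in \<open>x\<close> although the derivatives themselves
  need not be.
\<close>

lemma RN_deriv_kernel_pow:
  assumes n: "n \<ge> 1" and x: "x \<in> space \<mu>"
  shows "AE y in \<mu>. RN_deriv \<mu> (kernel_pow \<mu> K n x) y = ennreal (rdpi y * rdens k n (x, y))"
proof -
  interpret mu: sigma_finite_measure \<mu> by (rule sigma_finite_mu)
  have dm: "dens k n x \<in> borel_measurable \<mu>"
    using dens_section_measurable[OF x] by (simp add: measurable_pi)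
  have "density \<mu> (\<lambda>y. dpi y * dens k n x y) = kernel_pow \<mu> K n x"
    unfolding kernel_pow_dens[OF n x] using dm dpi_meas by (subst (2) pi_density, subst density_density_eq) auto
  then have "AE y in \<mu>. dpi y * dens k n x y = RN_deriv \<mu> (kernel_pow \<mu> K n x) y"
    using dm dpi_meas by (intro mu.RN_deriv_unique) auto
  moreover have "AE y in \<mu>. ennreal (rdens k n (x, y)) = dens k n x y"
    using rdens_eq[OF n x] by (simp add: AE_pi_iff)
  ultimately show ?thesis using dpi_eq_rdpi
    by eventually_elim (simp add: ennreal_mult rdens_def)
qed

end

abbreviation "q \<equiv> dens p"
abbreviation "qs \<equiv> dens ps"
abbreviation "Q \<equiv> rdens p"
abbreviation "QS \<equiv> rdens ps"

lemmas q_measurable [measurable] = dens_measurable[OF P_has_density]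
lemmas qs_measurable [measurable] = dens_measurable[OF Ps_has_density]
lemmas kernel_pow_P = kernel_pow_dens[OF P_has_density]
lemmas kernel_pow_Ps = kernel_pow_dens[OF Ps_has_density]
lemmas q_row = dens_row[OF P_has_density]
lemmas qs_row = dens_row[OF Ps_has_density]
lemmas Q_eq = rdens_eq[OF P_has_density]
lemmas QS_eq = rdens_eq[OF Ps_has_density]
lemmas RN_deriv_P = RN_deriv_kernel_pow[OF P_has_density]
lemmas RN_deriv_Ps = RN_deriv_kernel_pow[OF Ps_has_density]

text \<open>
  Both functions are densities on the product space, and by time reversal they give the same mass
  to rectangles.
\<close>

lemma qs_eq_q_swap:
  assumes n: "n \<ge> 1"
  shows "AE x in \<pi>. AE y in \<pi>. qs n x y = q n y x"
proof -
  have swap [measurable]: "(\<lambda>z. q n (snd z) (fst z)) \<in> borel_measurable (\<pi> \<Otimes>\<^sub>M \<pi>)"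
    using measurable_compose[of prod.swap "\<pi> \<Otimes>\<^sub>M \<pi>" "\<pi> \<Otimes>\<^sub>M \<pi>" "case_prod (q n)" borel]
    by (simp add: swap_measurable case_prod_unfold)
  have fin: "(\<integral>\<^sup>+z. qs n (fst z) (snd z) \<partial>(\<pi> \<Otimes>\<^sub>M \<pi>)) = 1"
  proof -
    have "(\<integral>\<^sup>+z. qs n (fst z) (snd z) \<partial>(\<pi> \<Otimes>\<^sub>M \<pi>)) = (\<integral>\<^sup>+x. \<integral>\<^sup>+y. qs n x y \<partial>\<pi> \<partial>\<pi>)"
      by (subst nn_integral_fst[symmetric]) auto
    also have "\<dots> = (\<integral>\<^sup>+x. 1 \<partial>\<pi>)" by (intro nn_integral_cong) (simp add: qs_row[OF n] space_pi)
    finally show ?thesis by (simp add: emeasure_space_1)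
  qed
  have "density (\<pi> \<Otimes>\<^sub>M \<pi>) (\<lambda>z. qs n (fst z) (snd z)) = density (\<pi> \<Otimes>\<^sub>M \<pi>) (\<lambda>z. q n (snd z) (fst z))"
  proof (rule finite_pair_measure_eqI[where ?M1.0 = \<pi> and ?M2.0 = \<pi>])
    show "finite_measure (density (\<pi> \<Otimes>\<^sub>M \<pi>) (\<lambda>z. qs n (fst z) (snd z)))"
    proof (rule finite_measureI)
      have "emeasure (density (\<pi> \<Otimes>\<^sub>M \<pi>) (\<lambda>z. qs n (fst z) (snd z))) (space (\<pi> \<Otimes>\<^sub>M \<pi>)) = (\<integral>\<^sup>+z. qs n (fst z) (snd z) \<partial>(\<pi> \<Otimes>\<^sub>M \<pi>))"
        by (subst emeasure_density) (auto intro!: nn_integral_cong simp: case_prod_unfold)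
      then show "emeasure (density (\<pi> \<Otimes>\<^sub>M \<pi>) (\<lambda>z. qs n (fst z) (snd z))) (space (density (\<pi> \<Otimes>\<^sub>M \<pi>) (\<lambda>z. qs n (fst z) (snd z)))) \<noteq> \<infinity>"
        using fin by simp
    qed
    fix A B assume AB [measurable]: "A \<in> sets \<pi>" "B \<in> sets \<pi>"
    have "emeasure (density (\<pi> \<Otimes>\<^sub>M \<pi>) (\<lambda>z. qs n (fst z) (snd z))) (A \<times> B)
        = (\<integral>\<^sup>+z. (qs n (fst z) (snd z) * indicator B (snd z)) * indicator A (fst z) \<partial>(\<pi> \<Otimes>\<^sub>M \<pi>))"
      by (subst emeasure_density) (auto intro!: nn_integral_cong simp: indicator_def)
    also have "\<dots> = (\<integral>\<^sup>+x. \<integral>\<^sup>+y. (qs n x y * indicator B y) * indicator A x \<partial>\<pi> \<partial>\<pi>)"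
      by (subst nn_integral_fst[symmetric]) auto
    also have "\<dots> = (\<integral>\<^sup>+x\<in>A. emeasure (kernel_pow \<mu> Ps n x) B \<partial>\<pi>)"
      by (intro nn_integral_cong)
         (simp add: nn_integral_multc kernel_pow_Ps[OF n] space_pi emeasure_density)
    also have "\<dots> = (\<integral>\<^sup>+y\<in>B. emeasure (kernel_pow \<mu> P n y) A \<partial>\<pi>)"
      using time_reversal_kernel_pow[OF kernel_P kernel_Ps sets_pi Ps_reversal, of n] AB
      by (simp add: time_reversal_def)
    also have "\<dots> = (\<integral>\<^sup>+y. \<integral>\<^sup>+x. (q n y x * indicator A x) * indicator B y \<partial>\<pi> \<partial>\<pi>)"
      by (intro nn_integral_cong)
         (simp add: nn_integral_multc kernel_pow_P[OF n] space_pi emeasure_density)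
    also have "\<dots> = (\<integral>\<^sup>+z. (q n (snd z) (fst z) * indicator A (fst z)) * indicator B (snd z) \<partial>(\<pi> \<Otimes>\<^sub>M \<pi>))"
      by (subst sq.nn_integral_snd[symmetric]) auto
    also have "\<dots> = emeasure (density (\<pi> \<Otimes>\<^sub>M \<pi>) (\<lambda>z. q n (snd z) (fst z))) (A \<times> B)"
      by (subst emeasure_density) (auto intro!: nn_integral_cong simp: indicator_def)
    finally show "emeasure (density (\<pi> \<Otimes>\<^sub>M \<pi>) (\<lambda>z. qs n (fst z) (snd z))) (A \<times> B)
      = emeasure (density (\<pi> \<Otimes>\<^sub>M \<pi>) (\<lambda>z. q n (snd z) (fst z))) (A \<times> B)" .
  qed auto
  then have "AE z in \<pi> \<Otimes>\<^sub>M \<pi>. qs n (fst z) (snd z) = q n (snd z) (fst z)"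
    using fin by (subst (asm) finite_density_unique) auto
  from sq.AE_pair[OF this] show ?thesis by simp
qed

lemma Q_measurable [measurable]: "Q n \<in> borel_measurable (\<pi> \<Otimes>\<^sub>M \<pi>)"
  unfolding rdens_def[abs_def] by measurable

lemma QS_measurable [measurable]: "QS n \<in> borel_measurable (\<pi> \<Otimes>\<^sub>M \<pi>)"
  unfolding rdens_def[abs_def] by measurable

lemma QS_eq_Q_swap: "n \<ge> 1 \<Longrightarrow> AE x in \<pi>. AE y in \<pi>. QS n (x, y) = Q n (y, x)"
  using qs_eq_q_swap[of n] by (auto simp: rdens_def elim!: eventually_mono)

lemma doubly_stochastic_Q:
  assumes n: "n \<ge> 1"
  shows "doubly_stochastic \<pi> (Q n)"
proof
  show "Q n \<in> borel_measurable (\<pi> \<Otimes>\<^sub>M \<pi>)" by measurable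
  show "0 \<le> Q n z" for z by (simp add: rdens_def)
  show "AE x in \<pi>. (\<integral>\<^sup>+y. Q n (x, y) \<partial>\<pi>) = 1"
  proof (rule AE_I2)
    fix x assume "x \<in> space \<pi>"
    then have x: "x \<in> space \<mu>" by (simp add: space_pi)
    have "(\<integral>\<^sup>+y. Q n (x, y) \<partial>\<pi>) = (\<integral>\<^sup>+y. q n x y \<partial>\<pi>)" by (rule nn_integral_cong_AE[OF Q_eq[OF n x]])
    then show "(\<integral>\<^sup>+y. Q n (x, y) \<partial>\<pi>) = 1" by (simp add: q_row[OF n x])
  qed
  show "AE y in \<pi>. (\<integral>\<^sup>+x. Q n (x, y) \<partial>\<pi>) = 1"
    using QS_eq_Q_swap[OF n] AE_space
  proof eventually_elim
    case (elim y)
    then have y: "y \<in> space \<mu>" by (simp add: space_pi)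
    have "(\<integral>\<^sup>+x. Q n (x, y) \<partial>\<pi>) = (\<integral>\<^sup>+x. QS n (y, x) \<partial>\<pi>)"
      by (rule nn_integral_cong_AE) (use elim(1) in eventually_elim, simp)
    also have "\<dots> = (\<integral>\<^sup>+x. qs n y x \<partial>\<pi>)" by (rule nn_integral_cong_AE[OF QS_eq[OF n y]])
    finally show ?case by (simp add: qs_row[OF n y])
  qed
qed

text \<open>
  The Chapman-Kolmogorov equation. The densities satisfy it everywhere; their real-valued versions
  only where they are finite.
\<close>

lemma Q_compose:
  assumes m: "m \<ge> 1" and n: "n \<ge> 1" and x: "x \<in> space \<pi>"
  shows "AE y in \<pi>. (\<integral>\<^sup>+z. ennreal (Q m (x, z)) * ennreal (Q n (z, y)) \<partial>\<pi>) = ennreal (Q (m + n) (x, y))"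
proof -
  have x': "x \<in> space \<mu>" using x by (simp add: space_pi)
  have "AE z in \<pi>. AE y in \<pi>. ennreal (Q n (z, y)) = q n z y"
    by (rule AE_I2) (auto simp: space_pi Q_eq[OF n])
  then have "AE y in \<pi>. AE z in \<pi>. ennreal (Q n (z, y)) = q n z y"
    by (subst (asm) sq.AE_commute) auto
  moreover have "AE y in \<pi>. ennreal (Q (m + n) (x, y)) = q (m + n) x y" using m x' by (intro Q_eq) auto
  ultimately show ?thesis using AE_space
  proof eventually_elim
    case (elim y)
    have "(\<integral>\<^sup>+z. ennreal (Q m (x, z)) * ennreal (Q n (z, y)) \<partial>\<pi>) = (\<integral>\<^sup>+z. q m x z * q n z y \<partial>\<pi>)"
      by (rule nn_integral_cong_AE) (use elim(1) Q_eq[OF m x'] in eventually_elim, simp)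
    also have "\<dots> = q (m + n) x y"
    proof -
      have "Suc (m - 1 + (n - 1)) = m + n - 1" using m n by simp
      then show ?thesis using density_pow_add[OF quotient_measurable[OF P_has_density] elim(3) x, of "m - 1" "n - 1"] m n
        by (simp add: dens_def del: density_pow.simps)
    qed
    finally show ?case using elim(2) by simp
  qed
qed

lemma section_Q_measurable: "x \<in> space \<mu> \<Longrightarrow> (\<lambda>y. Q n (x, y)) \<in> borel_measurable \<mu>"
  and section_QS_measurable: "x \<in> space \<mu> \<Longrightarrow> (\<lambda>y. QS n (x, y)) \<in> borel_measurable \<mu>"
  using measurable_Pair2[OF Q_measurable, of x n] measurable_Pair2[OF QS_measurable, of x n]
  by (simp_all add: space_pi measurable_pi)

lemma integral_mu_pi:
  fixes g :: "'a \<Rightarrow> complex"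
  assumes k: "k \<in> borel_measurable \<mu>" and g: "g \<in> borel_measurable \<mu>"
    and H: "H \<in> borel_measurable \<mu>" "AE y in \<mu>. H y = ennreal (rdpi y * k y)" "\<And>y. 0 \<le> k y"
  shows "(\<integral>y. of_real (enn2real (H y)) * g y \<partial>\<mu>) = (\<integral>y. of_real (k y) * g y \<partial>\<pi>)"
proof -
  have "(\<integral>y. of_real (enn2real (H y)) * g y \<partial>\<mu>) = (\<integral>y. rdpi y *\<^sub>R (of_real (k y) * g y) \<partial>\<mu>)"
  proof (rule integral_cong_AE)
    show "AE y in \<mu>. of_real (enn2real (H y)) * g y = rdpi y *\<^sub>R (of_real (k y) * g y)"
      using H(2) by eventually_elim (simp add: H(3) scaleR_conv_of_real)
  qed (use k g H(1) in measurable)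
  also have "\<dots> = (\<integral>y. of_real (k y) * g y \<partial>\<pi>)"
    using k g by (subst pi_density_rdpi, subst integral_density) auto
  finally show ?thesis .
qed

abbreviation "minQ n x y \<equiv> min (Q n (x, y)) (QS n (x, y))"
abbreviation "maxQ n x y \<equiv> max (Q n (x, y)) (QS n (x, y))"

lemma Q_nonneg [simp]: "0 \<le> Q n z" "0 \<le> QS n z"
  by (simp_all add: rdens_def)

lemma MH_integrals:
  fixes f :: "'a \<Rightarrow> complex"
  assumes n: "n \<ge> 1" and x: "x \<in> space \<mu>" and f: "f \<in> borel_measurable \<pi>"
  shows "(\<integral>y. of_real (enn2real (min (RN_deriv \<mu> (kernel_pow \<mu> P n x) y) (RN_deriv \<mu> (kernel_pow \<mu> Ps n x) y))) * f y \<partial>\<mu>)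
      = (\<integral>y. of_real (minQ n x y) * f y \<partial>\<pi>)"
    and "(\<integral>y. of_real (enn2real (max (RN_deriv \<mu> (kernel_pow \<mu> P n x) y) (RN_deriv \<mu> (kernel_pow \<mu> Ps n x) y))) * f y \<partial>\<mu>)
      = (\<integral>y. of_real (maxQ n x y) * f y \<partial>\<pi>)"
proof -
  have [measurable]: "(\<lambda>y. Q n (x, y)) \<in> borel_measurable \<mu>" "(\<lambda>y. QS n (x, y)) \<in> borel_measurable \<mu>"
    by (rule section_Q_measurable[OF x] section_QS_measurable[OF x])+
  have f': "f \<in> borel_measurable \<mu>" using f by (simp add: measurable_pi)
  have min_rdpi: "min (rdpi y * a) (rdpi y * b) = rdpi y * min a b" "max (rdpi y * a) (rdpi y * b) = rdpi y * max a b" for y a b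
    by (simp_all add: min_mult_distrib_left max_mult_distrib_left)
  show "(\<integral>y. of_real (enn2real (min (RN_deriv \<mu> (kernel_pow \<mu> P n x) y) (RN_deriv \<mu> (kernel_pow \<mu> Ps n x) y))) * f y \<partial>\<mu>)
      = (\<integral>y. of_real (minQ n x y) * f y \<partial>\<pi>)"
    using RN_deriv_P[OF n x] RN_deriv_Ps[OF n x]
    by (intro integral_mu_pi f') (auto elim!: eventually_elim2 simp: enn_min min_rdpi)
  show "(\<integral>y. of_real (enn2real (max (RN_deriv \<mu> (kernel_pow \<mu> P n x) y) (RN_deriv \<mu> (kernel_pow \<mu> Ps n x) y))) * f y \<partial>\<mu>)
      = (\<integral>y. of_real (maxQ n x y) * f y \<partial>\<pi>)"
    using RN_deriv_P[OF n x] RN_deriv_Ps[OF n x]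
    by (intro integral_mu_pi f') (auto elim!: eventually_elim2 simp: enn_max min_rdpi le_max_iff_disj)
qed

text \<open>
  Deleting the point \<open>x\<close> from the integral changes nothing, although
  \<open>{x}\<close> may fail to be measurable. If \<open>x\<close> lies in the null set where the
  densities of the reversal disagree, then almost every \<open>y\<close> differs from
  \<open>x\<close>; otherwise the integrand vanishes at \<open>y = x\<close> whenever the
  densities agree there.
\<close>

lemma mh_rho_eq:
  assumes n: "n \<ge> 1" and x: "x \<in> space \<mu>"
  shows "mh_rho \<mu> (kernel_pow \<mu> P n) (kernel_pow \<mu> Ps n) x = (\<integral>y. Q n (x, y) - minQ n x y \<partial>\<pi>)"
proof -
  let ?r = "RN_deriv \<mu> (kernel_pow \<mu> P n x)" and ?rs = "RN_deriv \<mu> (kernel_pow \<mu> Ps n x)"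
  have [measurable]: "(\<lambda>y. Q n (x, y)) \<in> borel_measurable \<mu>" "(\<lambda>y. QS n (x, y)) \<in> borel_measurable \<mu>"
    by (rule section_Q_measurable[OF x] section_QS_measurable[OF x])+
  obtain N where N: "N \<in> null_sets \<pi>" "{x \<in> space \<pi>. \<not> (AE y in \<pi>. QS n (x, y) = Q n (y, x))} \<subseteq> N"
    using QS_eq_Q_swap[OF n] by (auto elim!: AE_E simp: null_sets_def)
  \<comment> \<open>The integrands of the two sides differ at most at \<open>y = x\<close>, where the one on the right must then vanish.\<close>
  have diag: "AE y in \<mu>. y = x \<longrightarrow> QS n (x, y) = Q n (x, y)"
  proof (cases "x \<in> N")
    case True
    have "AE y in \<mu>. y \<notin> N" using AE_not_in[OF N(1)] by (simp add: AE_pi_iff)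
    then show ?thesis by eventually_elim (use True in auto)
  next
    case False
    then have "AE y in \<pi>. QS n (x, y) = Q n (y, x)" using N(2) x by (auto simp: space_pi)
    then have "AE y in \<mu>. QS n (x, y) = Q n (y, x)" by (simp add: AE_pi_iff)
    then show ?thesis by eventually_elim auto
  qed
  have "(\<integral>\<^sup>+y\<in>space \<mu> - {x}. (?r y - min (?r y) (?rs y)) \<partial>\<mu>)
      = (\<integral>\<^sup>+y. ennreal (rdpi y) * ennreal (Q n (x, y) - minQ n x y) \<partial>\<mu>)"
  proof (rule nn_integral_cong_AE)
    show "AE y in \<mu>. (?r y - min (?r y) (?rs y)) * indicator (space \<mu> - {x}) y
        = ennreal (rdpi y) * ennreal (Q n (x, y) - minQ n x y)"
      using RN_deriv_P[OF n x] RN_deriv_Ps[OF n x] diag AE_space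
    proof eventually_elim
      case (elim y)
      have "?r y - min (?r y) (?rs y) = ennreal (rdpi y * (Q n (x, y) - minQ n x y))"
        using elim(1,2) by (simp add: enn_min ennreal_minus min_mult_distrib_left right_diff_distrib)
      also have "\<dots> = ennreal (rdpi y) * ennreal (Q n (x, y) - minQ n x y)"
        by (rule ennreal_mult) auto
      finally show ?case using elim(3,4) by (cases "y = x") auto
    qed
  qed
  also have "\<dots> = (\<integral>\<^sup>+y. ennreal (Q n (x, y) - minQ n x y) \<partial>\<pi>)"
    by (subst pi_density_rdpi, subst nn_integral_density) auto
  finally have "mh_rho \<mu> (kernel_pow \<mu> P n) (kernel_pow \<mu> Ps n) x = enn2real (\<integral>\<^sup>+y. ennreal (Q n (x, y) - minQ n x y) \<partial>\<pi>)"
    by (simp add: mh_rho_def)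
  also have "\<dots> = (\<integral>y. Q n (x, y) - minQ n x y \<partial>\<pi>)"
    by (rule integral_eq_nn_integral[symmetric]) (auto simp: measurable_pi)
  finally show ?thesis .
qed

lemma MH_eq:
  fixes f :: "'a \<Rightarrow> complex"
  assumes n: "n \<ge> 1" and x: "x \<in> space \<mu>" and f: "f \<in> borel_measurable \<pi>"
  shows "MH1 \<mu> (kernel_pow \<mu> P n) (kernel_pow \<mu> Ps n) f x
      = (\<integral>y. of_real (minQ n x y) * f y \<partial>\<pi>) + of_real (\<integral>y. Q n (x, y) - minQ n x y \<partial>\<pi>) * f x"
    and "MH2 \<mu> (kernel_pow \<mu> P n) (kernel_pow \<mu> Ps n) f x
      = (\<integral>y. of_real (maxQ n x y) * f y \<partial>\<pi>) - of_real (\<integral>y. Q n (x, y) - minQ n x y \<partial>\<pi>) * f x"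
  unfolding MH1_def MH2_def MH_integrals[OF n x f] mh_rho_eq[OF n x] by simp_all

lemma MH_quadratic_forms:
  assumes n: "n \<ge> 1" and f: "f \<in> L2 \<pi>"
  defines "R \<equiv> \<integral>x. doubly_stochastic.rejection \<pi> (Q n) x * (cmod (f x))\<^sup>2 \<partial>\<pi>"
  shows "inner_L2 \<pi> (MH1 \<mu> (kernel_pow \<mu> P n) (kernel_pow \<mu> Ps n) f) f
      = doubly_stochastic.form \<pi> (\<lambda>z. min (Q n z) (Q n (prod.swap z))) f f + of_real R"
    and "inner_L2 \<pi> (MH2 \<mu> (kernel_pow \<mu> P n) (kernel_pow \<mu> Ps n) f) f
      = doubly_stochastic.form \<pi> (\<lambda>z. max (Q n z) (Q n (prod.swap z))) f f - of_real R"
proof -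
  interpret D: doubly_stochastic \<pi> "Q n" by (rule doubly_stochastic_Q[OF n])
  have [measurable]: "f \<in> borel_measurable \<pi>" using f by (rule L2_measurable)
  let ?min = "\<lambda>x y. min (Q n (x, y)) (Q n (y, x))" and ?max = "\<lambda>x y. max (Q n (x, y)) (Q n (y, x))"
  have [measurable]: "(\<lambda>x. Q n (prod.swap x)) \<in> borel_measurable (\<pi> \<Otimes>\<^sub>M \<pi>)" by measurable
  have AE_eq: "AE x in \<pi>. (\<integral>y. of_real (minQ n x y) * f y \<partial>\<pi>) = (\<integral>y. of_real (?min x y) * f y \<partial>\<pi>)
      \<and> (\<integral>y. of_real (maxQ n x y) * f y \<partial>\<pi>) = (\<integral>y. of_real (?max x y) * f y \<partial>\<pi>)
      \<and> (\<integral>y. Q n (x, y) - minQ n x y \<partial>\<pi>) = D.rejection x"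
    using QS_eq_Q_swap[OF n] AE_space
  proof eventually_elim
    case (elim x)
    then have [measurable]: "x \<in> space \<pi>" by simp
    have [measurable]: "(\<lambda>y. Q n (y, x)) \<in> borel_measurable \<pi>" by measurable
    have "(\<integral>y. of_real (minQ n x y) * f y \<partial>\<pi>) = (\<integral>y. of_real (?min x y) * f y \<partial>\<pi>)"
    proof (rule integral_cong_AE)
      show "AE y in \<pi>. of_real (minQ n x y) * f y = of_real (?min x y) * f y"
        using elim(1) by eventually_elim simp
    qed measurable
    moreover have "(\<integral>y. of_real (maxQ n x y) * f y \<partial>\<pi>) = (\<integral>y. of_real (?max x y) * f y \<partial>\<pi>)"
    proof (rule integral_cong_AE)
      show "AE y in \<pi>. of_real (maxQ n x y) * f y = of_real (?max x y) * f y"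
        using elim(1) by eventually_elim simp
    qed measurable
    moreover have "(\<integral>y. Q n (x, y) - minQ n x y \<partial>\<pi>) = (\<integral>y. Q n (x, y) - ?min x y \<partial>\<pi>)"
    proof (rule integral_cong_AE)
      show "AE y in \<pi>. Q n (x, y) - minQ n x y = Q n (x, y) - ?min x y"
        using elim(1) by eventually_elim simp
    qed measurable
    ultimately show ?case by (simp add: D.rejection_def D.excess_def)
  qed
  let ?F = "\<lambda>x. (\<integral>y. of_real (minQ n x y) * f y \<partial>\<pi>)" and ?G = "\<lambda>x. (\<integral>y. of_real (maxQ n x y) * f y \<partial>\<pi>)"
    and ?r = "\<lambda>x. (\<integral>y. Q n (x, y) - minQ n x y \<partial>\<pi>)"
  let ?F' = "\<lambda>x. (\<integral>y. of_real (?min x y) * f y \<partial>\<pi>)" and ?G' = "\<lambda>x. (\<integral>y. of_real (?max x y) * f y \<partial>\<pi>)"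
  have [measurable]: "?F \<in> borel_measurable \<pi>" "?G \<in> borel_measurable \<pi>" "?r \<in> borel_measurable \<pi>"
    by measurable
  have [measurable]: "(\<lambda>z. Q n (snd z, fst z)) \<in> borel_measurable (\<pi> \<Otimes>\<^sub>M \<pi>)"
    by measurable
  have [measurable]: "?F' \<in> borel_measurable \<pi>" "?G' \<in> borel_measurable \<pi>"
    by measurable
  have R_int: "integrable \<pi> (\<lambda>x. of_real (D.rejection x) * f x * cnj (f x))"
    and R_eq: "(\<integral>x. of_real (D.rejection x) * f x * cnj (f x) \<partial>\<pi>) = of_real R"
  proof -
    have eq: "of_real (D.rejection x) * f x * cnj (f x) = of_real (D.rejection x * (cmod (f x))\<^sup>2)" for x
      by (simp only: of_real_mult complex_norm_square mult.assoc)
    show "integrable \<pi> (\<lambda>x. of_real (D.rejection x) * f x * cnj (f x))"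
      unfolding eq by (intro integrable_of_real D.rejection_integral L2_square_integrable f zero_le_power2)
    show "(\<integral>x. of_real (D.rejection x) * f x * cnj (f x) \<partial>\<pi>) = of_real R"
      unfolding eq R_def
      by (intro integral_of_real D.rejection_integral L2_square_integrable f zero_le_power2)
  qed
  have int: "integrable \<pi> (\<lambda>x. ?F' x * cnj (f x))" "integrable \<pi> (\<lambda>x. ?G' x * cnj (f x))"
    using sq.integrable_fst'[OF D.form_integrable[OF D.dominated_kernels(4) f f]]
      sq.integrable_fst'[OF D.form_integrable[OF D.dominated_kernels(5) f f]]
    by (simp_all add: mult.assoc[symmetric])
  have fub: "(\<integral>x. ?F' x * cnj (f x) \<partial>\<pi>) = D.form (\<lambda>z. min (Q n z) (Q n (prod.swap z))) f f"
    "(\<integral>x. ?G' x * cnj (f x) \<partial>\<pi>) = D.form (\<lambda>z. max (Q n z) (Q n (prod.swap z))) f f"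
    using D.form_fubini[OF D.dominated_kernels(4) f f] D.form_fubini[OF D.dominated_kernels(5) f f]
    by simp_all
  have "inner_L2 \<pi> (MH1 \<mu> (kernel_pow \<mu> P n) (kernel_pow \<mu> Ps n) f) f
      = (\<integral>x. (?F x + of_real (?r x) * f x) * cnj (f x) \<partial>\<pi>)"
    unfolding inner_L2_def by (intro Bochner_Integration.integral_cong) (auto simp: MH_eq[OF n] space_pi)
  also have "\<dots> = (\<integral>x. ?F' x * cnj (f x) + of_real (D.rejection x) * f x * cnj (f x) \<partial>\<pi>)"
  proof (rule integral_cong_AE)
    show "AE x in \<pi>. (?F x + of_real (?r x) * f x) * cnj (f x) = ?F' x * cnj (f x) + of_real (D.rejection x) * f x * cnj (f x)"
      using AE_eq by eventually_elim (simp only: distrib_right)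
  qed measurable
  also have "\<dots> = D.form (\<lambda>z. min (Q n z) (Q n (prod.swap z))) f f + of_real R"
    using int R_int by (simp add: fub R_eq)
  finally show "inner_L2 \<pi> (MH1 \<mu> (kernel_pow \<mu> P n) (kernel_pow \<mu> Ps n) f) f
      = D.form (\<lambda>z. min (Q n z) (Q n (prod.swap z))) f f + of_real R" .
  have "inner_L2 \<pi> (MH2 \<mu> (kernel_pow \<mu> P n) (kernel_pow \<mu> Ps n) f) f
      = (\<integral>x. (?G x - of_real (?r x) * f x) * cnj (f x) \<partial>\<pi>)"
    unfolding inner_L2_def by (intro Bochner_Integration.integral_cong) (auto simp: MH_eq[OF n] space_pi)
  also have "\<dots> = (\<integral>x. ?G' x * cnj (f x) - of_real (D.rejection x) * f x * cnj (f x) \<partial>\<pi>)"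
  proof (rule integral_cong_AE)
    show "AE x in \<pi>. (?G x - of_real (?r x) * f x) * cnj (f x) = ?G' x * cnj (f x) - of_real (D.rejection x) * f x * cnj (f x)"
      using AE_eq by eventually_elim (simp only: left_diff_distrib)
  qed measurable
  also have "\<dots> = D.form (\<lambda>z. max (Q n z) (Q n (prod.swap z))) f f - of_real R"
    using int R_int by (simp add: fub R_eq)
  finally show "inner_L2 \<pi> (MH2 \<mu> (kernel_pow \<mu> P n) (kernel_pow \<mu> Ps n) f) f
      = D.form (\<lambda>z. max (Q n z) (Q n (prod.swap z))) f f - of_real R" .
qed

end

section \<open>The Metropolis-Hastings gap controls the semigroup\<close>

context density_chain
begin

definition sqnorm :: "('a \<Rightarrow> complex) \<Rightarrow> real" where
  "sqnorm f = (\<integral>x. (cmod (f x))\<^sup>2 \<partial>\<pi>)"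

lemma sqnorm_nonneg [simp]: "0 \<le> sqnorm f"
  by (simp add: sqnorm_def)

lemma inner_self: "f \<in> L2 \<pi> \<Longrightarrow> inner_L2 \<pi> f f = of_real (sqnorm f)"
proof -
  assume f: "f \<in> L2 \<pi>"
  have "inner_L2 \<pi> f f = (\<integral>x. of_real ((cmod (f x))\<^sup>2) \<partial>\<pi>)"
    by (simp only: inner_L2_def complex_norm_square)
  also have "\<dots> = of_real (sqnorm f)"
    unfolding sqnorm_def by (rule integral_of_real[OF L2_square_integrable[OF f]])
  finally show ?thesis .
qed

lemma sqnorm_scale: "sqnorm (\<lambda>x. c * f x) = (cmod c)\<^sup>2 * sqnorm f"
  by (simp add: sqnorm_def norm_mult power_mult_distrib)

lemma L2_scale: "f \<in> L2 \<pi> \<Longrightarrow> (\<lambda>x. c * f x) \<in> L2 \<pi>"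
  by (auto simp: L2_def norm_mult power_mult_distrib)

lemma L2_0_scale: "f \<in> L2_0 \<pi> \<Longrightarrow> (\<lambda>x. c * f x) \<in> L2_0 \<pi>"
  by (auto simp: L2_0_def L2_scale)

lemma L2_add:
  assumes f: "f \<in> L2 \<pi>" and g: "g \<in> L2 \<pi>"
  shows "(\<lambda>x. f x + g x) \<in> L2 \<pi>"
proof -
  have [measurable]: "f \<in> borel_measurable \<pi>" "g \<in> borel_measurable \<pi>" using f g by (auto dest: L2_measurable)
  have "integrable \<pi> (\<lambda>x. 2 * ((cmod (f x))\<^sup>2 + (cmod (g x))\<^sup>2))"
    using L2_square_integrable[OF f] L2_square_integrable[OF g] by simp
  then have "integrable \<pi> (\<lambda>x. (cmod (f x + g x))\<^sup>2)"
  proof (rule Bochner_Integration.integrable_bound)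
    show "AE x in \<pi>. norm ((cmod (f x + g x))\<^sup>2) \<le> norm (2 * ((cmod (f x))\<^sup>2 + (cmod (g x))\<^sup>2))"
    proof (rule AE_I2)
      fix x
      have "(cmod (f x + g x))\<^sup>2 \<le> (cmod (f x) + cmod (g x))\<^sup>2" by (intro power_mono norm_triangle_ineq) auto
      also have "\<dots> \<le> 2 * ((cmod (f x))\<^sup>2 + (cmod (g x))\<^sup>2)"
        using sum_squares_bound[of "cmod (f x)" "cmod (g x)"] by (simp add: power2_sum)
      finally show "norm ((cmod (f x + g x))\<^sup>2) \<le> norm (2 * ((cmod (f x))\<^sup>2 + (cmod (g x))\<^sup>2))" by simp
    qed
  qed measurable
  then show ?thesis by (simp add: L2_def)
qed

lemma inner_integrable:
  assumes f: "f \<in> L2 \<pi>" and g: "g \<in> L2 \<pi>"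
  shows "integrable \<pi> (\<lambda>x. f x * cnj (g x))"
proof -
  have [measurable]: "f \<in> borel_measurable \<pi>" "g \<in> borel_measurable \<pi>" using f g by (auto dest: L2_measurable)
  have "integrable \<pi> (\<lambda>x. (cmod (f x))\<^sup>2 + (cmod (g x))\<^sup>2)"
    using L2_square_integrable[OF f] L2_square_integrable[OF g] by simp
  then show ?thesis
  proof (rule Bochner_Integration.integrable_bound)
    show "AE x in \<pi>. norm (f x * cnj (g x)) \<le> norm ((cmod (f x))\<^sup>2 + (cmod (g x))\<^sup>2)"
    proof (rule AE_I2)
      fix x
      have "cmod (f x * cnj (g x)) \<le> (cmod (f x))\<^sup>2 + (cmod (g x))\<^sup>2"
        by (rule norm_mult_le_squares)
      then show "norm (f x * cnj (g x)) \<le> norm ((cmod (f x))\<^sup>2 + (cmod (g x))\<^sup>2)" by simp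
    qed
  qed measurable
qed

definition mh1_form :: "nat \<Rightarrow> ('a \<Rightarrow> complex) \<Rightarrow> real" where
  "mh1_form n f = Re (inner_L2 \<pi> (MH1 \<mu> (kernel_pow \<mu> P n) (kernel_pow \<mu> Ps n) f) f)"
definition mh2_form :: "nat \<Rightarrow> ('a \<Rightarrow> complex) \<Rightarrow> real" where
  "mh2_form n f = Re (inner_L2 \<pi> (MH2 \<mu> (kernel_pow \<mu> P n) (kernel_pow \<mu> Ps n) f) f)"

lemma mh_form_scale:
  assumes n: "n \<ge> 1" and f: "f \<in> L2 \<pi>"
  shows "mh1_form n (\<lambda>x. c * f x) = (cmod c)\<^sup>2 * mh1_form n f"
    and "mh2_form n (\<lambda>x. c * f x) = (cmod c)\<^sup>2 * mh2_form n f"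
proof -
  interpret D: doubly_stochastic \<pi> "Q n" by (rule doubly_stochastic_Q[OF n])
  have F: "D.form k (\<lambda>x. c * f x) (\<lambda>x. c * f x) = of_real ((cmod c)\<^sup>2) * D.form k f f" for k
    by (simp only: D.form_scale complex_norm_square mult_ac)
  have R: "(\<integral>x. D.rejection x * (cmod (c * f x))\<^sup>2 \<partial>\<pi>) = (cmod c)\<^sup>2 * (\<integral>x. D.rejection x * (cmod (f x))\<^sup>2 \<partial>\<pi>)"
    by (subst integral_mult_right_zero[symmetric]) (simp add: norm_mult power_mult_distrib mult_ac)
  show "mh1_form n (\<lambda>x. c * f x) = (cmod c)\<^sup>2 * mh1_form n f"
    "mh2_form n (\<lambda>x. c * f x) = (cmod c)\<^sup>2 * mh2_form n f"
    unfolding mh1_form_def mh2_form_def MH_quadratic_forms[OF n L2_scale[OF f]] MH_quadratic_forms[OF n f] F R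
    by (simp_all add: algebra_simps)
qed

text \<open>
  A crude bound. It makes the sets in the definitions of the spectral bounds bounded and covers
  functions of norm zero.
\<close>

lemma mh_form_bound:
  assumes n: "n \<ge> 1" and f: "f \<in> L2 \<pi>"
  shows "\<bar>mh1_form n f\<bar> \<le> 5 * sqnorm f" "\<bar>mh2_form n f\<bar> \<le> 5 * sqnorm f"
proof -
  interpret D: doubly_stochastic \<pi> "Q n" by (rule doubly_stochastic_Q[OF n])
  have F: "\<bar>Re (D.form k f f)\<bar> \<le> 4 * sqnorm f" if "D.dominated k" for k
    using D.form_norm_le[OF that f] abs_Re_le_cmod[of "D.form k f f"] by (simp add: sqnorm_def)
  have R: "(\<integral>x. D.rejection x * (cmod (f x))\<^sup>2 \<partial>\<pi>) \<le> sqnorm f" "0 \<le> (\<integral>x. D.rejection x * (cmod (f x))\<^sup>2 \<partial>\<pi>)"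
    using D.rejection_form_le[OF f] by (simp_all add: sqnorm_def)
  show "\<bar>mh1_form n f\<bar> \<le> 5 * sqnorm f" "\<bar>mh2_form n f\<bar> \<le> 5 * sqnorm f"
    unfolding mh1_form_def mh2_form_def MH_quadratic_forms[OF n f]
    unfolding plus_complex.sel minus_complex.sel Re_complex_of_real
    using F[OF D.dominated_kernels(4)] F[OF D.dominated_kernels(5)] R by linarith+
qed

lemma norm_L2_eq: "f \<in> L2 \<pi> \<Longrightarrow> norm_L2 \<pi> f = sqrt (sqnorm f)"
  by (simp add: norm_L2_def inner_self)

text \<open>
  The infimum and supremum range over functions of norm one; the general case follows by scaling.
\<close>

lemma spectral_bounds:
  assumes n: "n \<ge> 1" and f: "f \<in> L2_0 \<pi>"
  shows "mh1_form n f \<le> Lambda_MH1 \<mu> \<pi> P Ps n * sqnorm f"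
    and "lambda_MH2 \<mu> \<pi> P Ps n * sqnorm f \<le> mh2_form n f"
proof -
  have fL: "f \<in> L2 \<pi>" using f by (simp add: L2_0_def)
  define S1 where "S1 = {mh1_form n g |g. g \<in> L2_0 \<pi> \<and> norm_L2 \<pi> g = 1}"
  define S2 where "S2 = {mh2_form n g |g. g \<in> L2_0 \<pi> \<and> norm_L2 \<pi> g = 1}"
  have L1: "Lambda_MH1 \<mu> \<pi> P Ps n = Sup S1" and L2: "lambda_MH2 \<mu> \<pi> P Ps n = Inf S2"
    by (simp_all add: Lambda_MH1_def spec_sup_def lambda_MH2_def spec_inf_def S1_def S2_def mh1_form_def mh2_form_def)
  have one: "sqnorm g = 1" "g \<in> L2 \<pi>" if "g \<in> L2_0 \<pi>" "norm_L2 \<pi> g = 1" for g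
    using that by (auto simp: L2_0_def norm_L2_eq)
  have bdd: "bdd_above S1" "bdd_below S2"
    unfolding S1_def S2_def
    by (auto intro!: bdd_aboveI[of _ 5] bdd_belowI[of _ "-5"]) (use mh_form_bound[OF n] one in \<open>fastforce simp: abs_le_iff\<close>)+
  have "mh1_form n f \<le> Lambda_MH1 \<mu> \<pi> P Ps n * sqnorm f \<and> lambda_MH2 \<mu> \<pi> P Ps n * sqnorm f \<le> mh2_form n f"
  proof (cases "sqnorm f = 0")
    case True
    then show ?thesis using mh_form_bound[OF n fL] by simp
  next
    case False
    then have pos: "sqnorm f > 0" using sqnorm_nonneg[of f] by linarith
    define c where "c = complex_of_real (1 / sqrt (sqnorm f))"
    define g where "g = (\<lambda>x. c * f x)"
    have g0: "g \<in> L2_0 \<pi>" unfolding g_def by (rule L2_0_scale[OF f])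
    have c2: "(cmod c)\<^sup>2 = 1 / sqnorm f"
      unfolding c_def norm_of_real using pos by (simp add: power_divide)
    have "norm_L2 \<pi> g = 1"
      using g0 pos by (simp add: norm_L2_eq L2_0_def) (simp add: g_def sqnorm_scale c2)
    then have "mh1_form n g \<in> S1" "mh2_form n g \<in> S2" using g0 by (auto simp: S1_def S2_def)
    then have "mh1_form n g \<le> Sup S1" "Inf S2 \<le> mh2_form n g"
      using bdd by (auto intro: cSup_upper cInf_lower)
    then show ?thesis
      using pos unfolding g_def mh_form_scale[OF n fL] c2 L1 L2 by (simp add: field_simps)
  qed
  then show "mh1_form n f \<le> Lambda_MH1 \<mu> \<pi> P Ps n * sqnorm f"
    "lambda_MH2 \<mu> \<pi> P Ps n * sqnorm f \<le> mh2_form n f" by auto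
qed

definition U :: "nat \<Rightarrow> ('a \<Rightarrow> complex) \<Rightarrow> 'a \<Rightarrow> complex" where
  "U n f = (if n = 0 then f else doubly_stochastic.avg \<pi> (Q n) f)"

lemma U_form: "n \<ge> 1 \<Longrightarrow> f \<in> L2 \<pi> \<Longrightarrow> g \<in> L2 \<pi> \<Longrightarrow> inner_L2 \<pi> (U n f) g = doubly_stochastic.form \<pi> (Q n) f g"
  using doubly_stochastic.inner_avg[OF doubly_stochastic_Q] by (simp add: U_def)

lemma U_L2:
  assumes f: "f \<in> L2 \<pi>"
  shows "U n f \<in> L2 \<pi>" "sqnorm (U n f) \<le> sqnorm f" "(\<integral>x. U n f x \<partial>\<pi>) = (\<integral>x. f x \<partial>\<pi>)"
proof -
  have "U n f \<in> L2 \<pi> \<and> sqnorm (U n f) \<le> sqnorm f \<and> (\<integral>x. U n f x \<partial>\<pi>) = (\<integral>x. f x \<partial>\<pi>)"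
  proof (cases "n = 0")
    case False
    then interpret D: doubly_stochastic \<pi> "Q n" by (intro doubly_stochastic_Q) simp
    show ?thesis using False D.avg_L2[OF f] D.avg_contraction[OF f] D.avg_integral[OF f]
      by (simp add: U_def sqnorm_def)
  qed (simp add: U_def f)
  then show "U n f \<in> L2 \<pi>" "sqnorm (U n f) \<le> sqnorm f" "(\<integral>x. U n f x \<partial>\<pi>) = (\<integral>x. f x \<partial>\<pi>)" by auto
qed

lemma inner_cong:
  assumes "AE x in \<pi>. f x = f' x" "f \<in> borel_measurable \<pi>" "f' \<in> borel_measurable \<pi>" "g \<in> borel_measurable \<pi>"
  shows "inner_L2 \<pi> f g = inner_L2 \<pi> f' g"
  unfolding inner_L2_def
proof (rule integral_cong_AE)
  show "AE x in \<pi>. f x * cnj (g x) = f' x * cnj (g x)" using assms(1) by eventually_elim simp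
qed (use assms in measurable)

lemma U_compose:
  assumes f: "f \<in> L2 \<pi>" and g: "g \<in> L2 \<pi>"
  shows "inner_L2 \<pi> (U m (U n f)) g = inner_L2 \<pi> (U (m + n) f) g"
proof (cases "m = 0 \<or> n = 0")
  case False
  then have m: "m \<ge> 1" and n: "n \<ge> 1" by auto
  have "AE x in \<pi>. U m (U n f) x = U (m + n) f x"
    using avg_compose[OF doubly_stochastic_Q[OF m] doubly_stochastic_Q[OF n] doubly_stochastic_Q[of "m + n"] Q_compose[OF m n] f] m n
    by (simp add: U_def)
  then show ?thesis using U_L2(1)[OF U_L2(1)[OF f]] U_L2(1)[OF f] g
    by (intro inner_cong L2_measurable)
qed (auto simp: U_def)

sublocale sg: weak_contraction_semigroup "L2_0 \<pi>" "\<lambda>c f x. c * f x" "inner_L2 \<pi>" U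
proof -
  have L: "f \<in> L2 \<pi>" if "f \<in> L2_0 \<pi>" for f using that by (simp add: L2_0_def)
  have add: "f + g \<in> L2_0 \<pi>" if "f \<in> L2_0 \<pi>" "g \<in> L2_0 \<pi>" for f g
    using that L2_add[OF L[OF that(1)] L[OF that(2)]] L2_integrable
    by (simp add: L2_0_def plus_fun_def)
  interpret semi_inner_product "L2_0 \<pi>" "\<lambda>c f x. c * f x" "inner_L2 \<pi>"
  proof
    show "0 \<in> L2_0 \<pi>" by (simp add: L2_0_def L2_def zero_fun_def)
    show "(\<lambda>x. c * f x) \<in> L2_0 \<pi>" if "f \<in> L2_0 \<pi>" for f c using that by (rule L2_0_scale)
    show "(\<lambda>x. - 1 * f x) = - f" for f :: "'a \<Rightarrow> complex" by (simp add: fun_eq_iff)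
    show "inner_L2 \<pi> (f + g) h = inner_L2 \<pi> f h + inner_L2 \<pi> g h"
      if "f \<in> L2_0 \<pi>" "g \<in> L2_0 \<pi>" "h \<in> L2_0 \<pi>" for f g h
      using that by (simp add: inner_L2_def distrib_right inner_integrable L)
    show "inner_L2 \<pi> (\<lambda>x. c * f x) g = c * inner_L2 \<pi> f g" for f g c
      by (simp add: inner_L2_def mult.assoc)
    show "inner_L2 \<pi> g f = cnj (inner_L2 \<pi> f g)" for f g
      by (simp add: inner_L2_def mult.commute flip: Bochner_Integration.integral_cnj)
    show "0 \<le> Re (inner_L2 \<pi> f f)" if "f \<in> L2_0 \<pi>" for f
      using that by (simp add: inner_self L)
  qed (use add in auto)
  have nrm: "(nrm f)\<^sup>2 = sqnorm f" "0 \<le> nrm f" if "f \<in> L2_0 \<pi>" for f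
    using that by (simp_all add: nrm_sq inner_self L)
  show "weak_contraction_semigroup (L2_0 \<pi>) (\<lambda>c f x. c * f x) (inner_L2 \<pi>) U"
  proof
    show Uc: "U n f \<in> L2_0 \<pi>" if "f \<in> L2_0 \<pi>" for n f
      using that U_L2[OF L[OF that], of n] by (simp add: L2_0_def)
    show "inner_L2 \<pi> (U n (f + g)) h = inner_L2 \<pi> (U n f) h + inner_L2 \<pi> (U n g) h"
      if "f \<in> L2_0 \<pi>" "g \<in> L2_0 \<pi>" "h \<in> L2_0 \<pi>" for f g h n
    proof (cases "n = 0")
      case False
      then interpret D: doubly_stochastic \<pi> "Q n" by (intro doubly_stochastic_Q) simp
      show ?thesis using False that D.form_add_left[OF D.dominated_kernels(1) L[OF that(1)] L[OF that(2)] L[OF that(3)]]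
        by (simp add: U_form L L2_add plus_fun_def)
    qed (use that ip_add_left in \<open>simp add: U_def\<close>)
    show "inner_L2 \<pi> (U n (\<lambda>x. c * f x)) h = c * inner_L2 \<pi> (U n f) h"
      if "f \<in> L2_0 \<pi>" "h \<in> L2_0 \<pi>" for f h c n
    proof (cases "n = 0")
      case False
      then interpret D: doubly_stochastic \<pi> "Q n" by (intro doubly_stochastic_Q) simp
      show ?thesis using False that by (simp add: U_form L L2_scale D.form_scale)
    qed (use that ip_sc_left in \<open>simp add: U_def\<close>)
    show "inner_L2 \<pi> (U m (U n f)) h = inner_L2 \<pi> (U (m + n) f) h"
      if "f \<in> L2_0 \<pi>" "h \<in> L2_0 \<pi>" for f h m n using U_compose L that by blast
    show "inner_L2 \<pi> (U 0 f) h = inner_L2 \<pi> f h" for f h by (simp add: U_def)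
    show "nrm (U n f) \<le> nrm f" if "f \<in> L2_0 \<pi>" for n f
    proof (rule power2_le_imp_le)
      show "(nrm (U n f))\<^sup>2 \<le> (nrm f)\<^sup>2" using that U_L2(2)[OF L[OF that]] by (simp add: nrm Uc)
    qed (use nrm that in auto)
  qed
qed

lemma nrm_sqnorm: "f \<in> L2_0 \<pi> \<Longrightarrow> (sg.nrm f)\<^sup>2 = sqnorm f"
  by (simp add: sg.nrm_sq inner_self L2_0_def)

context
  assumes gap_nonzero: "mh_gap \<mu> \<pi> P Ps \<noteq> 0" and Cc_finite: "finite (mh_Cc \<mu> \<pi> P Ps)"
begin

abbreviation "C \<equiv> mh_C \<mu> \<pi> P Ps"
abbreviation "\<beta> \<equiv> mh_beta \<mu> \<pi> P Ps"

lemma C_nonempty: "C \<noteq> {}"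
  using Cc_finite infinite_Ici[of "1::nat"] by (auto simp: mh_Cc_def)

lemma beta_bounds: "0 \<le> \<beta>" "\<beta> < 1"
  and root_le_beta: "\<And>n. n \<in> C \<Longrightarrow> root n \<bar>lambda_MH2 \<mu> \<pi> P Ps n\<bar> \<le> \<beta>"
    "\<And>n. n \<in> C \<Longrightarrow> 0 \<le> Lambda_MH1 \<mu> \<pi> P Ps n \<Longrightarrow> root n (Lambda_MH1 \<mu> \<pi> P Ps n) \<le> \<beta>"
proof -
  define S where "S = {root n \<bar>lambda_MH2 \<mu> \<pi> P Ps n\<bar> | n. n \<in> C} \<union>
                {root n (Lambda_MH1 \<mu> \<pi> P Ps n) | n. n \<in> C \<and> Lambda_MH1 \<mu> \<pi> P Ps n \<ge> 0}"
  have b: "\<beta> = Sup S" using C_nonempty by (simp add: mh_beta_def S_def)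
  have le1: "x \<le> 1" if "x \<in> S" for x
    using that by (auto simp: S_def mh_C_def simp: real_root_le_1_iff)
  have bdd: "bdd_above S" using le1 by (rule bdd_aboveI)
  show 1: "root n \<bar>lambda_MH2 \<mu> \<pi> P Ps n\<bar> \<le> \<beta>" if "n \<in> C" for n
    unfolding b using that by (intro cSup_upper bdd) (auto simp: S_def)
  show "root n (Lambda_MH1 \<mu> \<pi> P Ps n) \<le> \<beta>" if "n \<in> C" "0 \<le> Lambda_MH1 \<mu> \<pi> P Ps n" for n
    unfolding b using that by (intro cSup_upper bdd) (auto simp: S_def)
  obtain n where n: "n \<in> C" using C_nonempty by auto
  have "0 \<le> root n \<bar>lambda_MH2 \<mu> \<pi> P Ps n\<bar>" by (simp add: real_root_ge_zero)
  then show "0 \<le> \<beta>" using 1[OF n] by linarith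
  have "S \<noteq> {}" using n by (auto simp: S_def)
  then have "\<beta> \<le> 1" unfolding b using le1 by (rule cSup_least)
  then show "\<beta> < 1" using gap_nonzero by (simp add: mh_gap_def)
qed

text \<open>
  Both spectral quantities at a time \<open>n\<close> in \<open>C\<close> are controlled by
  \<open>\<beta> ^ n\<close>; a negative \<open>\<Lambda>\<close>, which the supremum defining
  \<open>\<beta>\<close> omits, is trivially below it.
\<close>

lemma num_radius: "n \<in> C \<Longrightarrow> sg.num_radius_le n (\<beta> ^ n)"
  unfolding sg.num_radius_le_def
proof
  fix f assume nC: "n \<in> C" and f: "f \<in> L2_0 \<pi>"
  have n: "n \<ge> 1" using nC by (simp add: mh_C_def)
  interpret D: doubly_stochastic \<pi> "Q n" by (rule doubly_stochastic_Q[OF n])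
  have lam: "\<bar>lambda_MH2 \<mu> \<pi> P Ps n\<bar> \<le> \<beta> ^ n"
  proof -
    have "\<bar>lambda_MH2 \<mu> \<pi> P Ps n\<bar> = (root n \<bar>lambda_MH2 \<mu> \<pi> P Ps n\<bar>) ^ n"
      using n by (simp add: real_root_pow_pos2)
    also have "\<dots> \<le> \<beta> ^ n" using root_le_beta(1)[OF nC] by (intro power_mono) (auto simp: real_root_ge_zero)
    finally show ?thesis .
  qed
  have Lam: "Lambda_MH1 \<mu> \<pi> P Ps n \<le> \<beta> ^ n"
  proof (cases "0 \<le> Lambda_MH1 \<mu> \<pi> P Ps n")
    case True
    have "Lambda_MH1 \<mu> \<pi> P Ps n = (root n (Lambda_MH1 \<mu> \<pi> P Ps n)) ^ n"
      using n True by (simp add: real_root_pow_pos2)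
    also have "\<dots> \<le> \<beta> ^ n" using root_le_beta(2)[OF nC True] True by (intro power_mono) (auto simp: real_root_ge_zero)
    finally show ?thesis .
  next
    case False
    then show ?thesis using zero_le_power[OF beta_bounds(1), of n] by linarith
  qed
  have "cmod (D.form (Q n) f f) \<le> \<beta> ^ n * (\<integral>x. (cmod (f x))\<^sup>2 \<partial>\<pi>)"
  proof (rule D.form_bound)
    show "0 \<le> \<beta> ^ n" using beta_bounds by simp
    show "Re (D.form (\<lambda>p. min (Q n p) (Q n (prod.swap p))) g g) + (\<integral>x. D.rejection x * (cmod (g x))\<^sup>2 \<partial>\<pi>)
        \<le> \<beta> ^ n * (\<integral>x. (cmod (g x))\<^sup>2 \<partial>\<pi>)" if g: "g \<in> L2_0 \<pi>" for g
    proof -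
      have "mh1_form n g \<le> Lambda_MH1 \<mu> \<pi> P Ps n * sqnorm g" by (rule spectral_bounds(1)[OF n g])
      also have "\<dots> \<le> \<beta> ^ n * sqnorm g" using Lam by (intro mult_right_mono) auto
      finally show ?thesis
        using g by (simp add: mh1_form_def MH_quadratic_forms(1)[OF n] L2_0_def sqnorm_def)
    qed
    show "- (\<beta> ^ n * (\<integral>x. (cmod (g x))\<^sup>2 \<partial>\<pi>))
        \<le> Re (D.form (\<lambda>p. max (Q n p) (Q n (prod.swap p))) g g) - (\<integral>x. D.rejection x * (cmod (g x))\<^sup>2 \<partial>\<pi>)"
      if g: "g \<in> L2_0 \<pi>" for g
    proof -
      have "- (\<beta> ^ n) * sqnorm g \<le> lambda_MH2 \<mu> \<pi> P Ps n * sqnorm g" using lam by (intro mult_right_mono) auto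
      also have "\<dots> \<le> mh2_form n g" by (rule spectral_bounds(2)[OF n g])
      finally show ?thesis
        using g by (simp add: mh2_form_def MH_quadratic_forms(2)[OF n] L2_0_def sqnorm_def)
    qed
  qed fact
  then show "cmod (inner_L2 \<pi> (U n f) f) \<le> \<beta> ^ n * (sg.nrm f)\<^sup>2"
    using f n by (simp add: U_form nrm_sqnorm) (simp add: U_form L2_0_def sqnorm_def)
qed

end
end

section \<open>Covariances along the chain\<close>

lemma (in prob_space) second_moment_sum:
  fixes Y :: "nat \<Rightarrow> 'a \<Rightarrow> complex"
  assumes int: "\<And>i j. i \<in> I \<Longrightarrow> j \<in> I \<Longrightarrow> integrable M (\<lambda>w. Y i w * cnj (Y j w))" and I: "finite I"
  shows "integrable M (\<lambda>w. (cmod (\<Sum>i\<in>I. Y i w))\<^sup>2)"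
    and "(\<integral>w. (cmod (\<Sum>i\<in>I. Y i w))\<^sup>2 \<partial>M) = (\<Sum>i\<in>I. \<Sum>j\<in>I. Re (\<integral>w. Y i w * cnj (Y j w) \<partial>M))"
proof -
  have eq: "(cmod (\<Sum>i\<in>I. Y i w))\<^sup>2 = (\<Sum>i\<in>I. \<Sum>j\<in>I. Re (Y i w * cnj (Y j w)))" for w
  proof -
    have "complex_of_real ((cmod (\<Sum>i\<in>I. Y i w))\<^sup>2) = (\<Sum>i\<in>I. \<Sum>j\<in>I. Y i w * cnj (Y j w))"
      unfolding complex_norm_square cnj_sum sum_product by simp
    then have "Re (complex_of_real ((cmod (\<Sum>i\<in>I. Y i w))\<^sup>2)) = Re (\<Sum>i\<in>I. \<Sum>j\<in>I. Y i w * cnj (Y j w))"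
      by (rule arg_cong)
    then show ?thesis by (simp only: Re_complex_of_real Re_sum)
  qed
  show "integrable M (\<lambda>w. (cmod (\<Sum>i\<in>I. Y i w))\<^sup>2)"
    unfolding eq by (intro Bochner_Integration.integrable_sum integrable_Re int)
  show "(\<integral>w. (cmod (\<Sum>i\<in>I. Y i w))\<^sup>2 \<partial>M) = (\<Sum>i\<in>I. \<Sum>j\<in>I. Re (\<integral>w. Y i w * cnj (Y j w) \<partial>M))"
    unfolding eq
    by (subst Bochner_Integration.integral_sum, (intro Bochner_Integration.integrable_sum integrable_Re int; assumption),
        intro sum.cong refl, subst Bochner_Integration.integral_sum, (intro integrable_Re int; assumption),
        intro sum.cong refl integral_Re int)
qed

lemma sum_square_upper_triangle:
  fixes G :: "nat \<Rightarrow> nat \<Rightarrow> real"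
  assumes sym: "\<And>i j. G i j = G j i"
  shows "(\<Sum>i<n. \<Sum>j<n. G i j) = (\<Sum>i<n. G i i) + 2 * (\<Sum>i<n. \<Sum>j\<in>{i<..<n}. G j i)"
proof (induction n)
  case (Suc n)
  have "{n<..<Suc n} = {}" by auto
  then have "(\<Sum>i<Suc n. \<Sum>j\<in>{i<..<Suc n}. G j i) = (\<Sum>i<n. \<Sum>j\<in>{i<..<Suc n}. G j i)" by simp
  also have "\<dots> = (\<Sum>i<n. (\<Sum>j\<in>{i<..<n}. G j i) + G n i)"
  proof (rule sum.cong[OF refl])
    fix i assume "i \<in> {..<n}"
    then have *: "{i<..<Suc n} = insert n {i<..<n}" by auto
    show "(\<Sum>j\<in>{i<..<Suc n}. G j i) = (\<Sum>j\<in>{i<..<n}. G j i) + G n i" unfolding * by simp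
  qed
  finally have "(\<Sum>i<Suc n. \<Sum>j\<in>{i<..<Suc n}. G j i) = (\<Sum>i<n. \<Sum>j\<in>{i<..<n}. G j i) + (\<Sum>i<n. G n i)"
    by (simp add: sum.distrib)
  moreover have "(\<Sum>i<n. G i n) = (\<Sum>i<n. G n i)" by (simp add: sym)
  ultimately show ?case using Suc by (simp add: sum.distrib)
qed simp

lemma sum_lag_double:
  fixes r :: "nat \<Rightarrow> real"
  shows "(\<Sum>t<n. \<Sum>s\<in>{t<..<n}. r (s - t)) = (\<Sum>l=1..n. \<Sum>k\<in>{1..<l}. r k)"
proof (induction n)
  case (Suc n)
  have "{n<..<Suc n} = {}" by auto
  then have "(\<Sum>t<Suc n. \<Sum>s\<in>{t<..<Suc n}. r (s - t)) = (\<Sum>t<n. \<Sum>s\<in>{t<..<Suc n}. r (s - t))" by simp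
  also have "\<dots> = (\<Sum>t<n. (\<Sum>s\<in>{t<..<n}. r (s - t)) + r (n - t))"
  proof (rule sum.cong[OF refl])
    fix t assume "t \<in> {..<n}"
    then have *: "{t<..<Suc n} = insert n {t<..<n}" by auto
    show "(\<Sum>s\<in>{t<..<Suc n}. r (s - t)) = (\<Sum>s\<in>{t<..<n}. r (s - t)) + r (n - t)" unfolding * by simp
  qed
  also have "\<dots> = (\<Sum>l=1..n. \<Sum>k\<in>{1..<l}. r k) + (\<Sum>t<n. r (n - t))"
    by (simp only: sum.distrib Suc)
  also have "(\<Sum>t<n. r (n - t)) = (\<Sum>k\<in>{1..<Suc n}. r k)"
    by (rule sum.reindex_bij_witness[of _ "\<lambda>k. n - k" "\<lambda>t. n - t"]) auto
  finally show ?case by simp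
qed simp

locale density_chain_process = density_chain \<mu> \<pi> P Ps p ps dpi
  for \<mu> \<pi> :: "'a measure" and P Ps p ps dpi +
  fixes W :: "'w measure" and X :: "nat \<Rightarrow> 'w \<Rightarrow> 'a"
  assumes pi_stationary: "stationary \<pi> P"
    and chain: "markov_chain W \<mu> P X"
    and initial: "distr W \<mu> (X 0) = \<pi>"
begin

sublocale W: prob_space W
  using chain by (simp add: markov_chain_def)

lemma X_measurable [measurable]: "X n \<in> W \<rightarrow>\<^sub>M \<mu>"
  using chain by (simp add: markov_chain_def)

lemma P_sub: "P \<in> \<mu> \<rightarrow>\<^sub>M subprob_algebra \<mu>"
  using kernel_P by (rule measurable_prob_algebraD)

lemma P_pow_sub: "kernel_pow \<mu> P n \<in> \<mu> \<rightarrow>\<^sub>M subprob_algebra \<mu>"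
  using kernel_pow_measurable[OF kernel_P] by (rule measurable_prob_algebraD)

lemma space_mu_nonempty: "space \<mu> \<noteq> {}"
  using not_empty by (simp add: space_pi)

lemma history_event:
  assumes A: "A \<in> sets \<mu>" and i: "i \<le> n"
  shows "X i -` A \<inter> space W \<in> sets (history W \<mu> X n)"
proof -
  let ?\<Omega> = "\<Pi>\<^sub>M i\<in>{..n}. \<mu>"
  have "(\<lambda>\<omega>. \<omega> i) -` A \<inter> space ?\<Omega> \<in> sets ?\<Omega>"
    using A i by (intro measurable_sets[OF measurable_component_singleton]) auto
  from in_vimage_algebra[OF this, of "\<lambda>w. \<lambda>i\<in>{..n}. X i w" "space W"]
  have "(\<lambda>w. \<lambda>i\<in>{..n}. X i w) -` ((\<lambda>\<omega>. \<omega> i) -` A \<inter> space ?\<Omega>) \<inter> space W \<in> sets (history W \<mu> X n)"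
    by (simp add: history_def)
  also have "(\<lambda>w. \<lambda>i\<in>{..n}. X i w) -` ((\<lambda>\<omega>. \<omega> i) -` A \<inter> space ?\<Omega>) \<inter> space W = X i -` A \<inter> space W"
    using i measurable_space[OF X_measurable] by (auto simp: space_PiM)
  finally show ?thesis .
qed

lemma history_subalgebra: "subalgebra W (history W \<mu> X n)"
  unfolding subalgebra_def history_def
proof
  have [measurable]: "(\<lambda>w. \<lambda>i\<in>{..n}. X i w) \<in> W \<rightarrow>\<^sub>M (\<Pi>\<^sub>M i\<in>{..n}. \<mu>)" by measurable
  show "sets (vimage_algebra (space W) (\<lambda>w. \<lambda>i\<in>{..n}. X i w) (\<Pi>\<^sub>M i\<in>{..n}. \<mu>)) \<subseteq> sets W"
    by (rule sets_image_in_sets) auto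
qed simp

text \<open>
  The defining property of the conditional expectation, integrated over an event of the past.
\<close>

lemma one_step:
  assumes S: "S \<in> sets (history W \<mu> X n)" and B: "B \<in> sets \<mu>"
  shows "(\<integral>\<^sup>+w. indicator S w * indicator B (X (Suc n) w) \<partial>W)
       = (\<integral>\<^sup>+w. indicator S w * emeasure (P (X n w)) B \<partial>W)"
proof -
  interpret F: finite_measure_subalgebra W "history W \<mu> X n"
    by unfold_locales (rule history_subalgebra)
  have SW [measurable]: "S \<in> sets W" using S history_subalgebra by (auto simp: subalgebra_def)
  note [measurable] = B
  have em [measurable]: "(\<lambda>x. measure (P x) B) \<in> borel_measurable \<mu>"
    using measurable_measure_prob_algebra[OF B] kernel_P measurable_compose by blast
  have Pp: "prob_space (P (X n w))" if "w \<in> space W" for w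
    using measurable_space[OF kernel_P measurable_space[OF X_measurable that]] by (simp add: space_prob_algebra)
  have int1: "integrable W (\<lambda>w. indicator B (X (Suc n) w) :: real)"
    by (intro W.integrable_const_bound[where B=1]) (auto simp: indicator_def)
  have int2: "integrable W (\<lambda>w. indicator S w * indicator B (X (Suc n) w) :: real)"
    by (intro W.integrable_const_bound[where B=1]) (auto simp: indicator_def)
  have int3: "integrable W (\<lambda>w. indicator S w * measure (P (X n w)) B)"
    by (intro W.integrable_const_bound[where B=1])
       (auto simp: indicator_def prob_space.prob_le_1[OF Pp] intro!: AE_I2)
  have "(\<integral>w. indicator S w * indicator B (X (Suc n) w) \<partial>W)
      = (\<integral>w. indicator S w * real_cond_exp W (history W \<mu> X n) (\<lambda>w. indicator B (X (Suc n) w)) w \<partial>W)"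
    using F.real_cond_exp_intA[OF int1 S] by (simp add: set_lebesgue_integral_def)
  also have "\<dots> = (\<integral>w. indicator S w * measure (P (X n w)) B \<partial>W)"
  proof (rule integral_cong_AE)
    have "AE w in W. real_cond_exp W (history W \<mu> X n) (\<lambda>w. indicator B (X (Suc n) w)) w = measure (P (X n w)) B"
      using chain B by (simp add: markov_chain_def)
    then show "AE w in W. indicator S w * real_cond_exp W (history W \<mu> X n) (\<lambda>w. indicator B (X (Suc n) w)) w
        = indicator S w * measure (P (X n w)) B"
      by eventually_elim simp
  qed measurable
  finally have "ennreal (\<integral>w. indicator S w * indicator B (X (Suc n) w) \<partial>W)
      = ennreal (\<integral>w. indicator S w * measure (P (X n w)) B \<partial>W)" by simp
  then have "(\<integral>\<^sup>+w. ennreal (indicator S w * indicator B (X (Suc n) w)) \<partial>W)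
      = (\<integral>\<^sup>+w. ennreal (indicator S w * measure (P (X n w)) B) \<partial>W)"
    using int2 int3 by (subst (1 2) nn_integral_eq_integral) auto
  also have "(\<integral>\<^sup>+w. ennreal (indicator S w * measure (P (X n w)) B) \<partial>W)
      = (\<integral>\<^sup>+w. indicator S w * emeasure (P (X n w)) B \<partial>W)"
  proof (intro nn_integral_cong)
    fix w assume "w \<in> space W"
    then have "finite_measure (P (X n w))" using Pp prob_space.finite_measure by blast
    then show "ennreal (indicator S w * measure (P (X n w)) B) = indicator S w * emeasure (P (X n w)) B"
      by (simp add: finite_measure.emeasure_eq_measure indicator_def)
  qed
  also have "(\<integral>\<^sup>+w. ennreal (indicator S w * indicator B (X (Suc n) w)) \<partial>W)
      = (\<integral>\<^sup>+w. indicator S w * indicator B (X (Suc n) w) \<partial>W)"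
    by (intro nn_integral_cong) (simp add: indicator_def)
  finally show ?thesis .
qed

text \<open>
  The law of \<open>X n\<close> restricted to an event, without normalisation. Taking for the
  event that \<open>X i\<close> lies in \<open>A\<close> turns joint laws of two times into
  iterates of the kernel.
\<close>

definition law_on :: "'w set \<Rightarrow> nat \<Rightarrow> 'a measure" where
  "law_on S n = distr (density W (indicator S)) \<mu> (X n)"

lemma sets_law_on [simp]: "sets (law_on S n) = sets \<mu>"
  by (simp add: law_on_def)

lemma space_law_on [simp]: "space (law_on S n) = space \<mu>"
  by (simp add: law_on_def)

lemma nn_integral_law_on:
  assumes [measurable]: "S \<in> sets W" "h \<in> borel_measurable \<mu>"
  shows "(\<integral>\<^sup>+x. h x \<partial>law_on S n) = (\<integral>\<^sup>+w. indicator S w * h (X n w) \<partial>W)"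
  by (simp add: law_on_def nn_integral_distr nn_integral_density)

lemma law_on_Suc:
  assumes S: "S \<in> sets (history W \<mu> X n)"
  shows "law_on S (Suc n) = law_on S n \<bind> P"
proof (rule measure_eqI)
  have SW [measurable]: "S \<in> sets W" using S history_subalgebra by (auto simp: subalgebra_def)
  have Pm: "P \<in> law_on S n \<rightarrow>\<^sub>M subprob_algebra \<mu>"
    using P_sub by (simp add: measurable_cong_sets[OF sets_law_on refl])
  show "sets (law_on S (Suc n)) = sets (law_on S n \<bind> P)"
  proof -
    have "sets (law_on S n \<bind> P) = sets \<mu>"
    proof (rule sets_bind)
      show "sets (P x) = sets \<mu>" if "x \<in> space (law_on S n)" for x by (rule sets_kernel[OF Pm that])
    qed (use space_mu_nonempty in simp)
    then show ?thesis by (simp only: sets_law_on)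
  qed
  fix B assume "B \<in> sets (law_on S (Suc n))"
  then have B [measurable]: "B \<in> sets \<mu>" by simp
  have em: "(\<lambda>x. emeasure (P x) B) \<in> borel_measurable \<mu>"
    using measurable_emeasure_kernel[OF P_sub B] .
  have "emeasure (law_on S (Suc n)) B = (\<integral>\<^sup>+x. indicator B x \<partial>law_on S (Suc n))" by simp
  also have "\<dots> = (\<integral>\<^sup>+w. indicator S w * indicator B (X (Suc n) w) \<partial>W)"
    by (rule nn_integral_law_on) auto
  also have "\<dots> = (\<integral>\<^sup>+w. indicator S w * emeasure (P (X n w)) B \<partial>W)" by (rule one_step[OF S B])
  also have "\<dots> = (\<integral>\<^sup>+x. emeasure (P x) B \<partial>law_on S n)"
    using em by (intro nn_integral_law_on[symmetric]) auto
  also have "\<dots> = emeasure (law_on S n \<bind> P) B"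
    by (rule emeasure_bind[symmetric, OF _ Pm B]) (simp add: space_mu_nonempty)
  finally show "emeasure (law_on S (Suc n)) B = emeasure (law_on S n \<bind> P) B" .
qed

lemma law_on_add:
  assumes A: "A \<in> sets \<mu>"
  shows "law_on (X i -` A \<inter> space W) (i + k) = law_on (X i -` A \<inter> space W) i \<bind> kernel_pow \<mu> P k"
    (is "law_on ?S _ = _")
proof (induction k)
  case 0
  have "return \<mu> = return (law_on ?S i)" by (intro ext return_cong) simp
  then show ?case by (simp add: bind_return''[OF refl])
next
  case (Suc k)
  have m: "kernel_pow \<mu> P k \<in> law_on ?S i \<rightarrow>\<^sub>M subprob_algebra \<mu>"
    using P_pow_sub by (simp add: measurable_cong_sets[OF sets_law_on refl])
  have "law_on ?S (i + Suc k) = law_on ?S (i + k) \<bind> P"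
    using law_on_Suc[OF history_event[OF A, of i "i + k"]] by simp
  also have "\<dots> = law_on ?S i \<bind> (\<lambda>x. kernel_pow \<mu> P k x \<bind> P)"
    unfolding Suc by (rule bind_assoc[OF m P_sub])
  also have "\<dots> = law_on ?S i \<bind> kernel_pow \<mu> P (Suc k)"
    by (rule bind_cong[OF refl]) (simp add: kernel_pow_Suc_right[OF kernel_P] del: kernel_pow.simps)
  finally show ?case .
qed

lemma law_X: "distr W \<mu> (X n) = \<pi>"
proof -
  have full: "law_on (space W) n = distr W \<mu> (X n)" for n
  proof -
    have "density W (indicator (space W)) = density W (\<lambda>_. 1)"
      by (rule density_cong) auto
    then show ?thesis by (simp add: law_on_def density_1)
  qed
  show ?thesis
  proof (induction n)
    case (Suc n)
    have "space W \<in> sets (history W \<mu> X n)"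
      using sets.top[of "history W \<mu> X n"] by (simp add: history_def)
    from law_on_Suc[OF this] show ?case using Suc pi_stationary by (simp add: full stationary_def)
  qed (rule initial)
qed

text \<open>
  For \<open>k \<ge> 1\<close> the joint law of the chain at distance \<open>k\<close> has a
  density on the product space. It suffices to compare rectangles, where the law of \<open>X (i +
  k)\<close> on the event that \<open>X i\<close> lies in \<open>A\<close> is the restricted
  stationary law moved by \<open>P\<^sup>k\<close>.
\<close>

lemma pair_law:
  assumes k: "k \<ge> 1"
  shows "distr W (\<pi> \<Otimes>\<^sub>M \<pi>) (\<lambda>w. (X i w, X (i + k) w)) = density (\<pi> \<Otimes>\<^sub>M \<pi>) (Q k)"
proof -
  have Xm [measurable]: "X n \<in> W \<rightarrow>\<^sub>M \<pi>" for n
    using X_measurable by (simp add: measurable_cong_sets[OF refl sets_pi])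
  have pm: "(\<lambda>w. (X i w, X (i + k) w)) \<in> W \<rightarrow>\<^sub>M \<pi> \<Otimes>\<^sub>M \<pi>" by measurable
  show ?thesis
  proof (rule finite_pair_measure_eqI[where ?M1.0 = \<pi> and ?M2.0 = \<pi>])
    show "finite_measure (distr W (\<pi> \<Otimes>\<^sub>M \<pi>) (\<lambda>w. (X i w, X (i + k) w)))"
      by (rule W.finite_measure_distr[OF pm])
    fix A B assume AB [measurable]: "A \<in> sets \<pi>" "B \<in> sets \<pi>"
    then have AB' [measurable]: "A \<in> sets \<mu>" "B \<in> sets \<mu>" by (simp_all add: sets_pi)
    define S where "S = X i -` A \<inter> space W"
    have S [measurable]: "S \<in> sets W" unfolding S_def by measurable
    have em: "(\<lambda>x. emeasure (kernel_pow \<mu> P k x) B) \<in> borel_measurable \<mu>"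
      using measurable_emeasure_kernel[OF P_pow_sub AB'(2)] .
    then have [measurable]: "(\<lambda>x. emeasure (kernel_pow \<mu> P k x) B) \<in> borel_measurable \<pi>"
      by (simp add: measurable_pi)
    have "emeasure (distr W (\<pi> \<Otimes>\<^sub>M \<pi>) (\<lambda>w. (X i w, X (i + k) w))) (A \<times> B)
        = emeasure W ((\<lambda>w. (X i w, X (i + k) w)) -` (A \<times> B) \<inter> space W)"
      by (rule emeasure_distr[OF pm]) measurable
    also have "\<dots> = (\<integral>\<^sup>+w. indicator S w * indicator B (X (i + k) w) \<partial>W)"
    proof -
      have "(\<lambda>w. (X i w, X (i + k) w)) -` (A \<times> B) \<inter> space W \<in> sets W" by measurable
      then have "emeasure W ((\<lambda>w. (X i w, X (i + k) w)) -` (A \<times> B) \<inter> space W)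
        = (\<integral>\<^sup>+w. indicator ((\<lambda>w. (X i w, X (i + k) w)) -` (A \<times> B) \<inter> space W) w \<partial>W)"
        by simp
      also have "\<dots> = (\<integral>\<^sup>+w. indicator S w * indicator B (X (i + k) w) \<partial>W)"
        by (intro nn_integral_cong) (auto simp: S_def indicator_def)
      finally show ?thesis .
    qed
    also have "\<dots> = (\<integral>\<^sup>+x. indicator B x \<partial>law_on S (i + k))"
      by (rule nn_integral_law_on[symmetric]) auto
    also have "\<dots> = emeasure (law_on S (i + k)) B" by simp
    also have "\<dots> = emeasure (law_on S i \<bind> kernel_pow \<mu> P k) B"
      unfolding S_def law_on_add[OF AB'(1)] ..
    also have "\<dots> = (\<integral>\<^sup>+x. emeasure (kernel_pow \<mu> P k x) B \<partial>law_on S i)"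
      using space_mu_nonempty P_pow_sub
      by (intro emeasure_bind AB') (auto simp: measurable_cong_sets[OF sets_law_on refl])
    also have "\<dots> = (\<integral>\<^sup>+w. indicator S w * emeasure (kernel_pow \<mu> P k (X i w)) B \<partial>W)"
      by (rule nn_integral_law_on[OF S em])
    also have "\<dots> = (\<integral>\<^sup>+w. indicator A (X i w) * emeasure (kernel_pow \<mu> P k (X i w)) B \<partial>W)"
      by (intro nn_integral_cong) (simp add: S_def indicator_def)
    also have "\<dots> = (\<integral>\<^sup>+x. indicator A x * emeasure (kernel_pow \<mu> P k x) B \<partial>distr W \<mu> (X i))"
      using em by (subst nn_integral_distr) auto
    also have "\<dots> = (\<integral>\<^sup>+x. indicator A x * emeasure (kernel_pow \<mu> P k x) B \<partial>\<pi>)"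
      unfolding law_X ..
    also have "\<dots> = (\<integral>\<^sup>+x. \<integral>\<^sup>+y. ennreal (Q k (x, y)) * indicator (A \<times> B) (x, y) \<partial>\<pi> \<partial>\<pi>)"
    proof (intro nn_integral_cong)
      fix x assume "x \<in> space \<pi>"
      then have x: "x \<in> space \<mu>" and [measurable]: "x \<in> space \<pi>" by (simp_all add: space_pi)
      have "emeasure (kernel_pow \<mu> P k x) B = (\<integral>\<^sup>+y. q k x y * indicator B y \<partial>\<pi>)"
        unfolding kernel_pow_P[OF k x] by (rule emeasure_density) measurable
      also have "\<dots> = (\<integral>\<^sup>+y. ennreal (Q k (x, y)) * indicator B y \<partial>\<pi>)"
        by (rule nn_integral_cong_AE) (use Q_eq[OF k x] in eventually_elim, simp)
      finally have "indicator A x * emeasure (kernel_pow \<mu> P k x) B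
          = (\<integral>\<^sup>+y. indicator A x * (ennreal (Q k (x, y)) * indicator B y) \<partial>\<pi>)"
        by (simp add: nn_integral_cmult)
      also have "\<dots> = (\<integral>\<^sup>+y. ennreal (Q k (x, y)) * indicator (A \<times> B) (x, y) \<partial>\<pi>)"
        by (intro nn_integral_cong) (simp add: indicator_def)
      finally show "indicator A x * emeasure (kernel_pow \<mu> P k x) B
          = (\<integral>\<^sup>+y. ennreal (Q k (x, y)) * indicator (A \<times> B) (x, y) \<partial>\<pi>)" .
    qed
    also have "\<dots> = (\<integral>\<^sup>+z. ennreal (Q k z) * indicator (A \<times> B) z \<partial>(\<pi> \<Otimes>\<^sub>M \<pi>))"
      by (rule nn_integral_fst) measurable
    also have "\<dots> = emeasure (density (\<pi> \<Otimes>\<^sub>M \<pi>) (Q k)) (A \<times> B)"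
      by (rule emeasure_density[symmetric]) measurable
    finally show "emeasure (distr W (\<pi> \<Otimes>\<^sub>M \<pi>) (\<lambda>w. (X i w, X (i + k) w))) (A \<times> B)
        = emeasure (density (\<pi> \<Otimes>\<^sub>M \<pi>) (Q k)) (A \<times> B)" .
  qed simp_all
qed

lemma X_integral:
  fixes h :: "'a \<Rightarrow> 'c::{banach, second_countable_topology}"
  assumes "h \<in> borel_measurable \<pi>"
  shows "(\<integral>w. h (X n w) \<partial>W) = (\<integral>x. h x \<partial>\<pi>)"
    and "integrable W (\<lambda>w. h (X n w)) \<longleftrightarrow> integrable \<pi> h"
proof -
  have h: "h \<in> borel_measurable \<mu>" using assms by (simp add: measurable_pi)
  show "(\<integral>w. h (X n w) \<partial>W) = (\<integral>x. h x \<partial>\<pi>)"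
    using integral_distr[OF X_measurable h, of n] by (simp add: law_X)
  show "integrable W (\<lambda>w. h (X n w)) \<longleftrightarrow> integrable \<pi> h"
    using integrable_distr_eq[OF X_measurable h, of n] by (simp add: law_X)
qed

lemma covariance:
  assumes f: "f \<in> L2 \<pi>" and g: "g \<in> L2 \<pi>"
  shows "integrable W (\<lambda>w. f (X (i + k) w) * cnj (g (X i w)))"
    and "(\<integral>w. f (X (i + k) w) * cnj (g (X i w)) \<partial>W) = inner_L2 \<pi> (U k f) g"
proof -
  have [measurable]: "f \<in> borel_measurable \<pi>" "g \<in> borel_measurable \<pi>" using f g by (auto dest: L2_measurable)
  have "integrable W (\<lambda>w. f (X (i + k) w) * cnj (g (X i w))) \<and>
     (\<integral>w. f (X (i + k) w) * cnj (g (X i w)) \<partial>W) = inner_L2 \<pi> (U k f) g"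
  proof (cases "k = 0")
    case True
    then show ?thesis
      using X_integral[of "\<lambda>x. f x * cnj (g x)" i] inner_integrable[OF f g] by (simp add: U_def inner_L2_def)
  next
    case False
    then have k: "k \<ge> 1" by simp
    then interpret D: doubly_stochastic \<pi> "Q k" by (rule doubly_stochastic_Q)
    have Xm [measurable]: "X n \<in> W \<rightarrow>\<^sub>M \<pi>" for n
      using X_measurable by (simp add: measurable_cong_sets[OF refl sets_pi])
    have pm: "(\<lambda>w. (X i w, X (i + k) w)) \<in> W \<rightarrow>\<^sub>M \<pi> \<Otimes>\<^sub>M \<pi>" by measurable
    let ?h = "\<lambda>z. f (snd z) * cnj (g (fst z))"
    have hm: "?h \<in> borel_measurable (\<pi> \<Otimes>\<^sub>M \<pi>)" by measurable
    have "integrable (density (\<pi> \<Otimes>\<^sub>M \<pi>) (Q k)) ?h"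
      using D.form_integrable[OF D.dominated_kernels(1) f g] hm
      by (subst integrable_density) (auto simp: scaleR_conv_of_real)
    then have 1: "integrable W (\<lambda>w. ?h (X i w, X (i + k) w))"
      unfolding pair_law[OF k, of i, symmetric] integrable_distr_eq[OF pm hm] .
    have "(\<integral>w. ?h (X i w, X (i + k) w) \<partial>W) = (\<integral>z. ?h z \<partial>density (\<pi> \<Otimes>\<^sub>M \<pi>) (Q k))"
      unfolding pair_law[OF k, of i, symmetric] by (rule integral_distr[symmetric, OF pm hm])
    also have "\<dots> = D.form (Q k) f g"
      unfolding D.form_def using hm by (subst integral_density) (auto simp: scaleR_conv_of_real)
    finally show ?thesis using 1 k by (simp add: U_form f g)
  qed
  then show "integrable W (\<lambda>w. f (X (i + k) w) * cnj (g (X i w)))"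
    "(\<integral>w. f (X (i + k) w) * cnj (g (X i w)) \<partial>W) = inner_L2 \<pi> (U k f) g" by auto
qed

lemma covariance_integrable:
  assumes "f \<in> L2 \<pi>" "g \<in> L2 \<pi>"
  shows "integrable W (\<lambda>w. f (X i w) * cnj (g (X j w)))"
proof (cases "j \<le> i")
  case True
  then show ?thesis using covariance(1)[OF assms, of j "i - j"] by simp
next
  case False
  then have "integrable W (\<lambda>w. g (X j w) * cnj (f (X i w)))"
    using covariance(1)[OF assms(2,1), of i "j - i"] by simp
  then have "integrable W (\<lambda>w. cnj (g (X j w) * cnj (f (X i w))))"
    by (rule integrable_cnj)
  then show ?thesis by (simp add: mult.commute)
qed

definition centre :: "('a \<Rightarrow> complex) \<Rightarrow> 'a \<Rightarrow> complex" where
  "centre f x = f x - (\<integral>y. f y \<partial>\<pi>)"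

lemma centre_L2_0:
  assumes f: "f \<in> L2 \<pi>"
  shows "centre f \<in> L2_0 \<pi>"
proof -
  have "(\<lambda>x. - (\<integral>y. f y \<partial>\<pi>)) \<in> L2 \<pi>" by (simp add: L2_def)
  from L2_add[OF f this] have "centre f \<in> L2 \<pi>" by (simp add: centre_def[abs_def])
  moreover have "(\<integral>x. centre f x \<partial>\<pi>) = 0"
    using L2_integrable[OF f] by (simp add: centre_def[abs_def] prob_space)
  ultimately show ?thesis by (simp add: L2_0_def)
qed

lemma cvariance_sum:
  assumes g: "\<And>i. i \<in> I \<Longrightarrow> g i \<in> L2 \<pi>" and I: "finite I"
  shows "cvariance W (\<lambda>w. \<Sum>i\<in>I. g i (X i w)) = (\<integral>w. (cmod (\<Sum>i\<in>I. centre (g i) (X i w)))\<^sup>2 \<partial>W)"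
proof -
  have m: "g i \<in> borel_measurable \<pi>" if "i \<in> I" for i using g[OF that] by (rule L2_measurable)
  have "(\<integral>w. (\<Sum>i\<in>I. g i (X i w)) \<partial>W) = (\<Sum>i\<in>I. \<integral>x. g i x \<partial>\<pi>)"
    using g m by (subst Bochner_Integration.integral_sum)
      (auto simp: X_integral intro: L2_integrable)
  then show ?thesis by (simp add: cvariance_def centre_def sum_subtractf)
qed

lemma cvariance_single: "f \<in> L2 \<pi> \<Longrightarrow> cvariance W (\<lambda>w. f (X i w)) = sqnorm (centre f)"
proof -
  assume f: "f \<in> L2 \<pi>"
  have [measurable]: "centre f \<in> borel_measurable \<pi>" using centre_L2_0[OF f] by (simp add: L2_0_def L2_measurable)
  have "cvariance W (\<lambda>w. f (X i w)) = (\<integral>w. (cmod (centre f (X i w)))\<^sup>2 \<partial>W)"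
    using cvariance_sum[of "{i}" "\<lambda>_. f"] f by simp
  then show ?thesis using X_integral(1)[of "\<lambda>x. (cmod (centre f x))\<^sup>2" i] by (simp add: sqnorm_def)
qed

lemma cvariance_pi: "cvariance \<pi> f = sqnorm (centre f)"
  by (simp add: cvariance_def sqnorm_def centre_def)

text \<open>
  Along the times \<open>c, c + K, c + 2 K, \<dots>\<close> the covariances are inner products
  with powers of \<open>U K\<close>, the shape required by the block bound.
\<close>

lemma second_moment:
  assumes h: "\<And>i. h i \<in> L2_0 \<pi>"
  shows "integrable W (\<lambda>w. (cmod (\<Sum>t<L. h t (X (c + K * t) w)))\<^sup>2)"
    and "(\<integral>w. (cmod (\<Sum>t<L. h t (X (c + K * t) w)))\<^sup>2 \<partial>W)
     = (\<Sum>t<L. sqnorm (h t)) + 2 * (\<Sum>t<L. \<Sum>s\<in>{t<..<L}. Re (inner_L2 \<pi> (U (K * (s - t)) (h s)) (h t)))"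
proof -
  have hL: "h i \<in> L2 \<pi>" for i using h by (simp add: L2_0_def)
  note int = covariance_integrable[OF hL hL]
  note sm = W.second_moment_sum[of "{..<L}" "\<lambda>t w. h t (X (c + K * t) w)", OF int finite_lessThan]
  show "integrable W (\<lambda>w. (cmod (\<Sum>t<L. h t (X (c + K * t) w)))\<^sup>2)" by (rule sm(1))
  define G where "G s t = Re (\<integral>w. h s (X (c + K * s) w) * cnj (h t (X (c + K * t) w)) \<partial>W)" for s t
  have sym: "G s t = G t s" for s t
  proof -
    have "(\<integral>w. h s (X (c + K * s) w) * cnj (h t (X (c + K * t) w)) \<partial>W)
        = cnj (\<integral>w. h t (X (c + K * t) w) * cnj (h s (X (c + K * s) w)) \<partial>W)"
      by (subst Bochner_Integration.integral_cnj[symmetric]) (simp add: mult.commute)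
    then show ?thesis by (simp add: G_def)
  qed
  have Gst: "G s t = Re (inner_L2 \<pi> (U (K * (s - t)) (h s)) (h t))" if "t \<le> s" for s t
  proof -
    have "c + K * s = (c + K * t) + K * (s - t)" using that by (simp add: diff_mult_distrib2)
    then show ?thesis using covariance(2)[OF hL hL, of s "c + K * t" "K * (s - t)" t]
      unfolding G_def by (simp only:)
  qed
  have "(\<integral>w. (cmod (\<Sum>t<L. h t (X (c + K * t) w)))\<^sup>2 \<partial>W) = (\<Sum>s<L. \<Sum>t<L. G s t)"
    unfolding G_def by (rule sm(2))
  also have "\<dots> = (\<Sum>t<L. G t t) + 2 * (\<Sum>t<L. \<Sum>s\<in>{t<..<L}. G s t)"
    by (rule sum_square_upper_triangle[OF sym])
  also have "\<dots> = (\<Sum>t<L. sqnorm (h t)) + 2 * (\<Sum>t<L. \<Sum>s\<in>{t<..<L}. Re (inner_L2 \<pi> (U (K * (s - t)) (h s)) (h t)))"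
    by (auto intro!: arg_cong2[where f = "(+)"] sum.cong simp: Gst U_def inner_self[OF hL])
  finally show "(\<integral>w. (cmod (\<Sum>t<L. h t (X (c + K * t) w)))\<^sup>2 \<partial>W)
     = (\<Sum>t<L. sqnorm (h t)) + 2 * (\<Sum>t<L. \<Sum>s\<in>{t<..<L}. Re (inner_L2 \<pi> (U (K * (s - t)) (h s)) (h t)))" .
qed

context
  assumes gap_nonzero: "mh_gap \<mu> \<pi> P Ps \<noteq> 0" and Cc_finite: "finite (mh_Cc \<mu> \<pi> P Ps)"
begin

lemma semigroup_hypotheses:
  "mh_C \<mu> \<pi> P Ps \<subseteq> {1..}" "finite ({1..} - mh_C \<mu> \<pi> P Ps)"
  "0 \<le> mh_beta \<mu> \<pi> P Ps" "mh_beta \<mu> \<pi> P Ps < 1"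
  "\<And>k. k \<in> mh_C \<mu> \<pi> P Ps \<Longrightarrow> sg.num_radius_le k (mh_beta \<mu> \<pi> P Ps ^ k)"
  using Cc_finite beta_bounds[OF gap_nonzero Cc_finite] num_radius[OF gap_nonzero Cc_finite]
  by (auto simp: mh_C_def mh_Cc_def)

text \<open>
  Let \<open>K\<close> be a good time with at most \<open>\<bar>C\<^sup>c\<bar>\<close> positive
  times below it. The sum is split by residues modulo \<open>K\<close>: the second moment of
  \<open>K\<close> blocks is at most \<open>K\<close> times the sum of their second moments, and
  inside a block only powers of \<open>U K\<close> occur.
\<close>

lemma variance_sum_bound:
  assumes g: "\<And>i. i \<in> {1..n} \<Longrightarrow> g i \<in> L2 \<pi>"
  shows "cvariance W (\<lambda>w. \<Sum>i=1..n. g i (X i w))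
     \<le> (\<Sum>i=1..n. sqnorm (centre (g i))) * (real (card (mh_Cc \<mu> \<pi> P Ps)) + 2 / mh_gap \<mu> \<pi> P Ps)"
proof -
  let ?\<beta> = "mh_beta \<mu> \<pi> P Ps"
  obtain K where K: "K \<ge> 1" "?\<beta> ^ K < 1" "sg.num_radius_le K (?\<beta> ^ K)"
    "K * (2 / (1 - ?\<beta> ^ K) - 1) \<le> card (mh_Cc \<mu> \<pi> P Ps) + 2 / mh_gap \<mu> \<pi> P Ps"
    using sg.block_bound_constant[OF semigroup_hypotheses] unfolding mh_Cc_def mh_gap_def by blast
  define \<kappa> where "\<kappa> = 2 / (1 - ?\<beta> ^ K) - 1"
  define L where "L = n + 1"
  \<comment> \<open>Padding by zero makes all residue classes equally long.\<close>
  define h where "h i = (if i \<in> {1..n} then centre (g i) else 0)" for i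
  have h: "h i \<in> L2_0 \<pi>" for i
    using centre_L2_0[OF g] by (simp add: h_def)
  have "(n + 1) * 1 \<le> L * K" using K(1) unfolding L_def by (intro mult_le_mono) auto
  then have sub: "{1..n} \<subseteq> {..<L * K}" by auto
  define Z where "Z c w = (\<Sum>t<L. h (c + K * t) (X (c + K * t) w))" for c w
  have Z_int: "integrable W (\<lambda>w. (cmod (Z c w))\<^sup>2)" for c
    unfolding Z_def by (rule second_moment(1)[of "\<lambda>t. h (c + K * t)"]) (rule h)
  have Z_le: "(\<integral>w. (cmod (Z c w))\<^sup>2 \<partial>W) \<le> \<kappa> * (\<Sum>t<L. sqnorm (h (c + K * t)))" for c
    using second_moment(2)[of "\<lambda>t. h (c + K * t)" c K L] sg.block_bound[OF K(3,2), of "\<lambda>t. h (c + K * t)" L] h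
    by (simp add: Z_def \<kappa>_def nrm_sqnorm)
  have split: "(\<Sum>i\<in>{1..n}. centre (g i) (X i w)) = (\<Sum>c<K. Z c w)" for w
  proof -
    have "(\<Sum>i\<in>{1..n}. centre (g i) (X i w)) = (\<Sum>i<L * K. h i (X i w))"
      by (rule sum.mono_neutral_cong_left) (use sub in \<open>auto simp: h_def\<close>)
    then show ?thesis by (simp add: sum_nat_residues Z_def)
  qed
  have "cvariance W (\<lambda>w. \<Sum>i=1..n. g i (X i w)) = (\<integral>w. (cmod (\<Sum>c<K. Z c w))\<^sup>2 \<partial>W)"
    using cvariance_sum[where I = "{1..n}" and g = g, OF g] by (simp only: split finite_atLeastAtMost)
  also have "\<dots> \<le> (\<integral>w. real K * (\<Sum>c<K. (cmod (Z c w))\<^sup>2) \<partial>W)"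
  proof (rule integral_mono')
    show "integrable W (\<lambda>w. real K * (\<Sum>c<K. (cmod (Z c w))\<^sup>2))"
      by (intro integrable_mult_right Bochner_Integration.integrable_sum Z_int)
    fix w
    have "(cmod (\<Sum>c<K. Z c w))\<^sup>2 \<le> (\<Sum>c<K. cmod (Z c w))\<^sup>2"
      by (intro power_mono norm_sum) simp
    also have "\<dots> \<le> (\<Sum>c<K. (cmod (Z c w))\<^sup>2) * real K"
      using sum_squared_le_sum_of_squares[of "\<lambda>c. cmod (Z c w)" "{..<K}"] by simp
    finally show "(cmod (\<Sum>c<K. Z c w))\<^sup>2 \<le> real K * (\<Sum>c<K. (cmod (Z c w))\<^sup>2)" by (simp add: mult.commute)
    show "0 \<le> real K * (\<Sum>c<K. (cmod (Z c w))\<^sup>2)" by (simp add: sum_nonneg)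
  qed
  also have "\<dots> = real K * (\<Sum>c<K. \<integral>w. (cmod (Z c w))\<^sup>2 \<partial>W)"
    using Z_int by (simp add: Bochner_Integration.integral_sum)
  also have "\<dots> \<le> real K * (\<Sum>c<K. \<kappa> * (\<Sum>t<L. sqnorm (h (c + K * t))))"
    by (intro mult_left_mono sum_mono Z_le) simp
  also have "\<dots> = (real K * \<kappa>) * (\<Sum>i<L * K. sqnorm (h i))"
    by (simp add: sum_nat_residues sum_distrib_left mult.assoc)
  also have "(\<Sum>i<L * K. sqnorm (h i)) = (\<Sum>i=1..n. sqnorm (centre (g i)))"
    by (rule sum.mono_neutral_cong_right) (use sub in \<open>auto simp: h_def sqnorm_def\<close>)
  also have "(real K * \<kappa>) * \<dots> \<le> (real (card (mh_Cc \<mu> \<pi> P Ps)) + 2 / mh_gap \<mu> \<pi> P Ps) * \<dots>"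
    using K(4) by (intro mult_right_mono sum_nonneg) (auto simp: \<kappa>_def)
  finally show ?thesis by (simp add: mult.commute)
qed

text \<open>
  With \<open>r k\<close> the real part of the autocovariance at lag \<open>k\<close>, the
  variance of the sum is \<open>n \<sigma>\<^sup>2\<close> minus twice the sum over \<open>l \<le>
  n\<close> of the tails of \<open>r\<close> from \<open>l\<close> on. The bound on this sum of
  tails does not depend on \<open>n\<close>, so dividing by \<open>n\<close> also gives the limit.
\<close>

lemma asymptotic_variance:
  assumes f: "f \<in> L2 \<pi>"
  defines "B \<equiv> 4 * cvariance \<pi> f *
       (1 + real (card (mh_Cc \<mu> \<pi> P Ps))
          + 4 * mh_beta \<mu> \<pi> P Ps ^ (card (mh_Cc \<mu> \<pi> P Ps) + 1) / mh_gap \<mu> \<pi> P Ps)\<^sup>2"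
  shows "convergent (\<lambda>n. cvariance W (\<lambda>w. \<Sum>i=1..n. f (X i w)) / real n)"
    and "\<bar>cvariance W (\<lambda>w. \<Sum>i=1..n. f (X i w)) - real n * asymp_variance W X f\<bar> \<le> B"
proof -
  define f0 where "f0 = centre f"
  have f0: "f0 \<in> L2_0 \<pi>" unfolding f0_def by (rule centre_L2_0[OF f])
  define a where "a k = inner_L2 \<pi> (U k f0) f0" for k
  define r where "r k = Re (a k)" for k
  define T where "T l = (\<Sum>i. r (i + l))" for l
  define V where "V n = cvariance W (\<lambda>w. \<Sum>i=1..n. f (X i w))" for n
  define \<sigma>2 where "\<sigma>2 = sqnorm f0 + 2 * T 1"
  have a_sum: "summable a"
    unfolding a_def[abs_def] by (rule sg.autocovariance_summable[OF semigroup_hypotheses f0])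
  have a_sum_shift: "summable (\<lambda>i. a (i + l))" for l using a_sum by (subst summable_iff_shift)
  have r_sum: "summable (\<lambda>i. r (i + l))" for l
    unfolding r_def using a_sum_shift by (rule summable_Re)
  have T_eq: "T l = Re (\<Sum>i. a (i + l))" for l
    unfolding T_def r_def using bounded_linear.suminf[OF bounded_linear_Re a_sum_shift[of l]] by simp
  have T_Suc: "T l = r l + T (Suc l)" for l
    using suminf_split_head[OF r_sum[of l]] by (simp add: T_def)
  have T_split: "(\<Sum>k\<in>{1..<Suc l}. r k) = T 1 - T (Suc l)" for l
  proof (induction l)
    case (Suc l)
    then show ?case using T_Suc[of "Suc l"] by simp
  qed simp
  have V_eq: "V n = real n * \<sigma>2 - 2 * (\<Sum>l=1..n. T l)" for n
  proof -
    have "V n = (\<integral>w. (cmod (\<Sum>i=1..n. f0 (X i w)))\<^sup>2 \<partial>W)"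
      unfolding V_def f0_def by (rule cvariance_sum) (use f in auto)
    also have "\<dots> = (\<integral>w. (cmod (\<Sum>t<n. f0 (X (1 + 1 * t) w)))\<^sup>2 \<partial>W)"
    proof -
      have "(\<Sum>i=1..n. f0 (X i w)) = (\<Sum>t<n. f0 (X (1 + 1 * t) w))" for w
        by (rule sum.reindex_bij_witness[of _ "\<lambda>t. 1 + 1 * t" "\<lambda>i. i - 1"]) auto
      then show ?thesis by simp
    qed
    also have "\<dots> = real n * sqnorm f0 + 2 * (\<Sum>t<n. \<Sum>s\<in>{t<..<n}. r (s - t))"
      using second_moment(2)[of "\<lambda>_. f0" 1 1 n] f0 by (simp add: r_def a_def)
    also have "(\<Sum>t<n. \<Sum>s\<in>{t<..<n}. r (s - t)) = (\<Sum>l=1..n. \<Sum>k\<in>{1..<l}. r k)" by (rule sum_lag_double)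
    also have "\<dots> = (\<Sum>l=1..n. T 1 - T l)"
    proof (rule sum.cong[OF refl])
      fix l assume "l \<in> {1..n}"
      then show "(\<Sum>k\<in>{1..<l}. r k) = T 1 - T l" using T_split[of "l - 1"] by simp
    qed
    also have "\<dots> = real n * T 1 - (\<Sum>l=1..n. T l)" by (simp add: sum_subtractf)
    finally show ?thesis by (simp add: \<sigma>2_def algebra_simps)
  qed
  have bound: "\<bar>V n - real n * \<sigma>2\<bar> \<le> B" for n
  proof -
    have "\<bar>\<Sum>l=1..n. T l\<bar> \<le> cmod (\<Sum>l=1..n. \<Sum>i. a (i + l))"
      using abs_Re_le_cmod[of "\<Sum>l=1..n. \<Sum>i. a (i + l)"] by (simp add: T_eq)
    also have "\<dots> \<le> 2 * (1 + real (card (mh_Cc \<mu> \<pi> P Ps))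
          + 4 * mh_beta \<mu> \<pi> P Ps ^ (card (mh_Cc \<mu> \<pi> P Ps) + 1) / mh_gap \<mu> \<pi> P Ps)\<^sup>2 * sqnorm f0"
      using sg.tail_sum_bound_constant[OF semigroup_hypotheses f0, of n] f0
      by (simp add: a_def nrm_sqnorm mh_Cc_def mh_gap_def)
    finally show ?thesis by (simp add: V_eq B_def cvariance_pi f0_def abs_mult algebra_simps)
  qed
  have lim: "(\<lambda>n. V n / real n) \<longlonglongrightarrow> \<sigma>2"
  proof -
    have "(\<lambda>n. V n / real n - \<sigma>2) \<longlonglongrightarrow> 0"
    proof (rule Lim_null_comparison)
      show "eventually (\<lambda>n. norm (V n / real n - \<sigma>2) \<le> B * (1 / real n)) sequentially"
        using eventually_gt_at_top[of 0]
      proof eventually_elim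
        case (elim n)
        have "V n / real n - \<sigma>2 = (V n - real n * \<sigma>2) / real n" using elim by (simp add: field_simps)
        then show ?case using divide_right_mono[OF bound[of n], of "real n"] by simp
      qed
      show "(\<lambda>n. B * (1 / real n)) \<longlonglongrightarrow> 0"
        using tendsto_mult[OF tendsto_const[of B] lim_1_over_n] by simp
    qed
    then show ?thesis using LIM_zero_iff by blast
  qed
  then show "convergent (\<lambda>n. cvariance W (\<lambda>w. \<Sum>i=1..n. f (X i w)) / real n)"
    unfolding V_def convergent_def by blast
  have "asymp_variance W X f = \<sigma>2"
    using limI[OF lim] by (simp add: asymp_variance_def V_def)
  then show "\<bar>cvariance W (\<lambda>w. \<Sum>i=1..n. f (X i w)) - real n * asymp_variance W X f\<bar> \<le> B"
    using bound[of n] by (simp add: V_def)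
qed

end
end

section \<open>Variance bounds\<close>

theorem theorem6p1:
  fixes \<mu> \<pi> \<phi> :: "'a measure"
    and W :: "'w measure"
    and P Ps :: "'a \<Rightarrow> 'a measure"
    and p ps :: "'a \<Rightarrow> 'a \<Rightarrow> ennreal"
    and dpi :: "'a \<Rightarrow> ennreal"
    and X :: "nat \<Rightarrow> 'w \<Rightarrow> 'a"
    and f :: "'a \<Rightarrow> complex"
  assumes kernel_P: "P \<in> \<mu> \<rightarrow>\<^sub>M prob_algebra \<mu>"
    and kernel_Ps: "Ps \<in> \<mu> \<rightarrow>\<^sub>M prob_algebra \<mu>"
    and pi_prob: "prob_space \<pi>" and sets_pi: "sets \<pi> = sets \<mu>"
    and pi_stationary: "stationary \<pi> P"
    and Ps_reversal: "time_reversal \<pi> P Ps"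
    and irreducible: "phi_irreducible \<mu> \<phi> P"
    and p_meas: "(\<lambda>(x, y). p x y) \<in> borel_measurable (\<mu> \<Otimes>\<^sub>M \<mu>)"
    and ps_meas: "(\<lambda>(x, y). ps x y) \<in> borel_measurable (\<mu> \<Otimes>\<^sub>M \<mu>)"
    and dpi_meas: "dpi \<in> borel_measurable \<mu>"
    and P_density: "\<And>x. x \<in> space \<mu> \<Longrightarrow> P x = density \<mu> (p x)"
    and Ps_density: "\<And>x. x \<in> space \<mu> \<Longrightarrow> Ps x = density \<mu> (ps x)"
    and pi_density: "\<pi> = density \<mu> dpi"
    and dpi_pos: "{x \<in> space \<mu>. dpi x = 0} \<in> null_sets \<mu>"
    and chain: "markov_chain W \<mu> P X"
    and initial: "distr W \<mu> (X 0) = \<pi>"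
    and f_L2: "f \<in> L2 \<pi>"
    and gap_nonzero: "mh_gap \<mu> \<pi> P Ps \<noteq> 0"
    and Cc_finite: "finite (mh_Cc \<mu> \<pi> P Ps)"
  shows "(\<forall>n. cvariance W (\<lambda>w. \<Sum>i=1..n. f (X i w))
              \<le> real n * cvariance \<pi> f *
                  (real (card (mh_Cc \<mu> \<pi> P Ps)) + 2 / mh_gap \<mu> \<pi> P Ps)) \<and>
         convergent (\<lambda>n. cvariance W (\<lambda>w. \<Sum>i=1..n. f (X i w)) / real n) \<and>
         (\<forall>n. \<bar>cvariance W (\<lambda>w. \<Sum>i=1..n. f (X i w)) - real n * asymp_variance W X f\<bar>
              \<le> 4 * cvariance \<pi> f *
                  (1 + real (card (mh_Cc \<mu> \<pi> P Ps))
                     + 4 * mh_beta \<mu> \<pi> P Ps ^ (card (mh_Cc \<mu> \<pi> P Ps) + 1)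
                         / mh_gap \<mu> \<pi> P Ps)\<^sup>2) \<and>
         (\<forall>n (g :: nat \<Rightarrow> 'a \<Rightarrow> complex). (\<forall>i\<in>{1..n}. g i \<in> L2 \<pi>) \<longrightarrow>
            cvariance W (\<lambda>w. \<Sum>i=1..n. g i (X i w))
              \<le> (\<Sum>i=1..n. cvariance W (\<lambda>w. g i (X i w)) *
                  (real (card (mh_Cc \<mu> \<pi> P Ps)) + 2 / mh_gap \<mu> \<pi> P Ps)))"
proof -
  interpret density_chain_process \<mu> \<pi> P Ps p ps dpi W X
    by (intro density_chain_process.intro density_chain.intro density_chain_process_axioms.intro)
      (fact kernel_P kernel_Ps pi_prob sets_pi Ps_reversal p_meas ps_meas dpi_meas
      P_density Ps_density pi_density dpi_pos pi_stationary chain initial)+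
  show ?thesis
  proof (intro conjI allI impI)
    fix n
    show "cvariance W (\<lambda>w. \<Sum>i=1..n. f (X i w))
        \<le> real n * cvariance \<pi> f * (real (card (mh_Cc \<mu> \<pi> P Ps)) + 2 / mh_gap \<mu> \<pi> P Ps)"
      using variance_sum_bound[OF gap_nonzero Cc_finite, of n "\<lambda>_. f"] f_L2 by (simp add: cvariance_pi)
    show "convergent (\<lambda>n. cvariance W (\<lambda>w. \<Sum>i=1..n. f (X i w)) / real n)"
      by (rule asymptotic_variance(1)[OF gap_nonzero Cc_finite f_L2])
    show "\<bar>cvariance W (\<lambda>w. \<Sum>i=1..n. f (X i w)) - real n * asymp_variance W X f\<bar>
        \<le> 4 * cvariance \<pi> f *
            (1 + real (card (mh_Cc \<mu> \<pi> P Ps))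
               + 4 * mh_beta \<mu> \<pi> P Ps ^ (card (mh_Cc \<mu> \<pi> P Ps) + 1) / mh_gap \<mu> \<pi> P Ps)\<^sup>2"
      by (rule asymptotic_variance(2)[OF gap_nonzero Cc_finite f_L2])
  next
    fix n and g :: "nat \<Rightarrow> 'a \<Rightarrow> complex"
    assume g: "\<forall>i\<in>{1..n}. g i \<in> L2 \<pi>"
    then have "(\<Sum>i=1..n. cvariance W (\<lambda>w. g i (X i w))) = (\<Sum>i=1..n. sqnorm (centre (g i)))"
      by (intro sum.cong refl cvariance_single) auto
    then show "cvariance W (\<lambda>w. \<Sum>i=1..n. g i (X i w))
        \<le> (\<Sum>i=1..n. cvariance W (\<lambda>w. g i (X i w)) *
            (real (card (mh_Cc \<mu> \<pi> P Ps)) + 2 / mh_gap \<mu> \<pi> P Ps))"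
      using variance_sum_bound[OF gap_nonzero Cc_finite, of n g] g by (simp flip: sum_distrib_right)
  qed
qed

end
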